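(* Let $\pi\colon P\to M$ be a principal $\mathbb{X}$-bundle for a Lie groupoid $\mathbb{X}=[X_1\rightrightarrows X_0]$, and let $\sigma$ be a Cartan connection on $\mathbb{X}$. Then there is a one-to-one correspondence between quasi-connections $F\colon\mathcal{A}\mathfrak{t}(P)\to\mathcal{A}\mathfrak{d}(P)$ and connection forms $\omega\colon TP\to P\times_{X_0}A$ on $P$, in which $\omega$ corresponds to the quasi-connection $F_0(p,u,v)=(p,\omega_p(u),v)$, $F_1((p,u,v),g)=((p,\omega_p(u),v),g)$.
   Context: Lie groupoid $\mathbb{X}=[X_1\rightrightarrows X_0]$: source $s$, target $t$ are submersions, $gh$ is defined when $s(g)=t(h)$, units $1_x$, inversion $i$. For tangent vectors, $\beta.\alpha:=dm_{(g,h)}(\beta,\alpha)$, $m$ the composition. Right action on $P$ with anchor $a\colon P\to X_0$: $pg$ is defined when $a(p)=t(g)$, $a(pg)=s(g)$, $(pg)h=p(gh)$, $p1_{a(p)}=p$; for $(u,\beta)$ tangent to $P\times_{a,X_0,t}X_1$ at $(p,g)$, $u.\beta\in T_{pg}P$ is its image under the differential of the action. Principal $\mathbb{X}$-bundle: a surjective submersion $\pi\colon P\to M$ with a right action, $\pi(pg)=\pi(p)$, and $(p,g)\mapsto(p,pg)$ a diffeomorphism $P\times_{X_0}X_1\to P\times_MP$. Lie algebroid $A\to X_0$: $A_x=\ker(ds)_{1_x}$. $r_g\colon A_{t(g)}\to T_gX_1$ is the differential at $1_{t(g)}$ of $h\mapsto hg$; $l_g\colon A_{s(g)}\to T_gX_1$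 is the differential at $1_{s(g)}$ of $h\mapsto gh^{-1}$ on $s^{-1}(s(g))$. Ehresmann connection: a subbundle $\mathbb{H}\subset TX_1$ with $TX_1=\mathbb{H}\oplus\ker ds$ and $\mathbb{H}_{1_x}=(d1)_x(T_xX_0)$; $\sigma_g\colon T_{s(g)}X_0\to\mathbb{H}_g$ is the inverse of $ds|_{\mathbb{H}_g}$; $\psi_g\colon T_gX_1\to A_{t(g)}$ satisfies $r_g\psi_g+\sigma_g(ds)_g=\mathrm{Id}$. Put $\lambda^0_g=-\psi_gl_g$ on $A_{s(g)}$, $\lambda^1_g=(dt)_g\sigma_g$ on $T_{s(g)}X_0$, and the basic curvature $K(g,h)(v)=-\psi_{gh}(\sigma_g(\lambda^1_hv).\sigma_h(v))\in A_{t(g)}$, $v\in T_{s(h)}X_0$. The connection is Cartan if $K\equiv0$. For $a(p)=t(g)$, $\tau_g\colon T_pP\to T_{pg}P$, $\tau_g(u)=u.(di)_{g^{-1}}\sigma_{g^{-1}}(da)_p(u)$. $d\delta_p\colon A_{a(p)}\to T_pP$ is the differential at $1_{a(p)}$ of $h\mapsto ph^{-1}$ on $s^{-1}(a(p))$. Connection form: a smooth vector bundle map $\omega\colon TP\to P\times_{X_0}A$ over $P$ with $\omega_{pg}(\tau_g(u))=\lambda^0_{g^{-1}}(\omega_p(u))$ for $u\in T_pP$, $a(p)=t(g)$, and $\omega_p(d\delta_p(\alpha))=\alpha$ for $\alpha\in A_{a(p)}$. For a Cartan connection all of $\lambda^0,\lambda^1,\tau$ are functorial, and the groupoids are: $\mathcal{A}\mathfrak{d}(P)$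 with objects $(p,\alpha,v)\in P\times_{X_0}A\oplus a^*TX_0$ and arrows $((p,\alpha,v),g)$, $a(p)=t(g)$, from $(p,\alpha,v)$ to $(pg,\lambda^0_{g^{-1}}\alpha,\lambda^1_{g^{-1}}v)$; $\mathcal{A}\mathfrak{t}(P)$ with objects $(p,u,v)\in TP\oplus a^*TX_0$ and arrows $((p,u,v),g)$, $a(p)=t(g)$, from $(p,u,v)$ to $(pg,\tau_gu,\lambda^1_{g^{-1}}v)$; composition multiplies the $X_1$-components. Both map to the discrete category $M$ by $\bar\pi$ (object or arrow over $p$ goes to $\pi(p)$). The set $\mathfrak{Conn}(\bar\pi^{-1}(m))$ of isomorphism classes in the fibre over $m$ is a graded vector space via $\langle(p,\alpha,v)\rangle+\langle(pg,\beta,v')\rangle=\langle(pg,\lambda^0_{g^{-1}}\alpha+\beta,\lambda^1_{g^{-1}}v+v')\rangle$ (with $\tau_g$ in place of $\lambda^0_{g^{-1}}$ for $\mathcal{A}\mathfrak{t}(P)$). $\overline{d\delta}\colon\mathcal{A}\mathfrak{d}(P)\to\mathcal{A}\mathfrak{t}(P)$ is $(p,\alpha,v)\mapsto(p,d\delta_p(\alpha),v)$, $((p,\alpha,v),g)\mapsto((p,d\delta_p(\alpha),v),g)$. Quasi-connection: a functor $F=(F_0,F_1)\colon\mathcal{A}\mathfrak{t}(P)\to\mathcal{A}\mathfrak{d}(P)$ over $M$ such that (1) $F\circ\overline{d\delta}=\mathrm{Id}_{\mathcal{A}\mathfrak{d}(P)}$; (2) $F_0$ is a map of (diffeological) graded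 vector bundles over $P$ (smooth, over the identity of $P$, fibrewise linear, degree preserving); (3) the induced map $\mathfrak{Conn}(\bar\pi^{-1}_{\mathcal{A}\mathfrak{t}(P)}(m))\to\mathfrak{Conn}(\bar\pi^{-1}_{\mathcal{A}\mathfrak{d}(P)}(m))$ is linear for each $m\in M$. *)

theory Defs
  imports "HOL-Analysis.Analysis"
begin

section \<open>Smooth manifolds\<close>

primrec times_differentiable_on ::
  "nat \<Rightarrow> 'a::real_normed_vector set \<Rightarrow> ('a \<Rightarrow> 'b::real_normed_vector) \<Rightarrow> bool" where
  "times_differentiable_on 0 S f \<longleftrightarrow> continuous_on S f"
| "times_differentiable_on (Suc n) S f \<longleftrightarrow> (\<forall>x\<in>S. f differentiable (at x)) \<and>
     (\<forall>v. times_differentiable_on n S (\<lambda>x. frechet_derivative f (at x) v))"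

definition smooth_on :: "'a::real_normed_vector set \<Rightarrow> ('a \<Rightarrow> 'b::real_normed_vector) \<Rightarrow> bool" where
  "smooth_on S f \<longleftrightarrow> (\<forall>n. times_differentiable_on n S f)"

text \<open>A chart is a pair of its domain and its coordinate map (the values of the latter outside
  the domain are irrelevant). A manifold is given by an atlas, which also determines its
  underlying set and its topology. The model space is a finite-dimensional normed space rather
  than a type of class \<open>euclidean_space\<close>, since the latter excludes dimension zero (a Lie group
  is a Lie groupoid over a point); the instance below provides a zero-dimensional model space.\<close>

instantiation unit :: real_normed_vector
begin
definition "(0::unit) = ()"
definition "(x::unit) + y = ()"
definition "scaleR (r::real) (x::unit) = ()"
definition "norm (x::unit) = (0::real)"
definition "dist (x::unit) (y::unit) = (0::real)"
definition "sgn (x::unit) = ()"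
definition "(uniformity :: (unit \<times> unit) filter) = (INF e\<in>{0<..}. principal {(x, y). dist x y < e})"
definition "open (U::unit set) \<longleftrightarrow> (\<forall>x\<in>U. eventually (\<lambda>(x', y). x' = x \<longrightarrow> y \<in> U) uniformity)"
instance
  by standard (simp_all add: norm_unit_def dist_unit_def uniformity_unit_def open_unit_def)
end

type_synonym ('a, 'e) chart = "'a set \<times> ('a \<Rightarrow> 'e)"
type_synonym ('a, 'e) atlas = "('a, 'e) chart set"

definition carrier :: "('a, 'e) atlas \<Rightarrow> 'a set" where
  "carrier A = (\<Union>c\<in>A. fst c)"

definition chart_inv :: "('a, 'e) chart \<Rightarrow> 'e \<Rightarrow> 'a" where
  "chart_inv c = inv_into (fst c) (snd c)"

definition mfd_open :: "('a, 'e::real_normed_vector) atlas \<Rightarrow> 'a set \<Rightarrow> bool" where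
  "mfd_open A W \<longleftrightarrow> W \<subseteq> carrier A \<and> (\<forall>c\<in>A. open (snd c ` (W \<inter> fst c)))"

definition manifold :: "('a, 'e::real_normed_vector) atlas \<Rightarrow> bool" where
  "manifold A \<longleftrightarrow>
     (\<exists>B::'e set. finite B \<and> span B = UNIV) \<and>
     (\<forall>c\<in>A. inj_on (snd c) (fst c) \<and> open (snd c ` fst c)) \<and>
     (\<forall>c\<in>A. \<forall>d\<in>A. open (snd c ` (fst c \<inter> fst d)) \<and>
        smooth_on (snd c ` (fst c \<inter> fst d)) (snd d \<circ> chart_inv c)) \<and>
     (\<forall>p\<in>carrier A. \<forall>q\<in>carrier A. p \<noteq> q \<longrightarrow>
        (\<exists>V W. mfd_open A V \<and> mfd_open A W \<and> p \<in> V \<and> q \<in> W \<and> V \<inter> W = {})) \<and>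
     (\<exists>C\<subseteq>A. countable C \<and> carrier C = carrier A)"

definition smooth_near ::
  "('a, 'e::real_normed_vector) atlas \<Rightarrow> ('b, 'f::real_normed_vector) atlas \<Rightarrow> ('a \<Rightarrow> 'b) \<Rightarrow> 'a \<Rightarrow> bool" where
  "smooth_near A B f p \<longleftrightarrow> (\<exists>c\<in>A. \<exists>d\<in>B. \<exists>W. mfd_open A W \<and> p \<in> W \<and> W \<subseteq> fst c \<and> f ` W \<subseteq> fst d \<and>
     smooth_on (snd c ` W) (snd d \<circ> f \<circ> chart_inv c))"

text \<open>Maps on (embedded) submanifolds, such as fibres and fibre products, are smooth iff they
  extend locally to smooth maps on the ambient manifold.\<close>

definition extends_near ::
  "('a, 'e::real_normed_vector) atlas \<Rightarrow> ('b, 'f::real_normed_vector) atlas \<Rightarrow> 'a set \<Rightarrow> ('a \<Rightarrow> 'b)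
    \<Rightarrow> 'a \<Rightarrow> ('a \<Rightarrow> 'b) \<Rightarrow> bool" where
  "extends_near A B S f p F \<longleftrightarrow> smooth_near A B F p \<and>
     (\<exists>W. mfd_open A W \<and> p \<in> W \<and> (\<forall>q\<in>W \<inter> S. F q = f q))"

definition smooth_map_on ::
  "('a, 'e::real_normed_vector) atlas \<Rightarrow> ('b, 'f::real_normed_vector) atlas \<Rightarrow> 'a set \<Rightarrow> ('a \<Rightarrow> 'b) \<Rightarrow> bool" where
  "smooth_map_on A B S f \<longleftrightarrow> S \<subseteq> carrier A \<and> (\<forall>p\<in>S. \<exists>F. extends_near A B S f p F)"

abbreviation smooth_map ::
  "('a, 'e::real_normed_vector) atlas \<Rightarrow> ('b, 'f::real_normed_vector) atlas \<Rightarrow> ('a \<Rightarrow> 'b) \<Rightarrow> bool" where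
  "smooth_map A B f \<equiv> smooth_map_on A B (carrier A) f"

definition prod_atlas :: "('a, 'e) atlas \<Rightarrow> ('b, 'f) atlas \<Rightarrow> ('a \<times> 'b, 'e \<times> 'f) atlas" where
  "prod_atlas A B = (\<lambda>(c, d). (fst c \<times> fst d, map_prod (snd c) (snd d))) ` (A \<times> B)"

section \<open>Tangent vectors\<close>

text \<open>A tangent vector consists of its base point and of its components in all charts at that
  point; the components in different charts are related by the derivative of the transition map,
  and are set to zero for charts not containing the base point.\<close>

type_synonym ('a, 'e) tvec = "'a \<times> (('a, 'e) chart \<Rightarrow> 'e)"

definition tangent_bundle :: "('a, 'e::real_normed_vector) atlas \<Rightarrow> ('a, 'e) tvec set" where
  "tangent_bundle A = {(p, \<xi>). p \<in> carrier A \<and>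
     (\<forall>c. c \<notin> A \<or> p \<notin> fst c \<longrightarrow> \<xi> c = 0) \<and>
     (\<forall>c\<in>A. \<forall>d\<in>A. p \<in> fst c \<inter> fst d \<longrightarrow>
        \<xi> d = frechet_derivative (snd d \<circ> chart_inv c) (at (snd c p)) (\<xi> c))}"

definition tangent_space :: "('a, 'e::real_normed_vector) atlas \<Rightarrow> 'a \<Rightarrow> ('a, 'e) tvec set" where
  "tangent_space A p = {\<xi> \<in> tangent_bundle A. fst \<xi> = p}"

definition tangent_atlas :: "('a, 'e::real_normed_vector) atlas \<Rightarrow> (('a, 'e) tvec, 'e \<times> 'e) atlas" where
  "tangent_atlas A =
     (\<lambda>c. ({\<xi> \<in> tangent_bundle A. fst \<xi> \<in> fst c}, \<lambda>\<xi>. (snd c (fst \<xi>), snd \<xi> c))) ` A"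

definition tzero :: "'a \<Rightarrow> ('a, 'e::real_normed_vector) tvec" where
  "tzero p = (p, \<lambda>_. 0)"

definition tadd :: "('a, 'e::real_normed_vector) tvec \<Rightarrow> ('a, 'e) tvec \<Rightarrow> ('a, 'e) tvec" where
  "tadd \<xi> \<eta> = (fst \<xi>, \<lambda>c. snd \<xi> c + snd \<eta> c)"

definition tscale :: "real \<Rightarrow> ('a, 'e::real_normed_vector) tvec \<Rightarrow> ('a, 'e) tvec" where
  "tscale r \<xi> = (fst \<xi>, \<lambda>c. r *\<^sub>R snd \<xi> c)"

definition tlincomb ::
  "'a \<Rightarrow> nat \<Rightarrow> (nat \<Rightarrow> real) \<Rightarrow> (nat \<Rightarrow> ('a, 'e::real_normed_vector) tvec) \<Rightarrow> ('a, 'e) tvec" where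
  "tlincomb p k r Y = (p, \<lambda>c. \<Sum>i<k. r i *\<^sub>R snd (Y i) c)"

text \<open>Differential of a map that is smooth near the base point.\<close>

definition tmap ::
  "('a, 'e::real_normed_vector) atlas \<Rightarrow> ('b, 'f::real_normed_vector) atlas \<Rightarrow> ('a \<Rightarrow> 'b)
    \<Rightarrow> ('a, 'e) tvec \<Rightarrow> ('b, 'f) tvec" where
  "tmap A B f \<xi> = (let p = fst \<xi>; c = (SOME c. c \<in> A \<and> p \<in> fst c) in
     (f p, \<lambda>d. if d \<in> B \<and> f p \<in> fst d
               then frechet_derivative (snd d \<circ> f \<circ> chart_inv c) (at (snd c p)) (snd \<xi> c)
               else 0))"

text \<open>Differential of a smooth map on a submanifold \<open>S\<close>, to be applied to tangent vectors of \<open>S\<close>,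
  on which it does not depend on the chosen local extension.\<close>

definition tmap_on ::
  "('a, 'e::real_normed_vector) atlas \<Rightarrow> ('b, 'f::real_normed_vector) atlas \<Rightarrow> 'a set \<Rightarrow> ('a \<Rightarrow> 'b)
    \<Rightarrow> ('a, 'e) tvec \<Rightarrow> ('b, 'f) tvec" where
  "tmap_on A B S f \<xi> = tmap A B (SOME F. extends_near A B S f (fst \<xi>) F) \<xi>"

definition tpair ::
  "('a, 'e::real_normed_vector) atlas \<Rightarrow> ('b, 'f::real_normed_vector) atlas
    \<Rightarrow> ('a, 'e) tvec \<Rightarrow> ('b, 'f) tvec \<Rightarrow> ('a \<times> 'b, 'e \<times> 'f) tvec" where
  "tpair A B \<xi> \<eta> = (THE \<zeta>. \<zeta> \<in> tangent_bundle (prod_atlas A B) \<and>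
     tmap (prod_atlas A B) A fst \<zeta> = \<xi> \<and> tmap (prod_atlas A B) B snd \<zeta> = \<eta>)"

definition submersion ::
  "('a, 'e::real_normed_vector) atlas \<Rightarrow> ('b, 'f::real_normed_vector) atlas \<Rightarrow> ('a \<Rightarrow> 'b) \<Rightarrow> bool" where
  "submersion A B f \<longleftrightarrow> smooth_map A B f \<and>
     (\<forall>p\<in>carrier A. tmap A B f ` tangent_space A p = tangent_space B (f p))"

definition diffeo_on ::
  "('a, 'e::real_normed_vector) atlas \<Rightarrow> ('b, 'f::real_normed_vector) atlas
    \<Rightarrow> 'a set \<Rightarrow> 'b set \<Rightarrow> ('a \<Rightarrow> 'b) \<Rightarrow> bool" where
  "diffeo_on A B S T f \<longleftrightarrow> bij_betw f S T \<and> smooth_map_on A B S f \<and>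
     smooth_map_on B A T (inv_into S f)"

definition smooth_subbundle :: "('a, 'e::real_normed_vector) atlas \<Rightarrow> ('a, 'e) tvec set \<Rightarrow> bool" where
  "smooth_subbundle A H \<longleftrightarrow> H \<subseteq> tangent_bundle A \<and>
     (\<forall>p\<in>carrier A. \<exists>W k Y. mfd_open A W \<and> p \<in> W \<and>
        (\<forall>i<k. smooth_map_on A (tangent_atlas A) W (Y i) \<and> (\<forall>q\<in>W. Y i q \<in> tangent_space A q)) \<and>
        (\<forall>q\<in>W. bij_betw (\<lambda>r. tlincomb q k r (\<lambda>i. Y i q)) (extensional {..<k}) {\<xi>\<in>H. fst \<xi> = q}))"

section \<open>Lie groupoids and principal bundles\<close>

record ('g, 'f, 'x, 'e) lie_groupoid =
  arrs :: "('g, 'f) atlas"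
  objs :: "('x, 'e) atlas"
  src :: "'g \<Rightarrow> 'x"
  tgt :: "'g \<Rightarrow> 'x"
  unt :: "'x \<Rightarrow> 'g"
  ivs :: "'g \<Rightarrow> 'g"
  mul :: "'g \<Rightarrow> 'g \<Rightarrow> 'g"

abbreviation "X1 G \<equiv> carrier (arrs G)"
abbreviation "X0 G \<equiv> carrier (objs G)"

definition composable :: "('g, 'f, 'x, 'e) lie_groupoid \<Rightarrow> ('g \<times> 'g) set" where
  "composable G = {(g, h). g \<in> X1 G \<and> h \<in> X1 G \<and> src G g = tgt G h}"

definition is_lie_groupoid ::
  "('g, 'f::real_normed_vector, 'x, 'e::real_normed_vector) lie_groupoid \<Rightarrow> bool" where
  "is_lie_groupoid G \<longleftrightarrow>
     manifold (arrs G) \<and> manifold (objs G) \<and>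
     submersion (arrs G) (objs G) (src G) \<and> submersion (arrs G) (objs G) (tgt G) \<and>
     smooth_map (objs G) (arrs G) (unt G) \<and> smooth_map (arrs G) (arrs G) (ivs G) \<and>
     smooth_map_on (prod_atlas (arrs G) (arrs G)) (arrs G) (composable G) (\<lambda>(g, h). mul G g h) \<and>
     (\<forall>(g, h)\<in>composable G. mul G g h \<in> X1 G \<and>
        src G (mul G g h) = src G h \<and> tgt G (mul G g h) = tgt G g) \<and>
     (\<forall>g h k. (g, h) \<in> composable G \<and> (h, k) \<in> composable G \<longrightarrow>
        mul G (mul G g h) k = mul G g (mul G h k)) \<and>
     (\<forall>x\<in>X0 G. unt G x \<in> X1 G \<and> src G (unt G x) = x \<and> tgt G (unt G x) = x) \<and>
     (\<forall>g\<in>X1 G. mul G (unt G (tgt G g)) g = g \<and> mul G g (unt G (src G g)) = g) \<and>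
     (\<forall>g\<in>X1 G. ivs G g \<in> X1 G \<and> src G (ivs G g) = tgt G g \<and> tgt G (ivs G g) = src G g \<and>
        mul G g (ivs G g) = unt G (tgt G g) \<and> mul G (ivs G g) g = unt G (src G g))"

record ('p, 'k, 'm, 'l, 'x, 'g) pbundle =
  tot :: "('p, 'k) atlas"
  base :: "('m, 'l) atlas"
  proj :: "'p \<Rightarrow> 'm"
  anc :: "'p \<Rightarrow> 'x"
  act :: "'p \<Rightarrow> 'g \<Rightarrow> 'p"

definition actable ::
  "('g, 'f, 'x, 'e) lie_groupoid \<Rightarrow> ('p, 'k, 'm, 'l, 'x, 'g) pbundle \<Rightarrow> ('p \<times> 'g) set" where
  "actable G P = {(p, g). p \<in> carrier (tot P) \<and> g \<in> X1 G \<and> anc P p = tgt G g}"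

definition right_action ::
  "('g, 'f::real_normed_vector, 'x, 'e::real_normed_vector) lie_groupoid \<Rightarrow>
   ('p, 'k::real_normed_vector, 'm, 'l, 'x, 'g) pbundle \<Rightarrow> bool" where
  "right_action G P \<longleftrightarrow>
     smooth_map (tot P) (objs G) (anc P) \<and>
     smooth_map_on (prod_atlas (tot P) (arrs G)) (tot P) (actable G P) (\<lambda>(p, g). act P p g) \<and>
     (\<forall>(p, g)\<in>actable G P. act P p g \<in> carrier (tot P) \<and> anc P (act P p g) = src G g) \<and>
     (\<forall>p g h. (p, g) \<in> actable G P \<and> (g, h) \<in> composable G \<longrightarrow>
        act P (act P p g) h = act P p (mul G g h)) \<and>
     (\<forall>p\<in>carrier (tot P). act P p (unt G (anc P p)) = p)"

definition principal_bundle ::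
  "('g, 'f::real_normed_vector, 'x, 'e::real_normed_vector) lie_groupoid \<Rightarrow>
   ('p, 'k::real_normed_vector, 'm, 'l::real_normed_vector, 'x, 'g) pbundle \<Rightarrow> bool" where
  "principal_bundle G P \<longleftrightarrow>
     manifold (tot P) \<and> manifold (base P) \<and>
     submersion (tot P) (base P) (proj P) \<and> proj P ` carrier (tot P) = carrier (base P) \<and>
     right_action G P \<and>
     (\<forall>(p, g)\<in>actable G P. proj P (act P p g) = proj P p) \<and>
     diffeo_on (prod_atlas (tot P) (arrs G)) (prod_atlas (tot P) (tot P)) (actable G P)
       {(p, q). p \<in> carrier (tot P) \<and> q \<in> carrier (tot P) \<and> proj P p = proj P q}
       (\<lambda>(p, g). (p, act P p g))"

section \<open>Lie algebroid and Cartan connections\<close>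

definition d_src where "d_src G = tmap (arrs G) (objs G) (src G)"
definition d_tgt where "d_tgt G = tmap (arrs G) (objs G) (tgt G)"
definition d_unt where "d_unt G = tmap (objs G) (arrs G) (unt G)"
definition d_ivs where "d_ivs G = tmap (arrs G) (arrs G) (ivs G)"

definition ker_dsrc ::
  "('g, 'f::real_normed_vector, 'x, 'e::real_normed_vector) lie_groupoid \<Rightarrow> 'g \<Rightarrow> ('g, 'f) tvec set" where
  "ker_dsrc G g = {\<xi> \<in> tangent_space (arrs G) g. d_src G \<xi> = tzero (src G g)}"

definition algebroid ::
  "('g, 'f::real_normed_vector, 'x, 'e::real_normed_vector) lie_groupoid \<Rightarrow> 'x \<Rightarrow> ('g, 'f) tvec set" where
  "algebroid G x = ker_dsrc G (unt G x)"

definition d_mul ::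
  "('g, 'f::real_normed_vector, 'x, 'e::real_normed_vector) lie_groupoid
    \<Rightarrow> ('g, 'f) tvec \<Rightarrow> ('g, 'f) tvec \<Rightarrow> ('g, 'f) tvec" where
  "d_mul G \<beta> \<alpha> = tmap_on (prod_atlas (arrs G) (arrs G)) (arrs G) (composable G) (\<lambda>(g, h). mul G g h)
     (tpair (arrs G) (arrs G) \<beta> \<alpha>)"

definition d_act ::
  "('g, 'f::real_normed_vector, 'x, 'e::real_normed_vector) lie_groupoid \<Rightarrow>
   ('p, 'k::real_normed_vector, 'm, 'l, 'x, 'g) pbundle \<Rightarrow> ('p, 'k) tvec \<Rightarrow> ('g, 'f) tvec \<Rightarrow> ('p, 'k) tvec" where
  "d_act G P u \<beta> = tmap_on (prod_atlas (tot P) (arrs G)) (tot P) (actable G P) (\<lambda>(p, g). act P p g)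
     (tpair (tot P) (arrs G) u \<beta>)"

definition right_transl ::
  "('g, 'f::real_normed_vector, 'x, 'e::real_normed_vector) lie_groupoid \<Rightarrow> 'g \<Rightarrow> ('g, 'f) tvec \<Rightarrow> ('g, 'f) tvec" where
  "right_transl G g = tmap_on (arrs G) (arrs G) {h \<in> X1 G. src G h = tgt G g} (\<lambda>h. mul G h g)"

definition left_transl ::
  "('g, 'f::real_normed_vector, 'x, 'e::real_normed_vector) lie_groupoid \<Rightarrow> 'g \<Rightarrow> ('g, 'f) tvec \<Rightarrow> ('g, 'f) tvec" where
  "left_transl G g = tmap_on (arrs G) (arrs G) {h \<in> X1 G. src G h = src G g} (\<lambda>h. mul G g (ivs G h))"

definition d_orbit ::
  "('g, 'f::real_normed_vector, 'x, 'e::real_normed_vector) lie_groupoid \<Rightarrow>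
   ('p, 'k::real_normed_vector, 'm, 'l, 'x, 'g) pbundle \<Rightarrow> 'p \<Rightarrow> ('g, 'f) tvec \<Rightarrow> ('p, 'k) tvec" where
  "d_orbit G P p = tmap_on (arrs G) (tot P) {h \<in> X1 G. src G h = anc P p} (\<lambda>h. act P p (ivs G h))"

definition fibre_of :: "('g, 'f) tvec set \<Rightarrow> 'g \<Rightarrow> ('g, 'f) tvec set" where
  "fibre_of H g = {\<xi> \<in> H. fst \<xi> = g}"

definition ehresmann_connection ::
  "('g, 'f::real_normed_vector, 'x, 'e::real_normed_vector) lie_groupoid \<Rightarrow> ('g, 'f) tvec set \<Rightarrow> bool" where
  "ehresmann_connection G H \<longleftrightarrow> smooth_subbundle (arrs G) H \<and>
     (\<forall>g\<in>X1 G. \<forall>\<xi>\<in>tangent_space (arrs G) g.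
        \<exists>!\<eta>\<kappa>. fst \<eta>\<kappa> \<in> fibre_of H g \<and> snd \<eta>\<kappa> \<in> ker_dsrc G g \<and> \<xi> = tadd (fst \<eta>\<kappa>) (snd \<eta>\<kappa>)) \<and>
     (\<forall>x\<in>X0 G. fibre_of H (unt G x) = d_unt G ` tangent_space (objs G) x)"

definition hlift ::  \<comment> \<open>\<open>\<sigma>\<^sub>g\<close>\<close>
  "('g, 'f::real_normed_vector, 'x, 'e::real_normed_vector) lie_groupoid \<Rightarrow> ('g, 'f) tvec set
    \<Rightarrow> 'g \<Rightarrow> ('x, 'e) tvec \<Rightarrow> ('g, 'f) tvec" where
  "hlift G H g = inv_into (fibre_of H g) (d_src G)"

definition vproj ::  \<comment> \<open>\<open>\<psi>\<^sub>g\<close>\<close>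
  "('g, 'f::real_normed_vector, 'x, 'e::real_normed_vector) lie_groupoid \<Rightarrow> ('g, 'f) tvec set
    \<Rightarrow> 'g \<Rightarrow> ('g, 'f) tvec \<Rightarrow> ('g, 'f) tvec" where
  "vproj G H g \<xi> = (THE \<alpha>. \<alpha> \<in> algebroid G (tgt G g) \<and>
     tadd (right_transl G g \<alpha>) (hlift G H g (d_src G \<xi>)) = \<xi>)"

definition lam0 ::
  "('g, 'f::real_normed_vector, 'x, 'e::real_normed_vector) lie_groupoid \<Rightarrow> ('g, 'f) tvec set
    \<Rightarrow> 'g \<Rightarrow> ('g, 'f) tvec \<Rightarrow> ('g, 'f) tvec" where
  "lam0 G H g \<alpha> = tscale (-1) (vproj G H g (left_transl G g \<alpha>))"

definition lam1 ::
  "('g, 'f::real_normed_vector, 'x, 'e::real_normed_vector) lie_groupoid \<Rightarrow> ('g, 'f) tvec set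
    \<Rightarrow> 'g \<Rightarrow> ('x, 'e) tvec \<Rightarrow> ('x, 'e) tvec" where
  "lam1 G H g v = d_tgt G (hlift G H g v)"

definition basic_curvature ::
  "('g, 'f::real_normed_vector, 'x, 'e::real_normed_vector) lie_groupoid \<Rightarrow> ('g, 'f) tvec set
    \<Rightarrow> 'g \<Rightarrow> 'g \<Rightarrow> ('x, 'e) tvec \<Rightarrow> ('g, 'f) tvec" where
  "basic_curvature G H g h v =
     tscale (-1) (vproj G H (mul G g h) (d_mul G (hlift G H g (lam1 G H h v)) (hlift G H h v)))"

definition cartan_connection ::
  "('g, 'f::real_normed_vector, 'x, 'e::real_normed_vector) lie_groupoid \<Rightarrow> ('g, 'f) tvec set \<Rightarrow> bool" where
  "cartan_connection G H \<longleftrightarrow> ehresmann_connection G H \<and>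
     (\<forall>(g, h)\<in>composable G. \<forall>v\<in>tangent_space (objs G) (src G h).
        basic_curvature G H g h v = tzero (unt G (tgt G g)))"

definition transport ::  \<comment> \<open>\<open>\<tau>\<^sub>g\<close>\<close>
  "('g, 'f::real_normed_vector, 'x, 'e::real_normed_vector) lie_groupoid \<Rightarrow>
   ('p, 'k::real_normed_vector, 'm, 'l, 'x, 'g) pbundle \<Rightarrow> ('g, 'f) tvec set
    \<Rightarrow> 'g \<Rightarrow> ('p, 'k) tvec \<Rightarrow> ('p, 'k) tvec" where
  "transport G P H g u =
     d_act G P u (d_ivs G (hlift G H (ivs G g) (tmap (tot P) (objs G) (anc P) u)))"

section \<open>Connection forms\<close>

text \<open>The fibre of \<open>P \<times>\<^bsub>X\<^sub>0\<^esub> A\<close> over \<open>p\<close> consists of the pairs \<open>(p, \<alpha>)\<close> with \<open>\<alpha>\<close> in \<open>algebroid G (anc P p)\<close>; it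
  is a submanifold of \<open>P \<times> TX\<^sub>1\<close>. Maps are extensional, i.e. determined by their values on \<open>TP\<close>.\<close>

definition connection_form ::
  "('g, 'f::real_normed_vector, 'x, 'e::real_normed_vector) lie_groupoid \<Rightarrow>
   ('p, 'k::real_normed_vector, 'm, 'l, 'x, 'g) pbundle \<Rightarrow> ('g, 'f) tvec set
    \<Rightarrow> (('p, 'k) tvec \<Rightarrow> 'p \<times> ('g, 'f) tvec) \<Rightarrow> bool" where
  "connection_form G P H \<omega> \<longleftrightarrow>
     \<omega> \<in> extensional (tangent_bundle (tot P)) \<and>
     (\<forall>p\<in>carrier (tot P). \<forall>u\<in>tangent_space (tot P) p.
        fst (\<omega> u) = p \<and> snd (\<omega> u) \<in> algebroid G (anc P p)) \<and>
     (\<forall>p\<in>carrier (tot P). \<forall>u\<in>tangent_space (tot P) p. \<forall>u'\<in>tangent_space (tot P) p.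
        snd (\<omega> (tadd u u')) = tadd (snd (\<omega> u)) (snd (\<omega> u'))) \<and>
     (\<forall>r. \<forall>u\<in>tangent_bundle (tot P). snd (\<omega> (tscale r u)) = tscale r (snd (\<omega> u))) \<and>
     smooth_map_on (tangent_atlas (tot P)) (prod_atlas (tot P) (tangent_atlas (arrs G)))
       (tangent_bundle (tot P)) \<omega> \<and>
     (\<forall>(p, g)\<in>actable G P. \<forall>u\<in>tangent_space (tot P) p.
        snd (\<omega> (transport G P H g u)) = lam0 G H (ivs G g) (snd (\<omega> u))) \<and>
     (\<forall>p\<in>carrier (tot P). \<forall>\<alpha>\<in>algebroid G (anc P p). snd (\<omega> (d_orbit G P p \<alpha>)) = \<alpha>)"

section \<open>The groupoids of the bundle\<close>

record ('o, 'a) cat =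
  Obj :: "'o set"
  Arr :: "'a set"
  Dom :: "'a \<Rightarrow> 'o"
  Cod :: "'a \<Rightarrow> 'o"
  Idt :: "'o \<Rightarrow> 'a"
  Cmp :: "'a \<Rightarrow> 'a \<Rightarrow> 'a"

definition is_functor ::
  "('o, 'a) cat \<Rightarrow> ('u, 'b) cat \<Rightarrow> ('o \<Rightarrow> 'u) \<Rightarrow> ('a \<Rightarrow> 'b) \<Rightarrow> bool" where
  "is_functor C D F0 F1 \<longleftrightarrow>
     (\<forall>x\<in>Obj C. F0 x \<in> Obj D \<and> F1 (Idt C x) = Idt D (F0 x)) \<and>
     (\<forall>f\<in>Arr C. F1 f \<in> Arr D \<and> Dom D (F1 f) = F0 (Dom C f) \<and> Cod D (F1 f) = F0 (Cod C f)) \<and>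
     (\<forall>f\<in>Arr C. \<forall>h\<in>Arr C. Cod C f = Dom C h \<longrightarrow> F1 (Cmp C h f) = Cmp D (F1 h) (F1 f))"

text \<open>Objects are triples \<open>(p, \<xi>, v)\<close> with \<open>\<xi>\<close> in a given fibre \<open>E p\<close> and \<open>v\<close> tangent to \<open>X\<^sub>0\<close> at
  \<open>anc P p\<close>; arrows act on \<open>\<xi>\<close> by a given transport \<open>T g\<close>.\<close>

type_synonym ('p, 'z, 'w, 'x, 'e) tobj = "'p \<times> ('z, 'w) tvec \<times> ('x, 'e) tvec"

definition transport_groupoid ::
  "('g, 'f::real_normed_vector, 'x, 'e::real_normed_vector) lie_groupoid \<Rightarrow>
   ('p, 'k::real_normed_vector, 'm, 'l, 'x, 'g) pbundle \<Rightarrow> ('g, 'f) tvec set \<Rightarrow>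
   ('p \<Rightarrow> ('z, 'w) tvec set) \<Rightarrow> ('g \<Rightarrow> ('z, 'w) tvec \<Rightarrow> ('z, 'w) tvec) \<Rightarrow>
   (('p, 'z, 'w, 'x, 'e) tobj, ('p, 'z, 'w, 'x, 'e) tobj \<times> 'g) cat" where
  "transport_groupoid G P H E T =
     (let Ob = {(p, \<xi>, v). p \<in> carrier (tot P) \<and> \<xi> \<in> E p \<and> v \<in> tangent_space (objs G) (anc P p)} in
      \<lparr>Obj = Ob,
       Arr = {(x, g). x \<in> Ob \<and> (fst x, g) \<in> actable G P},
       Dom = fst,
       Cod = (\<lambda>((p, \<xi>, v), g). (act P p g, T g \<xi>, lam1 G H (ivs G g) v)),
       Idt = (\<lambda>x. (x, unt G (anc P (fst x)))),
       Cmp = (\<lambda>(y, h) (x, g). (x, mul G g h))\<rparr>)"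

definition Ad_groupoid ::
  "('g, 'f::real_normed_vector, 'x, 'e::real_normed_vector) lie_groupoid \<Rightarrow>
   ('p, 'k::real_normed_vector, 'm, 'l, 'x, 'g) pbundle \<Rightarrow> ('g, 'f) tvec set \<Rightarrow>
   (('p, 'g, 'f, 'x, 'e) tobj, ('p, 'g, 'f, 'x, 'e) tobj \<times> 'g) cat" where
  "Ad_groupoid G P H =
     transport_groupoid G P H (\<lambda>p. algebroid G (anc P p)) (\<lambda>g. lam0 G H (ivs G g))"

definition At_groupoid ::
  "('g, 'f::real_normed_vector, 'x, 'e::real_normed_vector) lie_groupoid \<Rightarrow>
   ('p, 'k::real_normed_vector, 'm, 'l, 'x, 'g) pbundle \<Rightarrow> ('g, 'f) tvec set \<Rightarrow>
   (('p, 'p, 'k, 'x, 'e) tobj, ('p, 'p, 'k, 'x, 'e) tobj \<times> 'g) cat" where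
  "At_groupoid G P H = transport_groupoid G P H (tangent_space (tot P)) (transport G P H)"

definition d_orbit0 ::
  "('g, 'f::real_normed_vector, 'x, 'e::real_normed_vector) lie_groupoid \<Rightarrow>
   ('p, 'k::real_normed_vector, 'm, 'l, 'x, 'g) pbundle \<Rightarrow>
   ('p, 'g, 'f, 'x, 'e) tobj \<Rightarrow> ('p, 'p, 'k, 'x, 'e) tobj" where
  "d_orbit0 G P = (\<lambda>(p, \<alpha>, v). (p, d_orbit G P p \<alpha>, v))"

definition d_orbit1 ::
  "('g, 'f::real_normed_vector, 'x, 'e::real_normed_vector) lie_groupoid \<Rightarrow>
   ('p, 'k::real_normed_vector, 'm, 'l, 'x, 'g) pbundle \<Rightarrow>
   ('p, 'g, 'f, 'x, 'e) tobj \<times> 'g \<Rightarrow> ('p, 'p, 'k, 'x, 'e) tobj \<times> 'g" where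
  "d_orbit1 G P = (\<lambda>(x, g). (d_orbit0 G P x, g))"

definition oadd ::
  "('p, 'z, 'w::real_normed_vector, 'x, 'e::real_normed_vector) tobj \<Rightarrow> ('p, 'z, 'w, 'x, 'e) tobj
    \<Rightarrow> ('p, 'z, 'w, 'x, 'e) tobj" where
  "oadd = (\<lambda>(p, \<xi>, v) (q, \<eta>, w). (p, tadd \<xi> \<eta>, tadd v w))"

definition oscale ::
  "real \<Rightarrow> ('p, 'z, 'w::real_normed_vector, 'x, 'e::real_normed_vector) tobj
    \<Rightarrow> ('p, 'z, 'w, 'x, 'e) tobj" where
  "oscale r = (\<lambda>(p, \<xi>, v). (p, tscale r \<xi>, tscale r v))"

definition is_tzero :: "('a, 'e::real_normed_vector) tvec \<Rightarrow> bool" where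
  "is_tzero \<xi> \<longleftrightarrow> \<xi> = tzero (fst \<xi>)"

text \<open>The two summands of an object space are its homogeneous components; the total spaces are
  submanifolds of \<open>P \<times> (TP \<times> TX\<^sub>0)\<close> and \<open>P \<times> (TX\<^sub>1 \<times> TX\<^sub>0)\<close>.\<close>

definition graded_bundle_map ::
  "('g, 'f::real_normed_vector, 'x, 'e::real_normed_vector) lie_groupoid \<Rightarrow>
   ('p, 'k::real_normed_vector, 'm, 'l, 'x, 'g) pbundle \<Rightarrow> ('g, 'f) tvec set \<Rightarrow>
   (('p, 'p, 'k, 'x, 'e) tobj \<Rightarrow> ('p, 'g, 'f, 'x, 'e) tobj) \<Rightarrow> bool" where
  "graded_bundle_map G P H F0 \<longleftrightarrow>
     smooth_map_on (prod_atlas (tot P) (prod_atlas (tangent_atlas (tot P)) (tangent_atlas (objs G))))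
       (prod_atlas (tot P) (prod_atlas (tangent_atlas (arrs G)) (tangent_atlas (objs G))))
       (Obj (At_groupoid G P H)) F0 \<and>
     (\<forall>x\<in>Obj (At_groupoid G P H). F0 x \<in> Obj (Ad_groupoid G P H) \<and> fst (F0 x) = fst x) \<and>
     (\<forall>x\<in>Obj (At_groupoid G P H). \<forall>y\<in>Obj (At_groupoid G P H). fst x = fst y \<longrightarrow>
        F0 (oadd x y) = oadd (F0 x) (F0 y)) \<and>
     (\<forall>r. \<forall>x\<in>Obj (At_groupoid G P H). F0 (oscale r x) = oscale r (F0 x)) \<and>
     (\<forall>x\<in>Obj (At_groupoid G P H).
        (is_tzero (snd (snd x)) \<longrightarrow> is_tzero (snd (snd (F0 x)))) \<and>
        (is_tzero (fst (snd x)) \<longrightarrow> is_tzero (fst (snd (F0 x)))))"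

section \<open>Isomorphism classes in the fibres and quasi-connections\<close>

definition fibre_cat ::
  "('p, 'k, 'm, 'l, 'x, 'g) pbundle \<Rightarrow>
   (('p, 'z, 'w, 'x, 'e) tobj, ('p, 'z, 'w, 'x, 'e) tobj \<times> 'g) cat \<Rightarrow> 'm \<Rightarrow>
   (('p, 'z, 'w, 'x, 'e) tobj, ('p, 'z, 'w, 'x, 'e) tobj \<times> 'g) cat" where
  "fibre_cat P C m = C\<lparr>Obj := {x \<in> Obj C. proj P (fst x) = m},
     Arr := {f \<in> Arr C. proj P (fst (fst f)) = m}\<rparr>"

text \<open>In a groupoid, objects are isomorphic iff there is an arrow between them.\<close>

definition iso_class :: "('o, 'a) cat \<Rightarrow> 'o \<Rightarrow> 'o set" where
  "iso_class C x = {y \<in> Obj C. \<exists>f\<in>Arr C. Dom C f = x \<and> Cod C f = y}"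

definition conn :: "('o, 'a) cat \<Rightarrow> 'o set set" where
  "conn C = iso_class C ` Obj C"

text \<open>Graphs of the vector space operations: an arrow \<open>f\<close> by \<open>g\<close> from \<open>x\<close> over \<open>p\<close> leads to the object
  \<open>Cod C f\<close> over \<open>pg\<close>, to which an object \<open>y\<close> over \<open>pg\<close> may be added.\<close>

definition conn_sum ::
  "(('p, 'z, 'w::real_normed_vector, 'x, 'e::real_normed_vector) tobj, 'a) cat \<Rightarrow>
   ('p, 'z, 'w, 'x, 'e) tobj set \<Rightarrow> ('p, 'z, 'w, 'x, 'e) tobj set \<Rightarrow>
   ('p, 'z, 'w, 'x, 'e) tobj set \<Rightarrow> bool" where
  "conn_sum C K L N \<longleftrightarrow> (\<exists>f\<in>Arr C. \<exists>y\<in>Obj C. fst y = fst (Cod C f) \<and>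
     K = iso_class C (Dom C f) \<and> L = iso_class C y \<and> N = iso_class C (oadd (Cod C f) y))"

definition conn_scale ::
  "(('p, 'z, 'w::real_normed_vector, 'x, 'e::real_normed_vector) tobj, 'a) cat \<Rightarrow> real \<Rightarrow>
   ('p, 'z, 'w, 'x, 'e) tobj set \<Rightarrow> ('p, 'z, 'w, 'x, 'e) tobj set \<Rightarrow> bool" where
  "conn_scale C r K N \<longleftrightarrow> (\<exists>x\<in>Obj C. K = iso_class C x \<and> N = iso_class C (oscale r x))"

definition induces_linear_map ::
  "(('p, 'z, 'w::real_normed_vector, 'x, 'e::real_normed_vector) tobj, 'a) cat \<Rightarrow>
   (('p, 'y, 'v::real_normed_vector, 'x, 'e) tobj, 'b) cat \<Rightarrow>
   (('p, 'z, 'w, 'x, 'e) tobj \<Rightarrow> ('p, 'y, 'v, 'x, 'e) tobj) \<Rightarrow> bool" where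
  "induces_linear_map C D F0 \<longleftrightarrow> (\<exists>\<Phi>\<in>conn C \<rightarrow> conn D.
     (\<forall>x\<in>Obj C. \<Phi> (iso_class C x) = iso_class D (F0 x)) \<and>
     (\<forall>K L N. conn_sum C K L N \<longrightarrow> conn_sum D (\<Phi> K) (\<Phi> L) (\<Phi> N)) \<and>
     (\<forall>r K N. conn_scale C r K N \<longrightarrow> conn_scale D r (\<Phi> K) (\<Phi> N)))"

definition quasi_connection ::
  "('g, 'f::real_normed_vector, 'x, 'e::real_normed_vector) lie_groupoid \<Rightarrow>
   ('p, 'k::real_normed_vector, 'm, 'l, 'x, 'g) pbundle \<Rightarrow> ('g, 'f) tvec set \<Rightarrow>
   (('p, 'p, 'k, 'x, 'e) tobj \<Rightarrow> ('p, 'g, 'f, 'x, 'e) tobj) \<Rightarrow>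
   (('p, 'p, 'k, 'x, 'e) tobj \<times> 'g \<Rightarrow> ('p, 'g, 'f, 'x, 'e) tobj \<times> 'g) \<Rightarrow> bool" where
  "quasi_connection G P H F0 F1 \<longleftrightarrow>
     F0 \<in> extensional (Obj (At_groupoid G P H)) \<and> F1 \<in> extensional (Arr (At_groupoid G P H)) \<and>
     is_functor (At_groupoid G P H) (Ad_groupoid G P H) F0 F1 \<and>
     (\<forall>x\<in>Obj (At_groupoid G P H). proj P (fst (F0 x)) = proj P (fst x)) \<and>
     (\<forall>f\<in>Arr (At_groupoid G P H). proj P (fst (fst (F1 f))) = proj P (fst (fst f))) \<and>
     (\<forall>x\<in>Obj (Ad_groupoid G P H). F0 (d_orbit0 G P x) = x) \<and>
     (\<forall>f\<in>Arr (Ad_groupoid G P H). F1 (d_orbit1 G P f) = f) \<and>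
     graded_bundle_map G P H F0 \<and>
     (\<forall>m\<in>carrier (base P).
        induces_linear_map (fibre_cat P (At_groupoid G P H) m) (fibre_cat P (Ad_groupoid G P H) m) F0)"

definition form_functor0 ::
  "('g, 'f::real_normed_vector, 'x, 'e::real_normed_vector) lie_groupoid \<Rightarrow>
   ('p, 'k::real_normed_vector, 'm, 'l, 'x, 'g) pbundle \<Rightarrow> ('g, 'f) tvec set \<Rightarrow>
   (('p, 'k) tvec \<Rightarrow> 'p \<times> ('g, 'f) tvec) \<Rightarrow>
   ('p, 'p, 'k, 'x, 'e) tobj \<Rightarrow> ('p, 'g, 'f, 'x, 'e) tobj" where
  "form_functor0 G P H \<omega> = (\<lambda>(p, u, v)\<in>Obj (At_groupoid G P H). (p, snd (\<omega> u), v))"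

definition form_functor1 ::
  "('g, 'f::real_normed_vector, 'x, 'e::real_normed_vector) lie_groupoid \<Rightarrow>
   ('p, 'k::real_normed_vector, 'm, 'l, 'x, 'g) pbundle \<Rightarrow> ('g, 'f) tvec set \<Rightarrow>
   (('p, 'k) tvec \<Rightarrow> 'p \<times> ('g, 'f) tvec) \<Rightarrow>
   ('p, 'p, 'k, 'x, 'e) tobj \<times> 'g \<Rightarrow> ('p, 'g, 'f, 'x, 'e) tobj \<times> 'g" where
  "form_functor1 G P H \<omega> = (\<lambda>((p, u, v), g)\<in>Arr (At_groupoid G P H). ((p, snd (\<omega> u), v), g))"

end

theory Submission
  imports Defs
begin

text \<open>Over a point, additivity and degree preservation give \<open>F0 (p, u, v) = F0 (p, u, 0) + F0 (p, 0, v)\<close>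
  with \<open>F0 (p, u, 0) = (p, \<omega> u, 0)\<close>, and \<open>(p, 0, v)\<close> lies in the image of \<open>d_orbit0\<close>, so
  \<open>F0 (p, u, v) = (p, \<omega> u, v)\<close>. An arrow is mapped to one with the same end points in \<open>P\<close>, and the
  action is free, so \<open>F1\<close> keeps the component in \<open>X\<^sub>1\<close>. Under this description, equivariance of \<open>\<omega>\<close> is
  compatibility with codomains, and normalisation on orbits is \<open>F \<circ> d\<delta> = Id\<close>. Conversely, linearity on
  isomorphism classes is automatic: the class of \<open>F0 x\<close> is the image under \<open>F0\<close> of the class of \<open>x\<close>.\<close>

text \<open>Much of the work is analytic. Smoothness of \<open>\<omega>\<close> and of
  \<open>F0\<close> means that local extensions to an ambient manifold exist, so the passage between
  the two is made on extensions: an extension of \<open>\<omega>\<close> is combined with the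
  projections of the ambient product, and an extension of \<open>F0\<close> is pulled back along the
  section that sends a tangent vector u at p to (p, u, 0). This calls for a chain rule, products and
  tangent bundles for the given atlases. The differentials along submanifolds inside
  \<open>transport\<close> and \<open>d_orbit\<close> are evaluated on an extension picked by
  choice. The facts used about them are which tangent space contains the value and that
  \<open>d_orbit\<close> sends zero to zero; both hold for whichever extension is picked. Forms and
  functors are total functions made extensional, so the correspondence is an honest bijection of
  functions. In return, each formula for a functor is available only once its argument has been
  shown to be an object or an arrow.\<close>

section \<open>Calculus in finite-dimensional normed spaces\<close>

text \<open>Induction on the basis: the span of \<open>B\<close> is closed because the coefficients of a Cauchy sequence are
  Cauchy, so \<open>a\<close> has positive distance from it, which bounds the coefficient of \<open>a\<close>.\<close>

lemma bounded_coefficients: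
  fixes B :: "'a::real_normed_vector set"
  assumes "finite B" "independent B"
  shows "\<exists>C. \<forall>c. \<forall>b\<in>B. \<bar>c b\<bar> \<le> C * norm (\<Sum>b\<in>B. c b *\<^sub>R b)"
  using assms
proof (induction B rule: finite_induct)
  case (insert a B)
  then have ind: "independent B" and a: "a \<notin> span B"
    by (auto simp: independent_insert)
  from insert.IH[OF ind] obtain C
    where C: "\<And>c b. b \<in> B \<Longrightarrow> \<bar>c b\<bar> \<le> C * norm (\<Sum>b\<in>B. c b *\<^sub>R b)" by blast
  have "closed (span B)"
    unfolding closed_sequential_limits
  proof (intro allI impI, elim conjE)
    fix x l assume x: "\<forall>n. x n \<in> span B" and l: "x \<longlonglongrightarrow> l"
    have "\<forall>n. \<exists>c. x n = (\<Sum>b\<in>B. c b *\<^sub>R b)"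
      using x by (auto simp: span_finite[OF insert.hyps(1)])
    then obtain c where c: "\<And>n. x n = (\<Sum>b\<in>B. c n b *\<^sub>R b)" by metis
    have "convergent (\<lambda>n. c n b)" if b: "b \<in> B" for b
    proof -
      have dif: "norm (c m b - c n b) \<le> C * norm (x m - x n)" for m n
        using C[OF b, of "\<lambda>b. c m b - c n b"]
        by (simp add: c sum_subtractf scaleR_left_diff_distrib)
      have "Cauchy (\<lambda>n. c n b)"
      proof (rule metric_CauchyI)
        fix e :: real assume e: "e > 0"
        have "Cauchy x" using l by (rule LIMSEQ_imp_Cauchy)
        \<comment> \<open>Adding 1 makes the divisor positive whatever \<open>C\<close> is, and the
          bound then gives \<bar>C\<bar> * dist < e.\<close>
        then obtain M where M: "\<And>m n. m \<ge> M \<Longrightarrow> n \<ge> M \<Longrightarrow> dist (x m) (x n) < e / (\<bar>C\<bar> + 1)"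
          using e by (metis metric_CauchyD divide_pos_pos abs_ge_zero add_nonneg_pos zero_less_one)
        have "dist (c m b) (c n b) < e" if "m \<ge> M" "n \<ge> M" for m n
        proof -
          have "dist (c m b) (c n b) \<le> C * dist (x m) (x n)" using dif by (simp add: dist_norm)
          also have "\<dots> \<le> (\<bar>C\<bar> + 1) * dist (x m) (x n)" by (intro mult_right_mono) auto
          also have "\<dots> < e"
            using M[OF that] by (simp add: pos_less_divide_eq mult.commute add_nonneg_pos)
          finally show ?thesis .
        qed
        then show "\<exists>M. \<forall>m\<ge>M. \<forall>n\<ge>M. dist (c m b) (c n b) < e" by blast
      qed
      then show ?thesis by (rule Cauchy_convergent)
    qed
    then obtain k where k: "\<And>b. b \<in> B \<Longrightarrow> (\<lambda>n. c n b) \<longlonglongrightarrow> k b"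
      unfolding convergent_def by metis
    have "x \<longlonglongrightarrow> (\<Sum>b\<in>B. k b *\<^sub>R b)"
      unfolding c[abs_def] by (intro tendsto_intros k)
    then have "l = (\<Sum>b\<in>B. k b *\<^sub>R b)" using l LIMSEQ_unique by blast
    then show "l \<in> span B" by (simp add: span_sum span_scale span_base)
  qed
  then have d: "infdist a (span B) > 0"
    using a in_closed_iff_infdist_zero[of "span B" a] span_zero[of B] infdist_nonneg[of a "span B"]
    by fastforce
  define d where "d = infdist a (span B)"
  have d0: "d > 0" using d d_def by simp
  \<comment> \<open>The first summand covers the coefficient of \<open>a\<close>. The second covers
    those of \<open>B\<close>: the part in \<open>span B\<close> is w - c a * a, of norm at most
    norm w * (1 + norm a / d).\<close>
  define K where "K = 1 / d + \<bar>C\<bar> * (1 + norm a / d)"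
  have "\<bar>c b\<bar> \<le> K * norm (\<Sum>b\<in>insert a B. c b *\<^sub>R b)" if "b \<in> insert a B" for c b
  proof -
    define s where "s = (\<Sum>b\<in>B. c b *\<^sub>R b)"
    define w where "w = c a *\<^sub>R a + s"
    have w: "(\<Sum>b\<in>insert a B. c b *\<^sub>R b) = w" using insert.hyps by (simp add: w_def s_def)
    have sB: "s \<in> span B" unfolding s_def by (simp add: span_sum span_scale span_base)
    have ca: "\<bar>c a\<bar> \<le> norm w / d"
    proof (cases "c a = 0")
      case False
      \<comment> \<open>Dividing \<open>w\<close> by \<open>c a\<close> gives a + s / c a, and - s /
        c a lies in \<open>span B\<close>, hence at distance at least \<open>d\<close> from
        \<open>a\<close>.\<close>
      have "d \<le> dist a (- (1 / c a) *\<^sub>R s)"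
        unfolding d_def by (intro infdist_le span_scale sB)
      then have "\<bar>c a\<bar> * d \<le> \<bar>c a\<bar> * norm (a + (1 / c a) *\<^sub>R s)"
        by (intro mult_left_mono) (auto simp: dist_norm)
      also have "\<dots> = norm (c a *\<^sub>R (a + (1 / c a) *\<^sub>R s))" by simp
      also have "\<dots> = norm w" using False by (simp add: w_def scaleR_add_right)
      finally show ?thesis using d0 by (simp add: pos_le_divide_eq)
    qed (use d0 in auto)
    show ?thesis
    proof (cases "b = a")
      case True
      have "norm w / d \<le> K * norm w"
        using d0 by (simp add: K_def algebra_simps)
      then show ?thesis using ca True w by simp
    next
      case False
      then have "\<bar>c b\<bar> \<le> C * norm s" using C that unfolding s_def by blast
      also have "\<dots> \<le> \<bar>C\<bar> * norm s" by (intro mult_right_mono) auto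
      also have "s = w - c a *\<^sub>R a" by (simp add: w_def)
      also have "\<bar>C\<bar> * norm (w - c a *\<^sub>R a) \<le> \<bar>C\<bar> * (norm w + \<bar>c a\<bar> * norm a)"
        by (intro mult_left_mono) (use norm_triangle_ineq4[of w "c a *\<^sub>R a"] in auto)
      also have "\<dots> \<le> \<bar>C\<bar> * (norm w + norm w / d * norm a)"
        by (intro mult_left_mono add_left_mono mult_right_mono ca) auto
      also have "\<dots> \<le> K * norm w" using d0 by (simp add: K_def algebra_simps)
      finally show ?thesis using w by simp
    qed
  qed
  then show ?case by blast
qed simp

definition finite_dimensional :: "'a::real_normed_vector itself \<Rightarrow> bool" where
  "finite_dimensional _ \<longleftrightarrow> (\<exists>B::'a set. finite B \<and> span B = UNIV)"

text \<open>Thinning a finite spanning set to a basis gives coordinates, and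
  \<open>bounded_coefficients\<close> makes them continuous. This is what allows a coordinate of a
  smooth function to be treated as smooth. For b outside \<open>B\<close> the functional is
  zero.\<close>

lemma finite_dimensional_coordinates:
  assumes "finite_dimensional TYPE('a::real_normed_vector)"
  obtains B :: "'a::real_normed_vector set" and \<phi>
  where "finite B" "\<And>b. bounded_linear (\<phi> b :: 'a \<Rightarrow> real)"
    "\<And>v. v = (\<Sum>b\<in>B. \<phi> b v *\<^sub>R b)"
proof -
  obtain B0 :: "'a set" where B0: "finite B0" "span B0 = UNIV"
    using assms by (auto simp: finite_dimensional_def)
  obtain B where B: "B \<subseteq> B0" "independent B" "B0 \<subseteq> span B"
    using maximal_independent_subset by blast
  have fin: "finite B" using B(1) B0(1) finite_subset by blast
  have sp: "span B = UNIV" using B(3) B0(2) span_mono[OF B(3)] span_span by blast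
  have rep: "v = (\<Sum>b\<in>B. representation B v b *\<^sub>R b)" for v
    using sum_representation_eq[OF B(2) _ fin order_refl, of v] sp by simp
  obtain C where C: "\<And>c b. b \<in> B \<Longrightarrow> \<bar>c b\<bar> \<le> C * norm (\<Sum>b\<in>B. c b *\<^sub>R b)"
    using bounded_coefficients[OF fin B(2)] by blast
  have "bounded_linear (\<lambda>v. representation B v b)" for b
  proof (rule bounded_linear_intro[where K = "\<bar>C\<bar>"])
    show "norm (representation B v b) \<le> norm v * \<bar>C\<bar>" for v
    proof (cases "b \<in> B")
      case True
      have "\<bar>representation B v b\<bar> \<le> C * norm v" using C[OF True, of "representation B v"] rep[of v] by simp
      also have "\<dots> \<le> norm v * \<bar>C\<bar>" by (subst mult.commute) (intro mult_left_mono, auto)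
      finally show ?thesis by simp
    next
      case False
      then have "representation B v b = 0" using representation_ne_zero by blast
      then show ?thesis by simp
    qed
  qed (use B(2) sp in \<open>auto simp: representation_add representation_scale\<close>)
  then show thesis using that[OF fin, of "\<lambda>b v. representation B v b"] rep by blast
qed

lemma finite_dimensional_prod:
  assumes "finite_dimensional TYPE('a::real_normed_vector)" "finite_dimensional TYPE('b::real_normed_vector)"
  shows "finite_dimensional TYPE('a \<times> 'b)"
proof -
  obtain A :: "'a set" and B :: "'b set"
    where A: "finite A" "span A = UNIV" and B: "finite B" "span B = UNIV"
    using assms by (auto simp: finite_dimensional_def)
  define C where "C = (\<lambda>a. (a, 0::'b)) ` A \<union> Pair 0 ` B"
  have l: "linear (\<lambda>a. (a, 0::'b))" and r: "linear (Pair (0::'a) :: 'b \<Rightarrow> _)"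
    by (auto simp: linear_iff)
  have "(a, 0) \<in> span C" for a
    using span_mono[of "(\<lambda>a. (a, 0::'b)) ` A" C] linear_span_image[OF l, of A] A
    by (auto simp: C_def)
  moreover have "(0, b) \<in> span C" for b
    using span_mono[of "Pair 0 ` B" C] linear_span_image[OF r, of B] B
    by (auto simp: C_def)
  ultimately have "(a, 0) + (0, b) \<in> span C" for a b by (intro span_add)
  then have "span C = UNIV" by auto
  moreover have "finite C" using A B by (simp add: C_def)
  ultimately show ?thesis by (auto simp: finite_dimensional_def)
qed

section \<open>Iterated directional derivatives and smooth functions on open sets\<close>

lemma times_differentiable_on_cong:
  assumes "open S" "\<And>x. x \<in> S \<Longrightarrow> f x = g x" "times_differentiable_on n S f"
  shows "times_differentiable_on n S g"
  using assms(2,3)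
proof (induction n arbitrary: f g)
  case 0
  then show ?case by (simp cong: continuous_on_cong)
next
  case (Suc n)
  \<comment> \<open>On an open set the functions agree near each point, so their derivatives agree
    as well and the induction can continue with them.\<close>
  have d: "(g has_derivative frechet_derivative f (at x)) (at x)" if "x \<in> S" for x
    using Suc.prems that assms(1)
    by (metis frechet_derivative_works has_derivative_transform_within_open times_differentiable_on.simps(2))
  then have eq: "frechet_derivative g (at x) = frechet_derivative f (at x)" if "x \<in> S" for x
    using frechet_derivative_at that by metis
  show ?case
    using d eq Suc.prems(2) Suc.IH[of "\<lambda>x. frechet_derivative f (at x) v" "\<lambda>x. frechet_derivative g (at x) v" for v]
    by (auto simp: differentiable_def)
qed

text \<open>The definition refers to the chosen \<open>frechet_derivative\<close>. Uniqueness of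
  derivatives lets any explicit \<open>f'\<close> take its place, so the usual
  \<open>has_derivative\<close> rules become applicable; the closure proofs below rest on
  this.\<close>

lemma times_differentiable_on_SucI:
  assumes "open S" "\<And>x. x \<in> S \<Longrightarrow> (f has_derivative f' x) (at x)"
    "\<And>v. times_differentiable_on n S (\<lambda>x. f' x v)"
  shows "times_differentiable_on (Suc n) S f"
proof -
  have "f' x = frechet_derivative f (at x)" if "x \<in> S" for x
    using assms(2)[OF that] by (rule frechet_derivative_at)
  then have "times_differentiable_on n S (\<lambda>x. frechet_derivative f (at x) v)" for v
    by (intro times_differentiable_on_cong[OF assms(1) _ assms(3)[of v]]) simp
  then show ?thesis using assms(2) by (auto simp: differentiable_def)
qed

lemma times_differentiable_on_SucD:
  assumes "times_differentiable_on (Suc n) S f"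
  shows "x \<in> S \<Longrightarrow> (f has_derivative frechet_derivative f (at x)) (at x)"
    and "times_differentiable_on n S (\<lambda>x. frechet_derivative f (at x) v)"
  using assms by (auto simp: frechet_derivative_works)

text \<open>The product and chain rules leave some factors undifferentiated; their order has to be
  lowered to match the differentiated ones. The base case is continuity of differentiable
  maps.\<close>

lemma times_differentiable_on_Suc_imp:
  "times_differentiable_on (Suc n) S f \<Longrightarrow> times_differentiable_on n S f"
proof (induction n arbitrary: f)
  case 0
  then show ?case
    by (auto intro!: continuous_at_imp_continuous_on differentiable_imp_continuous_within)
next
  case (Suc n)
  then show ?case by (metis times_differentiable_on.simps(2))
qed

lemma times_differentiable_on_subset:
  "times_differentiable_on n S f \<Longrightarrow> T \<subseteq> S \<Longrightarrow> times_differentiable_on n T f"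
  by (induction n arbitrary: f) (auto intro: continuous_on_subset)

lemma times_differentiable_on_const: "open S \<Longrightarrow> times_differentiable_on n S (\<lambda>x. c)"
  by (induction n arbitrary: c)
    (auto intro!: times_differentiable_on_SucI[where f' = "\<lambda>_ _. 0"] simp del: times_differentiable_on.simps(2))

lemma times_differentiable_on_linear_compose:
  assumes "open S" "bounded_linear L" "times_differentiable_on n S f"
  shows "times_differentiable_on n S (\<lambda>x. L (f x))"
  using assms(3)
proof (induction n arbitrary: f)
  case 0
  then show ?case using bounded_linear.continuous_on[OF assms(2)] by simp
next
  case (Suc n)
  show ?case
    by (rule times_differentiable_on_SucI[OF assms(1)
          bounded_linear.has_derivative[OF assms(2) times_differentiable_on_SucD(1)[OF Suc.prems]]])
      (auto intro!: Suc.IH times_differentiable_on_SucD(2)[OF Suc.prems])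
qed

lemma times_differentiable_on_id: "open S \<Longrightarrow> times_differentiable_on n S (\<lambda>x. x)"
proof (cases n)
  case (Suc m)
  assume "open S"
  then show ?thesis unfolding Suc
    by (intro times_differentiable_on_SucI[where f' = "\<lambda>_ v. v"] times_differentiable_on_const) auto
qed auto

lemma times_differentiable_on_add:
  assumes "open S" "times_differentiable_on n S f" "times_differentiable_on n S g"
  shows "times_differentiable_on n S (\<lambda>x. f x + g x)"
  using assms(2,3)
proof (induction n arbitrary: f g)
  case 0
  then show ?case by (simp add: continuous_on_add continuous_on_scaleR continuous_on_Pair)
next
  case (Suc n)
  show ?case
    by (rule times_differentiable_on_SucI[OF assms(1)
          has_derivative_add[OF Suc.prems[THEN times_differentiable_on_SucD(1)]]])
      (auto intro!: Suc.IH Suc.prems[THEN times_differentiable_on_SucD(2)])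
qed

lemma times_differentiable_on_sum:
  assumes "open S" "\<And>i. i \<in> I \<Longrightarrow> times_differentiable_on n S (f i)"
  shows "times_differentiable_on n S (\<lambda>x. \<Sum>i\<in>I. f i x)"
  using assms(2)
  by (induction I rule: infinite_finite_induct)
    (auto intro!: times_differentiable_on_add times_differentiable_on_const assms(1))

lemma times_differentiable_on_scaleR:
  fixes f :: "'a::real_normed_vector \<Rightarrow> real"
  assumes "open S" "times_differentiable_on n S f" "times_differentiable_on n S g"
  shows "times_differentiable_on n S (\<lambda>x. f x *\<^sub>R g x)"
  using assms(2,3)
proof (induction n arbitrary: f g)
  case 0
  then show ?case by (simp add: continuous_on_add continuous_on_scaleR continuous_on_Pair)
next
  case (Suc n)
  show ?case
    by (rule times_differentiable_on_SucI[OF assms(1)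
          has_derivative_scaleR[OF Suc.prems[THEN times_differentiable_on_SucD(1)]]])
      (auto intro!: Suc.IH times_differentiable_on_add assms(1) Suc.prems[THEN times_differentiable_on_SucD(2)]
        Suc.prems[THEN times_differentiable_on_Suc_imp])
qed

lemma times_differentiable_on_Pair:
  assumes "open S" "times_differentiable_on n S f" "times_differentiable_on n S g"
  shows "times_differentiable_on n S (\<lambda>x. (f x, g x))"
  using assms(2,3)
proof (induction n arbitrary: f g)
  case 0
  then show ?case by (simp add: continuous_on_add continuous_on_scaleR continuous_on_Pair)
next
  case (Suc n)
  show ?case
    by (rule times_differentiable_on_SucI[OF assms(1)
          has_derivative_Pair[OF Suc.prems[THEN times_differentiable_on_SucD(1)]]])
      (auto intro!: Suc.IH Suc.prems[THEN times_differentiable_on_SucD(2)])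
qed

text \<open>The smoothness notion only involves directional derivatives in fixed directions. Expanding the
  direction in a basis of the intermediate space (hence finite dimension) brings the chain rule into
  this form.\<close>

lemma times_differentiable_on_compose:
  fixes f :: "'a::real_normed_vector \<Rightarrow> 'b::real_normed_vector"
  assumes "finite_dimensional TYPE('b)" "open S" "f ` S \<subseteq> T"
    "times_differentiable_on n S f" "times_differentiable_on n T g"
  shows "times_differentiable_on n S (\<lambda>x. g (f x))"
  using assms(4,5)
proof (induction n arbitrary: g)
  case 0
  then show ?case using assms(3) by (auto intro: continuous_on_compose2)
next
  case (Suc n)
  obtain B :: "'b set" and \<phi> where B: "finite B" "\<And>b. bounded_linear (\<phi> b :: 'b \<Rightarrow> real)"
    "\<And>v. v = (\<Sum>b\<in>B. \<phi> b v *\<^sub>R b)"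
    using finite_dimensional_coordinates[OF assms(1)] by metis
  let ?f' = "\<lambda>x. frechet_derivative f (at x)" and ?g' = "\<lambda>y. frechet_derivative g (at y)"
  have "((\<lambda>x. g (f x)) has_derivative (\<lambda>v. \<Sum>b\<in>B. \<phi> b (?f' x v) *\<^sub>R ?g' (f x) b)) (at x)"
    if x: "x \<in> S" for x
  proof -
    have "(g has_derivative ?g' (f x)) (at (f x))"
      using times_differentiable_on_SucD(1)[OF Suc.prems(2)] assms(3) x by blast
    from diff_chain_at[OF times_differentiable_on_SucD(1)[OF Suc.prems(1) x] this]
    have g': "((\<lambda>x. g (f x)) has_derivative (\<lambda>v. ?g' (f x) (?f' x v))) (at x)"
      by (simp add: o_def)
    have "linear (?g' (f x))"
      using \<open>(g has_derivative ?g' (f x)) (at (f x))\<close> by (rule has_derivative_linear)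
    then have "(\<Sum>b\<in>B. \<phi> b w *\<^sub>R ?g' (f x) b) = ?g' (f x) w" for w
      by (subst (2) B(3)[of w]) (simp add: linear_sum linear_scale)
    with g' show ?thesis by (simp only:)
  qed
  then show ?case
  proof (rule times_differentiable_on_SucI[OF assms(2)])
    fix v
    show "times_differentiable_on n S (\<lambda>x. \<Sum>b\<in>B. \<phi> b (?f' x v) *\<^sub>R ?g' (f x) b)"
      by (intro times_differentiable_on_sum times_differentiable_on_scaleR assms(2)
          times_differentiable_on_linear_compose[OF _ B(2)] times_differentiable_on_SucD(2)[OF Suc.prems(1)]
          Suc.IH[OF times_differentiable_on_Suc_imp[OF Suc.prems(1)]]
          times_differentiable_on_SucD(2)[OF Suc.prems(2)])
  qed
qed

lemma smooth_on_cong: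
  "open S \<Longrightarrow> (\<And>x. x \<in> S \<Longrightarrow> f x = g x) \<Longrightarrow> smooth_on S f \<Longrightarrow> smooth_on S g"
  unfolding smooth_on_def using times_differentiable_on_cong by blast

lemma smooth_on_subset: "smooth_on S f \<Longrightarrow> T \<subseteq> S \<Longrightarrow> smooth_on T f"
  unfolding smooth_on_def using times_differentiable_on_subset by blast

lemma smooth_on_const: "open S \<Longrightarrow> smooth_on S (\<lambda>x. c)"
  by (simp add: smooth_on_def times_differentiable_on_const)

lemma smooth_on_id: "open S \<Longrightarrow> smooth_on S (\<lambda>x. x)"
  by (simp add: smooth_on_def times_differentiable_on_id)

lemma smooth_on_linear: "open S \<Longrightarrow> bounded_linear L \<Longrightarrow> smooth_on S L"
  using times_differentiable_on_linear_compose[OF _ _ times_differentiable_on_id]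
  by (auto simp: smooth_on_def)

lemma smooth_on_Pair:
  "open S \<Longrightarrow> smooth_on S f \<Longrightarrow> smooth_on S g \<Longrightarrow> smooth_on S (\<lambda>x. (f x, g x))"
  by (simp add: smooth_on_def times_differentiable_on_Pair)

lemma smooth_on_compose:
  fixes f :: "'a::real_normed_vector \<Rightarrow> 'b::real_normed_vector"
  assumes "finite_dimensional TYPE('b)" "open S" "f ` S \<subseteq> T" "smooth_on S f" "smooth_on T g"
  shows "smooth_on S (\<lambda>x. g (f x))"
  using times_differentiable_on_compose[OF assms(1-3)] assms(4,5) unfolding smooth_on_def by blast

lemma smooth_on_imp_continuous_on: "smooth_on S f \<Longrightarrow> continuous_on S f"
  unfolding smooth_on_def using times_differentiable_on.simps(1) by blast

lemma smooth_on_imp_differentiable: "smooth_on S f \<Longrightarrow> x \<in> S \<Longrightarrow> f differentiable (at x)"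
  unfolding smooth_on_def using times_differentiable_on.simps(2) by blast

text \<open>Smoothness supplies derivatives in a fixed direction only, whereas tangent charts need
  joint smoothness in point and direction. Expanding the direction in a basis gives a finite sum of
  coordinates of the direction times derivatives in fixed directions.\<close>

lemma smooth_on_derivative:
  fixes f :: "'a::real_normed_vector \<Rightarrow> 'b::real_normed_vector"
  assumes fd: "finite_dimensional TYPE('a)" and S: "open S" and f: "smooth_on S f"
  shows "smooth_on (S \<times> UNIV) (\<lambda>z. frechet_derivative f (at (fst z)) (snd z))"
proof -
  obtain B :: "'a set" and \<phi> where B: "finite B" "\<And>b. bounded_linear (\<phi> b :: 'a \<Rightarrow> real)"
    "\<And>v. v = (\<Sum>b\<in>B. \<phi> b v *\<^sub>R b)"
    using finite_dimensional_coordinates[OF fd] by metis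
  have o: "open (S \<times> (UNIV :: 'a set))" using S by (simp add: open_Times)
  let ?f' = "\<lambda>x. frechet_derivative f (at x)"
  have "times_differentiable_on n (S \<times> UNIV) (\<lambda>z. \<Sum>b\<in>B. \<phi> b (snd z) *\<^sub>R ?f' (fst z) b)" for n
  proof (intro times_differentiable_on_sum times_differentiable_on_scaleR o)
    fix b
    show "times_differentiable_on n (S \<times> UNIV) (\<lambda>z. \<phi> b (snd z))"
      using smooth_on_linear[OF o bounded_linear_compose[OF B(2) bounded_linear_snd]]
      by (simp add: smooth_on_def)
    have "smooth_on S (\<lambda>x. ?f' x b)" using f unfolding smooth_on_def
      using times_differentiable_on.simps(2) by blast
    then show "times_differentiable_on n (S \<times> (UNIV :: 'a set)) (\<lambda>z. ?f' (fst z) b)"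
      using smooth_on_compose[OF fd o _ smooth_on_linear[OF o bounded_linear_fst], of S "\<lambda>x. ?f' x b"]
      by (simp add: smooth_on_def)
  qed
  then have sm: "smooth_on (S \<times> UNIV) (\<lambda>z. \<Sum>b\<in>B. \<phi> b (snd z) *\<^sub>R ?f' (fst z) b)"
    by (simp add: smooth_on_def)
  have "(\<Sum>b\<in>B. \<phi> b v *\<^sub>R ?f' x b) = ?f' x v" if "x \<in> S" for x v
  proof -
    have "linear (?f' x)"
      using smooth_on_imp_differentiable[OF f that] linear_frechet_derivative by blast
    then show ?thesis by (subst (2) B(3)[of v]) (simp add: linear_sum linear_scale)
  qed
  then show ?thesis by (intro smooth_on_cong[OF o _ sm]) (simp add: mem_Times_iff)
qed

section \<open>Smooth maps between manifolds\<close>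

text \<open>The part of the manifold axioms that passes to products and tangent bundles without further work.\<close>

definition smooth_atlas :: "('a, 'e::real_normed_vector) atlas \<Rightarrow> bool" where
  "smooth_atlas A \<longleftrightarrow> finite_dimensional TYPE('e) \<and>
     (\<forall>c\<in>A. inj_on (snd c) (fst c) \<and> open (snd c ` fst c)) \<and>
     (\<forall>c\<in>A. \<forall>d\<in>A. open (snd c ` (fst c \<inter> fst d)) \<and>
        smooth_on (snd c ` (fst c \<inter> fst d)) (snd d \<circ> chart_inv c))"

lemma manifold_imp_smooth_atlas: "manifold A \<Longrightarrow> smooth_atlas A"
  by (simp add: manifold_def smooth_atlas_def finite_dimensional_def)

lemma smooth_atlasD:
  assumes "smooth_atlas (A :: ('a, 'e::real_normed_vector) atlas)"
  shows "finite_dimensional TYPE('e)"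
    and "c \<in> A \<Longrightarrow> inj_on (snd c) (fst c)"
    and "c \<in> A \<Longrightarrow> open (snd c ` fst c)"
    and "c \<in> A \<Longrightarrow> d \<in> A \<Longrightarrow> open (snd c ` (fst c \<inter> fst d))"
    and "c \<in> A \<Longrightarrow> d \<in> A \<Longrightarrow> smooth_on (snd c ` (fst c \<inter> fst d)) (snd d \<circ> chart_inv c)"
  using assms by (auto simp: smooth_atlas_def)

lemma chart_inv_chart [simp]:
  "smooth_atlas A \<Longrightarrow> c \<in> A \<Longrightarrow> p \<in> fst c \<Longrightarrow> chart_inv c (snd c p) = p"
  by (simp add: chart_inv_def inv_into_f_f smooth_atlasD(2))

lemma carrierI: "c \<in> A \<Longrightarrow> p \<in> fst c \<Longrightarrow> p \<in> carrier A"
  by (auto simp: carrier_def)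

lemma carrierE:
  assumes "p \<in> carrier A"
  obtains c where "c \<in> A" "p \<in> fst c"
  using assms by (auto simp: carrier_def)

text \<open>Here \<open>k\<close> and \<open>l\<close> are charts and \<open>h\<close> is the
  coordinate expression of the map \<open>m\<close>. Injectivity of \<open>l\<close> recovers
  membership in \<open>V\<close> from membership in the chart image, so the chart image of a
  preimage is a preimage under \<open>h\<close>, and continuity of \<open>h\<close> can be
  used.\<close>

lemma image_Collect_vimage:
  assumes "\<And>q. q \<in> U \<Longrightarrow> h (k q) = l (m q)" "inj_on l Z" "m ` U \<subseteq> Z" "V \<subseteq> Z"
  shows "k ` {q \<in> U. m q \<in> V} = k ` U \<inter> h -` (l ` V)"
proof -
  have "m q \<in> V" if "q \<in> U" "h (k q) = l v" "v \<in> V" for q v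
    using that assms(1)[OF that(1)] inj_onD[OF assms(2), of "m q" v] assms(3,4) by auto
  then show ?thesis using assms(1) by fastforce
qed

text \<open>One chart is enough to test openness: the image in another chart is a preimage under the
  transition map, which is continuous on an open set.\<close>

lemma mfd_open_chartI:
  assumes A: "smooth_atlas A" and c: "c \<in> A" and W: "W \<subseteq> fst c" "open (snd c ` W)"
  shows "mfd_open A W"
proof -
  have "open (snd d ` (W \<inter> fst d))" if d: "d \<in> A" for d
  proof -
    have "snd d ` {q \<in> fst d \<inter> fst c. q \<in> W} =
        snd d ` (fst d \<inter> fst c) \<inter> (snd c \<circ> chart_inv d) -` (snd c ` W)"
      by (rule image_Collect_vimage[OF _ smooth_atlasD(2)[OF A c]])
        (use W(1) chart_inv_chart[OF A d] in auto)
    moreover have "{q \<in> fst d \<inter> fst c. q \<in> W} = W \<inter> fst d" using W(1) by blast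
    ultimately show ?thesis
      using continuous_open_preimage[OF smooth_on_imp_continuous_on[OF smooth_atlasD(5)[OF A d c]]
          smooth_atlasD(4)[OF A d c] W(2)] by simp
  qed
  then show ?thesis using W(1) c by (auto simp: mfd_open_def carrier_def)
qed

lemma mfd_open_image: "mfd_open A W \<Longrightarrow> c \<in> A \<Longrightarrow> open (snd c ` (W \<inter> fst c))"
  by (simp add: mfd_open_def)

lemma mfd_open_chart: "smooth_atlas A \<Longrightarrow> c \<in> A \<Longrightarrow> mfd_open A (fst c)"
  by (auto intro: mfd_open_chartI smooth_atlasD)

lemma mfd_open_Int:
  assumes "smooth_atlas A" "mfd_open A V" "mfd_open A W"
  shows "mfd_open A (V \<inter> W)"
proof -
  have "snd c ` (V \<inter> W \<inter> fst c) = snd c ` (V \<inter> fst c) \<inter> snd c ` (W \<inter> fst c)" if "c \<in> A" for c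
    using smooth_atlasD(2)[OF assms(1) that] by (auto simp: inj_on_def)
  then show ?thesis using assms by (auto simp: mfd_open_def)
qed

lemma smooth_nearI:
  "c \<in> A \<Longrightarrow> d \<in> B \<Longrightarrow> mfd_open A W \<Longrightarrow> p \<in> W \<Longrightarrow> W \<subseteq> fst c \<Longrightarrow> f ` W \<subseteq> fst d \<Longrightarrow>
    smooth_on (snd c ` W) (snd d \<circ> f \<circ> chart_inv c) \<Longrightarrow> smooth_near A B f p"
  unfolding smooth_near_def by blast

lemma smooth_near_carrier:
  assumes "smooth_near A B f p"
  shows "p \<in> carrier A" "f p \<in> carrier B"
  using assms by (auto simp: smooth_near_def carrier_def)

text \<open>Continuity at a point, in the form used to shrink a domain until the image lies where
  something is known about the second map.\<close>

lemma smooth_near_preimage: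
  assumes A: "smooth_atlas A" and B: "smooth_atlas B" and f: "smooth_near A B f p"
    and V: "mfd_open B V" "f p \<in> V"
  obtains W where "mfd_open A W" "p \<in> W" "f ` W \<subseteq> V"
proof -
  obtain c d W where c: "c \<in> A" and d: "d \<in> B" and W: "mfd_open A W" "p \<in> W" "W \<subseteq> fst c" "f ` W \<subseteq> fst d"
    and s: "smooth_on (snd c ` W) (snd d \<circ> f \<circ> chart_inv c)"
    using f unfolding smooth_near_def by blast
  have o: "open (snd c ` W)" using mfd_open_image[OF W(1) c] W(3) by (simp add: inf.absorb1)
  have "snd c ` {q \<in> W. f q \<in> V \<inter> fst d} =
      snd c ` W \<inter> (snd d \<circ> f \<circ> chart_inv c) -` (snd d ` (V \<inter> fst d))"
    by (rule image_Collect_vimage[OF _ smooth_atlasD(2)[OF B d]])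
      (use W chart_inv_chart[OF A c] in auto)
  moreover have "{q \<in> W. f q \<in> V \<inter> fst d} = {q \<in> W. f q \<in> V}" using W(4) by blast
  ultimately have "open (snd c ` {q \<in> W. f q \<in> V})"
    using continuous_open_preimage[OF smooth_on_imp_continuous_on[OF s] o mfd_open_image[OF V(1) d]] by simp
  then have "mfd_open A {q \<in> W. f q \<in> V}" using W(3) by (intro mfd_open_chartI[OF A c]) auto
  then show thesis using that W(2) V(2) by blast
qed

text \<open>The definition of \<open>smooth_near\<close> provides some pair of charts; composing
  with transition maps on both sides carries smoothness to any prescribed pair around the point and
  its image.\<close>

lemma smooth_near_chart:
  assumes A: "smooth_atlas A" and B: "smooth_atlas B" and f: "smooth_near A B f p"
    and c: "c \<in> A" "p \<in> fst c" and d: "d \<in> B" "f p \<in> fst d"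
  obtains W where "mfd_open A W" "p \<in> W" "W \<subseteq> fst c" "f ` W \<subseteq> fst d" "open (snd c ` W)"
    "smooth_on (snd c ` W) (\<lambda>x. snd d (f (chart_inv c x)))"
proof -
  obtain c0 d0 W0 where c0: "c0 \<in> A" and d0: "d0 \<in> B"
    and W0: "mfd_open A W0" "p \<in> W0" "W0 \<subseteq> fst c0" "f ` W0 \<subseteq> fst d0"
    and s: "smooth_on (snd c0 ` W0) (snd d0 \<circ> f \<circ> chart_inv c0)"
    using f unfolding smooth_near_def by blast
  obtain V where V: "mfd_open A V" "p \<in> V" "f ` V \<subseteq> fst d"
    using smooth_near_preimage[OF A B f mfd_open_chart[OF B d(1)] d(2)] by blast
  define W where "W = W0 \<inter> fst c \<inter> V"
  have W: "mfd_open A W" "p \<in> W" "W \<subseteq> fst c" "f ` W \<subseteq> fst d"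
    using V W0 c by (auto simp: W_def intro!: mfd_open_Int[OF A] mfd_open_chart[OF A])
  have o: "open (snd c ` W)" using mfd_open_image[OF W(1) c(1)] W(3) by (simp add: inf.absorb1)
  have "smooth_on (snd c ` W) (snd c0 \<circ> chart_inv c)"
    using W0(3) by (intro smooth_on_subset[OF smooth_atlasD(5)[OF A c(1) c0]]) (auto simp: W_def)
  moreover have "(snd c0 \<circ> chart_inv c) ` snd c ` W \<subseteq> snd c0 ` W0"
    using chart_inv_chart[OF A c(1)] by (auto simp: W_def)
  ultimately have s1: "smooth_on (snd c ` W) (\<lambda>x. (snd d0 \<circ> f \<circ> chart_inv c0) ((snd c0 \<circ> chart_inv c) x))"
    using smooth_on_compose[OF smooth_atlasD(1)[OF A] o _ _ s] by blast
  have eq: "(snd d0 \<circ> f \<circ> chart_inv c0) ((snd c0 \<circ> chart_inv c) (snd c q)) = snd d0 (f q)"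
    if "q \<in> W" for q
    using that W0(3) chart_inv_chart[OF A c(1)] chart_inv_chart[OF A c0] by (auto simp: W_def)
  \<comment> \<open>The second transition map is smooth only on the overlap of \<open>d0\<close> and
    \<open>d\<close>; this is why \<open>W\<close> was cut down by \<open>V\<close>.\<close>
  have "(\<lambda>x. (snd d0 \<circ> f \<circ> chart_inv c0) ((snd c0 \<circ> chart_inv c) x)) ` snd c ` W \<subseteq> snd d0 ` (fst d0 \<inter> fst d)"
    using eq W(4) W0(4) by (auto simp: W_def image_subset_iff intro!: imageI)
  from smooth_on_compose[OF smooth_atlasD(1)[OF B] o this s1 smooth_atlasD(5)[OF B d0 d(1)]]
  have "smooth_on (snd c ` W) (\<lambda>x. snd d (f (chart_inv c x)))"
  proof (rule smooth_on_cong[OF o, rotated])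
    fix x assume "x \<in> snd c ` W"
    then obtain q where q: "q \<in> W" "x = snd c q" by blast
    have "f q \<in> fst d0" using q(1) W0(4) by (auto simp: W_def)
    then show "(snd d \<circ> chart_inv d0) ((snd d0 \<circ> f \<circ> chart_inv c0) ((snd c0 \<circ> chart_inv c) x)) =
        snd d (f (chart_inv c x))"
      using eq[OF q(1)] q W(3) chart_inv_chart[OF B d0] chart_inv_chart[OF A c(1)]
      unfolding q(2) o_apply by (metis subsetD)
  qed
  then show thesis using that W o by blast
qed

text \<open>The chart in which \<open>g\<close> is given serves as the intermediate one:
  \<open>f\<close> is re-expressed in it, on a domain small enough that \<open>f\<close> lands where
  \<open>g\<close> is known to be smooth.\<close>

lemma smooth_near_compose:
  assumes A: "smooth_atlas A" and B: "smooth_atlas B"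
    and f: "smooth_near A B f p" and g: "smooth_near B C g (f p)"
  shows "smooth_near A C (\<lambda>x. g (f x)) p"
proof -
  obtain d e V where d: "d \<in> B" and e: "e \<in> C" and V: "mfd_open B V" "f p \<in> V" "V \<subseteq> fst d" "g ` V \<subseteq> fst e"
    and s: "smooth_on (snd d ` V) (snd e \<circ> g \<circ> chart_inv d)"
    using g unfolding smooth_near_def by blast
  obtain c where c: "c \<in> A" "p \<in> fst c" using smooth_near_carrier(1)[OF f] by (rule carrierE)
  have fp: "f p \<in> fst d" using V by blast
  obtain W1 where W1: "mfd_open A W1" "p \<in> W1" "W1 \<subseteq> fst c" "f ` W1 \<subseteq> fst d"
    and s1: "smooth_on (snd c ` W1) (\<lambda>x. snd d (f (chart_inv c x)))"
    using smooth_near_chart[OF A B f c d fp] by metis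
  obtain W2 where W2: "mfd_open A W2" "p \<in> W2" "f ` W2 \<subseteq> V"
    using smooth_near_preimage[OF A B f V(1,2)] by blast
  define W where "W = W1 \<inter> W2"
  have W: "mfd_open A W" "p \<in> W" "W \<subseteq> fst c" "f ` W \<subseteq> V"
    using W1 W2 by (auto simp: W_def intro!: mfd_open_Int[OF A])
  have o: "open (snd c ` W)" using mfd_open_image[OF W(1) c(1)] W(3) by (simp add: inf.absorb1)
  have "smooth_on (snd c ` W) (\<lambda>x. snd d (f (chart_inv c x)))"
    by (rule smooth_on_subset[OF s1]) (auto simp: W_def)
  moreover have "(\<lambda>x. snd d (f (chart_inv c x))) ` snd c ` W \<subseteq> snd d ` V"
    using W chart_inv_chart[OF A c(1)] by (auto simp: subset_iff)
  ultimately have "smooth_on (snd c ` W) (\<lambda>x. (snd e \<circ> g \<circ> chart_inv d) (snd d (f (chart_inv c x))))"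
    using smooth_on_compose[OF smooth_atlasD(1)[OF B] o _ _ s] by blast
  then have "smooth_on (snd c ` W) (snd e \<circ> (\<lambda>x. g (f x)) \<circ> chart_inv c)"
  proof (rule smooth_on_cong[OF o, rotated])
    fix x assume "x \<in> snd c ` W"
    then obtain q where q: "q \<in> W" "x = snd c q" by blast
    then have "f q \<in> fst d" "chart_inv c x = q" using W V(3) chart_inv_chart[OF A c(1)] by auto
    then show "(snd e \<circ> g \<circ> chart_inv d) (snd d (f (chart_inv c x))) = (snd e \<circ> (\<lambda>x. g (f x)) \<circ> chart_inv c) x"
      using chart_inv_chart[OF B d] by simp
  qed
  moreover have "(\<lambda>x. g (f x)) ` W \<subseteq> fst e" using W(4) V(4) by blast
  ultimately show ?thesis using smooth_nearI[OF c(1) e W(1-3)] by blast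
qed

lemma smooth_near_id: "smooth_atlas A \<Longrightarrow> p \<in> carrier A \<Longrightarrow> smooth_near A A (\<lambda>x. x) p"
proof (elim carrierE)
  fix c assume A: "smooth_atlas A" and c: "c \<in> A" "p \<in> fst c"
  have "smooth_on (snd c ` fst c) (snd c \<circ> (\<lambda>x. x) \<circ> chart_inv c)"
    using smooth_atlasD(5)[OF A c(1) c(1)] by (simp add: o_def)
  then show ?thesis
    by (intro smooth_nearI[OF c(1) c(1) mfd_open_chart[OF A c(1)] c(2)]) auto
qed

lemma smooth_near_cong:
  assumes A: "smooth_atlas A" and f: "smooth_near A B f p"
    and V: "mfd_open A V" "p \<in> V" "\<And>q. q \<in> V \<Longrightarrow> f q = g q"
  shows "smooth_near A B g p"
proof -
  obtain c d W where c: "c \<in> A" and d: "d \<in> B" and W: "mfd_open A W" "p \<in> W" "W \<subseteq> fst c" "f ` W \<subseteq> fst d"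
    and s: "smooth_on (snd c ` W) (snd d \<circ> f \<circ> chart_inv c)"
    using f unfolding smooth_near_def by blast
  have U: "mfd_open A (W \<inter> V)" "W \<inter> V \<subseteq> fst c" using W V by (auto intro: mfd_open_Int[OF A])
  have o: "open (snd c ` (W \<inter> V))" using mfd_open_image[OF U(1) c] U(2) by (simp add: inf.absorb1)
  have s': "smooth_on (snd c ` (W \<inter> V)) (snd d \<circ> f \<circ> chart_inv c)" by (rule smooth_on_subset[OF s]) auto
  have "smooth_on (snd c ` (W \<inter> V)) (snd d \<circ> g \<circ> chart_inv c)"
    using V(3) U(2) chart_inv_chart[OF A c] by (intro smooth_on_cong[OF o _ s']) auto
  moreover have "g ` (W \<inter> V) \<subseteq> fst d"
  proof
    fix y assume "y \<in> g ` (W \<inter> V)"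
    then obtain q where "q \<in> W" "q \<in> V" "y = g q" by blast
    then show "y \<in> fst d" using V(3)[of q] W(4) by auto
  qed
  ultimately show ?thesis using W(2) V(2) by (intro smooth_nearI[OF c d U(1) _ U(2)]) auto
qed

section \<open>Products of atlases\<close>

lemma carrier_prod_atlas: "carrier (prod_atlas A B) = carrier A \<times> carrier B"
  by (fastforce simp: carrier_def prod_atlas_def)

lemma prod_atlasE:
  assumes "e \<in> prod_atlas A B"
  obtains c d where "c \<in> A" "d \<in> B" "e = (fst c \<times> fst d, map_prod (snd c) (snd d))"
  using assms by (auto simp: prod_atlas_def)

lemma prod_atlasI: "c \<in> A \<Longrightarrow> d \<in> B \<Longrightarrow> (fst c \<times> fst d, map_prod (snd c) (snd d)) \<in> prod_atlas A B"
  by (force simp: prod_atlas_def)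

lemma smooth_on_map_prod:
  fixes f :: "'a::real_normed_vector \<Rightarrow> 'c::real_normed_vector" and g :: "'b::real_normed_vector \<Rightarrow> 'd::real_normed_vector"
  assumes "finite_dimensional TYPE('a)" "finite_dimensional TYPE('b)" "open S" "open T" "smooth_on S f" "smooth_on T g"
  shows "smooth_on (S \<times> T) (map_prod f g)"
proof -
  have o: "open (S \<times> T)" using assms by (simp add: open_Times)
  have "smooth_on (S \<times> T) (\<lambda>z. f (fst z))"
    by (rule smooth_on_compose[OF assms(1) o _ smooth_on_linear[OF o bounded_linear_fst] assms(5)]) auto
  moreover have "smooth_on (S \<times> T) (\<lambda>z. g (snd z))"
    by (rule smooth_on_compose[OF assms(2) o _ smooth_on_linear[OF o bounded_linear_snd] assms(6)]) auto
  ultimately have "smooth_on (S \<times> T) (\<lambda>z. (f (fst z), g (snd z)))" by (rule smooth_on_Pair[OF o])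
  moreover have "map_prod f g = (\<lambda>z. (f (fst z), g (snd z)))" by (simp add: fun_eq_iff)
  ultimately show ?thesis by simp
qed

lemma smooth_atlas_prod:
  fixes A :: "('a, 'e::real_normed_vector) atlas" and B :: "('b, 'f::real_normed_vector) atlas"
  assumes A: "smooth_atlas A" and B: "smooth_atlas B"
  shows "smooth_atlas (prod_atlas A B)"
  unfolding smooth_atlas_def
proof (intro conjI ballI)
  show "finite_dimensional TYPE('e \<times> 'f)"
    by (rule finite_dimensional_prod[OF smooth_atlasD(1)[OF A] smooth_atlasD(1)[OF B]])
  fix e assume e: "e \<in> prod_atlas A B"
  then obtain c d where cd: "c \<in> A" "d \<in> B" and e_eq: "e = (fst c \<times> fst d, map_prod (snd c) (snd d))"
    by (rule prod_atlasE)
  show inj: "inj_on (snd e) (fst e)"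
    using smooth_atlasD(2)[OF A cd(1)] smooth_atlasD(2)[OF B cd(2)] by (auto simp: e_eq inj_on_def)
  show "open (snd e ` fst e)"
    using smooth_atlasD(3)[OF A cd(1)] smooth_atlasD(3)[OF B cd(2)]
    by (simp add: e_eq map_prod_surj_on[OF refl refl] open_Times)
  fix e' assume e': "e' \<in> prod_atlas A B"
  then obtain c' d' where cd': "c' \<in> A" "d' \<in> B" and e'_eq: "e' = (fst c' \<times> fst d', map_prod (snd c') (snd d'))"
    by (rule prod_atlasE)
  have im: "snd e ` (fst e \<inter> fst e') = (snd c ` (fst c \<inter> fst c')) \<times> (snd d ` (fst d \<inter> fst d'))"
    unfolding e_eq e'_eq fst_conv snd_conv Times_Int_Times by (rule map_prod_surj_on) simp_all
  show o: "open (snd e ` (fst e \<inter> fst e'))"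
    unfolding im by (intro open_Times smooth_atlasD(4)[OF A] smooth_atlasD(4)[OF B] cd cd')
  have "smooth_on (snd e ` (fst e \<inter> fst e')) (map_prod (snd c' \<circ> chart_inv c) (snd d' \<circ> chart_inv d))"
    unfolding im
    by (intro smooth_on_map_prod smooth_atlasD(1)[OF A] smooth_atlasD(1)[OF B] smooth_atlasD(4,5)[OF A]
        smooth_atlasD(4,5)[OF B] cd cd')
  then show "smooth_on (snd e ` (fst e \<inter> fst e')) (snd e' \<circ> chart_inv e)"
  proof (rule smooth_on_cong[OF o, rotated])
    fix x assume "x \<in> snd e ` (fst e \<inter> fst e')"
    then obtain p q where pq: "p \<in> fst c" "q \<in> fst d" "x = snd e (p, q)" by (auto simp: e_eq)
    have "chart_inv e x = (p, q)"
      unfolding chart_inv_def pq(3) using inj pq by (intro inv_into_f_f) (auto simp: e_eq)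
    then show "map_prod (snd c' \<circ> chart_inv c) (snd d' \<circ> chart_inv d) x = (snd e' \<circ> chart_inv e) x"
      using pq chart_inv_chart[OF A cd(1)] chart_inv_chart[OF B cd(2)] by (simp add: e_eq e'_eq)
  qed
qed

lemma smooth_near_projections:
  assumes A: "smooth_atlas A" and B: "smooth_atlas B" and z: "z \<in> carrier (prod_atlas A B)"
  shows "smooth_near (prod_atlas A B) A fst z" "smooth_near (prod_atlas A B) B snd z"
proof -
  note AB = smooth_atlas_prod[OF A B]
  from z obtain e where e: "e \<in> prod_atlas A B" "z \<in> fst e" by (rule carrierE)
  from e(1) obtain c d where cd: "c \<in> A" "d \<in> B" and e_eq: "e = (fst c \<times> fst d, map_prod (snd c) (snd d))"
    by (rule prod_atlasE)
  note o = smooth_atlasD(3)[OF AB e(1)]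
  have "smooth_on (snd e ` fst e) (snd c \<circ> fst \<circ> chart_inv e)"
    by (rule smooth_on_cong[OF o _ smooth_on_linear[OF o bounded_linear_fst]])
      (use chart_inv_chart[OF AB e(1)] in \<open>auto simp: e_eq\<close>)
  then show "smooth_near (prod_atlas A B) A fst z"
    by (intro smooth_nearI[OF e(1) cd(1) mfd_open_chart[OF AB e(1)] e(2)]) (auto simp: e_eq)
  have "smooth_on (snd e ` fst e) (snd d \<circ> snd \<circ> chart_inv e)"
    by (rule smooth_on_cong[OF o _ smooth_on_linear[OF o bounded_linear_snd]])
      (use chart_inv_chart[OF AB e(1)] in \<open>auto simp: e_eq\<close>)
  then show "smooth_near (prod_atlas A B) B snd z"
    by (intro smooth_nearI[OF e(1) cd(2) mfd_open_chart[OF AB e(1)] e(2)]) (auto simp: e_eq)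
qed

lemma smooth_near_Pair:
  assumes A: "smooth_atlas A" and B: "smooth_atlas B" and C: "smooth_atlas C"
    and f: "smooth_near A B f p" and g: "smooth_near A C g p"
  shows "smooth_near A (prod_atlas B C) (\<lambda>x. (f x, g x)) p"
proof -
  obtain c where c: "c \<in> A" "p \<in> fst c" using smooth_near_carrier(1)[OF f] by (rule carrierE)
  obtain d where d: "d \<in> B" "f p \<in> fst d" using smooth_near_carrier(2)[OF f] by (rule carrierE)
  obtain e where e: "e \<in> C" "g p \<in> fst e" using smooth_near_carrier(2)[OF g] by (rule carrierE)
  obtain V where V: "mfd_open A V" "p \<in> V" "V \<subseteq> fst c" "f ` V \<subseteq> fst d"
    and sV: "smooth_on (snd c ` V) (\<lambda>x. snd d (f (chart_inv c x)))"
    using smooth_near_chart[OF A B f c d] by metis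
  obtain W where W: "mfd_open A W" "p \<in> W" "W \<subseteq> fst c" "g ` W \<subseteq> fst e"
    and sW: "smooth_on (snd c ` W) (\<lambda>x. snd e (g (chart_inv c x)))"
    using smooth_near_chart[OF A C g c e] by metis
  have U: "mfd_open A (V \<inter> W)" "V \<inter> W \<subseteq> fst c" using V W by (auto intro: mfd_open_Int[OF A])
  have o: "open (snd c ` (V \<inter> W))" using mfd_open_image[OF U(1) c(1)] U(2) by (simp add: inf.absorb1)
  have "smooth_on (snd c ` (V \<inter> W)) (\<lambda>x. (snd d (f (chart_inv c x)), snd e (g (chart_inv c x))))"
    by (intro smooth_on_Pair[OF o] smooth_on_subset[OF sV] smooth_on_subset[OF sW]) auto
  then show ?thesis using V W U
    by (intro smooth_nearI[OF c(1) prod_atlasI[OF d(1) e(1)] U(1)]) (auto simp: o_def)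
qed

section \<open>Derivatives of coordinate expressions\<close>

lemma chart_differentiable:
  assumes A: "smooth_atlas A" and B: "smooth_atlas B" and f: "smooth_near A B f p"
    and c: "c \<in> A" "p \<in> fst c" and d: "d \<in> B" "f p \<in> fst d"
  shows "(snd d \<circ> f \<circ> chart_inv c) differentiable (at (snd c p))"
proof -
  obtain W where "p \<in> W" "smooth_on (snd c ` W) (\<lambda>x. snd d (f (chart_inv c x)))"
    using smooth_near_chart[OF A B f c d] by metis
  then show ?thesis using smooth_on_imp_differentiable by (fastforce simp: o_def)
qed

lemma chart_derivative_linear:
  assumes A: "smooth_atlas A" and B: "smooth_atlas B" and f: "smooth_near A B f p"
    and c: "c \<in> A" "p \<in> fst c" and d: "d \<in> B" "f p \<in> fst d"
  shows "linear (frechet_derivative (snd d \<circ> f \<circ> chart_inv c) (at (snd c p)))"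
  by (rule linear_frechet_derivative[OF chart_differentiable[OF assms]])

text \<open>Composing the two coordinate expressions passes through \<open>chart_inv d\<close>,
  which undoes \<open>d\<close> only where \<open>f\<close> takes values in the domain of
  \<open>d\<close>. The two sides therefore agree near the point rather than everywhere, which
  suffices because derivatives are local.\<close>

lemma chart_derivative_chain:
  assumes A: "smooth_atlas A" and B: "smooth_atlas B" and C: "smooth_atlas C"
    and f: "smooth_near A B f p" and g: "smooth_near B C g (f p)"
    and c: "c \<in> A" "p \<in> fst c" and d: "d \<in> B" "f p \<in> fst d" and e: "e \<in> C" "g (f p) \<in> fst e"
  shows "frechet_derivative (snd e \<circ> (\<lambda>x. g (f x)) \<circ> chart_inv c) (at (snd c p)) v =
    frechet_derivative (snd e \<circ> g \<circ> chart_inv d) (at (snd d (f p)))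
      (frechet_derivative (snd d \<circ> f \<circ> chart_inv c) (at (snd c p)) v)"
proof -
  let ?F = "snd d \<circ> f \<circ> chart_inv c" and ?G = "snd e \<circ> g \<circ> chart_inv d"
  obtain W where W: "mfd_open A W" "p \<in> W" "W \<subseteq> fst c" "f ` W \<subseteq> fst d" "open (snd c ` W)"
    using smooth_near_chart[OF A B f c d] by metis
  have chain: "(?G \<circ> ?F has_derivative frechet_derivative ?G (at (snd d (f p))) \<circ> frechet_derivative ?F (at (snd c p)))
      (at (snd c p))"
    using chart_differentiable[OF A B f c d] chart_differentiable[OF B C g d e] chart_inv_chart[OF A c]
    by (intro diff_chain_at) (auto simp: frechet_derivative_works)
  have eq: "(?G \<circ> ?F) x = (snd e \<circ> (\<lambda>x. g (f x)) \<circ> chart_inv c) x" if x: "x \<in> snd c ` W" for x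
  proof -
    obtain q where q: "q \<in> W" "x = snd c q" using x by blast
    then have "chart_inv c x = q" "f q \<in> fst d" using W(3,4) chart_inv_chart[OF A c(1)] by auto
    then show ?thesis using chart_inv_chart[OF B d(1)] by simp
  qed
  from frechet_derivative_at[OF has_derivative_transform_within_open[OF chain W(5) imageI[OF W(2)] eq]]
  show ?thesis by (metis comp_apply)
qed

lemma chart_derivative_same:
  assumes A: "smooth_atlas A" and c: "c \<in> A" "p \<in> fst c"
  shows "frechet_derivative (snd c \<circ> chart_inv c) (at (snd c p)) v = v"
proof -
  have "((snd c \<circ> chart_inv c) has_derivative (\<lambda>v. v)) (at (snd c p))"
    by (rule has_derivative_transform_within_open[OF has_derivative_ident smooth_atlasD(3)[OF A c(1)]])
      (use c chart_inv_chart[OF A c(1)] in auto)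
  from frechet_derivative_at[OF this] show ?thesis by metis
qed

section \<open>Tangent vectors and differentials\<close>

lemma tangent_spaceD:
  assumes "\<xi> \<in> tangent_space A p"
  shows "fst \<xi> = p" "p \<in> carrier A" "\<xi> \<in> tangent_bundle A"
    "c \<notin> A \<or> p \<notin> fst c \<Longrightarrow> snd \<xi> c = 0"
    "c \<in> A \<Longrightarrow> p \<in> fst c \<Longrightarrow> d \<in> A \<Longrightarrow> p \<in> fst d \<Longrightarrow>
      snd \<xi> d = frechet_derivative (snd d \<circ> chart_inv c) (at (snd c p)) (snd \<xi> c)"
proof -
  show "fst \<xi> = p" "\<xi> \<in> tangent_bundle A" using assms by (simp_all add: tangent_space_def)
  then obtain \<eta> where \<xi>: "\<xi> = (p, \<eta>)" "(p, \<eta>) \<in> tangent_bundle A" by (metis prod.collapse)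
  note * = \<xi>(2)[unfolded tangent_bundle_def mem_Collect_eq prod.case]
  show "p \<in> carrier A" using * by blast
  show "c \<notin> A \<or> p \<notin> fst c \<Longrightarrow> snd \<xi> c = 0" using * unfolding \<xi>(1) snd_conv by blast
  show "c \<in> A \<Longrightarrow> p \<in> fst c \<Longrightarrow> d \<in> A \<Longrightarrow> p \<in> fst d \<Longrightarrow>
      snd \<xi> d = frechet_derivative (snd d \<circ> chart_inv c) (at (snd c p)) (snd \<xi> c)"
    using * unfolding \<xi>(1) snd_conv by blast
qed

lemma tangent_spaceI:
  assumes "fst \<xi> = p" "p \<in> carrier A" "\<And>c. c \<notin> A \<or> p \<notin> fst c \<Longrightarrow> snd \<xi> c = 0"
    "\<And>c d. c \<in> A \<Longrightarrow> p \<in> fst c \<Longrightarrow> d \<in> A \<Longrightarrow> p \<in> fst d \<Longrightarrow>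
      snd \<xi> d = frechet_derivative (snd d \<circ> chart_inv c) (at (snd c p)) (snd \<xi> c)"
  shows "\<xi> \<in> tangent_space A p"
proof -
  obtain \<eta> where \<xi>: "\<xi> = (p, \<eta>)" using assms(1) by (metis prod.collapse)
  show ?thesis
    using assms(2-4) unfolding \<xi> tangent_space_def tangent_bundle_def mem_Collect_eq prod.case fst_conv snd_conv
    by blast
qed

lemma tangent_bundleD: "\<xi> \<in> tangent_bundle A \<Longrightarrow> \<xi> \<in> tangent_space A (fst \<xi>)"
  by (simp add: tangent_space_def)

text \<open>A transition map is the coordinate expression of the identity map, so facts about smooth
  maps apply to it. The next two lemmas use the same observation.\<close>

lemma transition_derivative_linear:
  assumes A: "smooth_atlas A" and "c \<in> A" "p \<in> fst c" "d \<in> A" "p \<in> fst d"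
  shows "linear (frechet_derivative (snd d \<circ> chart_inv c) (at (snd c p)))"
  using chart_derivative_linear[OF A A smooth_near_id[OF A] assms(2,3) assms(4,5)] carrierI[OF assms(2,3)]
  by (simp add: o_def)

text \<open>Chain rule with the identity as first factor: a differential does not depend on the
  source chart in which it is computed.\<close>

lemma transition_derivative_chain:
  assumes A: "smooth_atlas A" and B: "smooth_atlas B" and f: "smooth_near A B f p"
    and c: "c \<in> A" "p \<in> fst c" and c': "c' \<in> A" "p \<in> fst c'" and d: "d \<in> B" "f p \<in> fst d"
  shows "frechet_derivative (snd d \<circ> f \<circ> chart_inv c') (at (snd c' p))
      (frechet_derivative (snd c' \<circ> chart_inv c) (at (snd c p)) v) =
    frechet_derivative (snd d \<circ> f \<circ> chart_inv c) (at (snd c p)) v"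
  using chart_derivative_chain[OF A A B smooth_near_id[OF A carrierI[OF c]] f c c' d, of v]
  by (simp add: o_def)

text \<open>Chain rule with the identity as second factor: the components of an image vector obey
  the transformation law of tangent vectors.\<close>

lemma derivative_transition_chain:
  assumes A: "smooth_atlas A" and B: "smooth_atlas B" and f: "smooth_near A B f p"
    and c: "c \<in> A" "p \<in> fst c" and d: "d \<in> B" "f p \<in> fst d" and d': "d' \<in> B" "f p \<in> fst d'"
  shows "frechet_derivative (snd d' \<circ> chart_inv d) (at (snd d (f p)))
      (frechet_derivative (snd d \<circ> f \<circ> chart_inv c) (at (snd c p)) v) =
    frechet_derivative (snd d' \<circ> f \<circ> chart_inv c) (at (snd c p)) v"
  using chart_derivative_chain[OF A B B f smooth_near_id[OF B carrierI[OF d]] c d d', of v]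
  by (simp add: o_def)

text \<open>\<open>tmap\<close> computes in a source chart picked by choice. The transformation law
  of \<open>\<xi>\<close> and the chain rule replace it by any chart at the base point.\<close>

lemma tmap_component:
  assumes A: "smooth_atlas A" and B: "smooth_atlas B" and f: "smooth_near A B f p"
    and \<xi>: "\<xi> \<in> tangent_space A p" and c: "c \<in> A" "p \<in> fst c" and d: "d \<in> B" "f p \<in> fst d"
  shows "snd (tmap A B f \<xi>) d = frechet_derivative (snd d \<circ> f \<circ> chart_inv c) (at (snd c p)) (snd \<xi> c)"
proof -
  define c0 where "c0 = (SOME c. c \<in> A \<and> p \<in> fst c)"
  have c0: "c0 \<in> A" "p \<in> fst c0" using someI[of "\<lambda>c. c \<in> A \<and> p \<in> fst c" c] c by (auto simp: c0_def)
  have "snd (tmap A B f \<xi>) d = frechet_derivative (snd d \<circ> f \<circ> chart_inv c0) (at (snd c0 p)) (snd \<xi> c0)"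
    using d tangent_spaceD(1)[OF \<xi>] by (simp add: tmap_def Let_def c0_def)
  also have "snd \<xi> c0 = frechet_derivative (snd c0 \<circ> chart_inv c) (at (snd c p)) (snd \<xi> c)"
    by (rule tangent_spaceD(5)[OF \<xi> c c0])
  finally show ?thesis unfolding transition_derivative_chain[OF A B f c c0 d] .
qed

lemma fst_tmap: "fst (tmap A B f \<xi>) = f (fst \<xi>)"
  by (simp add: tmap_def Let_def)

lemma tmap_outside: "d \<notin> B \<or> f (fst \<xi>) \<notin> fst d \<Longrightarrow> snd (tmap A B f \<xi>) d = 0"
  by (auto simp: tmap_def Let_def)

lemma tmap_in_tangent_space:
  assumes A: "smooth_atlas A" and B: "smooth_atlas B" and f: "smooth_near A B f p"
    and \<xi>: "\<xi> \<in> tangent_space A p"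
  shows "tmap A B f \<xi> \<in> tangent_space B (f p)"
proof (rule tangent_spaceI)
  show "fst (tmap A B f \<xi>) = f p" by (simp add: fst_tmap tangent_spaceD(1)[OF \<xi>])
  show "f p \<in> carrier B" using smooth_near_carrier(2)[OF f] .
  show "snd (tmap A B f \<xi>) d = 0" if "d \<notin> B \<or> f p \<notin> fst d" for d
    using tmap_outside that tangent_spaceD(1)[OF \<xi>] by metis
  fix d d' assume d: "d \<in> B" "f p \<in> fst d" and d': "d' \<in> B" "f p \<in> fst d'"
  obtain c where c: "c \<in> A" "p \<in> fst c" using tangent_spaceD(2)[OF \<xi>] by (rule carrierE)
  show "snd (tmap A B f \<xi>) d' =
      frechet_derivative (snd d' \<circ> chart_inv d) (at (snd d (f p))) (snd (tmap A B f \<xi>) d)"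
    unfolding tmap_component[OF A B f \<xi> c d] tmap_component[OF A B f \<xi> c d']
    by (rule derivative_transition_chain[OF A B f c d d', symmetric])
qed

text \<open>One component determines the vector: transition derivatives give the components in the
  other charts at the point, and the convention of zero elsewhere fixes the rest.\<close>

lemma tangent_space_eqI:
  assumes \<xi>: "\<xi> \<in> tangent_space A p" and \<eta>: "\<eta> \<in> tangent_space A p"
    and c: "c \<in> A" "p \<in> fst c" and eq: "snd \<xi> c = snd \<eta> c"
  shows "\<xi> = \<eta>"
proof (rule prod_eqI)
  show "fst \<xi> = fst \<eta>" using \<xi> \<eta> by (simp add: tangent_spaceD(1))
  have "snd \<xi> d = snd \<eta> d" for d
    using tangent_spaceD(4,5)[OF \<xi>] tangent_spaceD(4,5)[OF \<eta>] c eq by metis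
  then show "snd \<xi> = snd \<eta>" by (rule ext)
qed

lemma tangent_space_tzero:
  assumes A: "smooth_atlas A" and p: "p \<in> carrier A"
  shows "tzero p \<in> tangent_space A p"
  using linear_0[OF transition_derivative_linear[OF A]] p
  by (intro tangent_spaceI) (simp_all add: tzero_def)

lemma tangent_space_tadd:
  assumes A: "smooth_atlas A" and \<xi>: "\<xi> \<in> tangent_space A p" and \<eta>: "\<eta> \<in> tangent_space A p"
  shows "tadd \<xi> \<eta> \<in> tangent_space A p"
proof (rule tangent_spaceI)
  fix c d assume c: "c \<in> A" "p \<in> fst c" and d: "d \<in> A" "p \<in> fst d"
  show "snd (tadd \<xi> \<eta>) d = frechet_derivative (snd d \<circ> chart_inv c) (at (snd c p)) (snd (tadd \<xi> \<eta>) c)"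
    using linear_add[OF transition_derivative_linear[OF A c d]] tangent_spaceD(5)[OF \<xi> c d]
      tangent_spaceD(5)[OF \<eta> c d] by (simp add: tadd_def)
qed (use tangent_spaceD[OF \<xi>] tangent_spaceD[OF \<eta>] in \<open>auto simp: tadd_def\<close>)

lemma tangent_space_tscale:
  assumes A: "smooth_atlas A" and \<xi>: "\<xi> \<in> tangent_space A p"
  shows "tscale r \<xi> \<in> tangent_space A p"
proof (rule tangent_spaceI)
  fix c d assume c: "c \<in> A" "p \<in> fst c" and d: "d \<in> A" "p \<in> fst d"
  show "snd (tscale r \<xi>) d = frechet_derivative (snd d \<circ> chart_inv c) (at (snd c p)) (snd (tscale r \<xi>) c)"
    using linear_scale[OF transition_derivative_linear[OF A c d]] tangent_spaceD(5)[OF \<xi> c d]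
    by (simp add: tscale_def)
qed (use tangent_spaceD[OF \<xi>] in \<open>auto simp: tscale_def\<close>)

lemma tmap_tadd:
  assumes A: "smooth_atlas A" and B: "smooth_atlas B" and f: "smooth_near A B f p"
    and \<xi>: "\<xi> \<in> tangent_space A p" and \<eta>: "\<eta> \<in> tangent_space A p"
  shows "tmap A B f (tadd \<xi> \<eta>) = tadd (tmap A B f \<xi>) (tmap A B f \<eta>)"
proof -
  obtain c where c: "c \<in> A" "p \<in> fst c" using tangent_spaceD(2)[OF \<xi>] by (rule carrierE)
  obtain d where d: "d \<in> B" "f p \<in> fst d" using smooth_near_carrier(2)[OF f] by (rule carrierE)
  note tm = tmap_in_tangent_space[OF A B f]
  have "snd (tmap A B f (tadd \<xi> \<eta>)) d = snd (tadd (tmap A B f \<xi>) (tmap A B f \<eta>)) d"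
    using tmap_component[OF A B f _ c d] \<xi> \<eta> tangent_space_tadd[OF A \<xi> \<eta>]
      linear_add[OF chart_derivative_linear[OF A B f c d]] by (simp add: tadd_def)
  then show ?thesis
    by (rule tangent_space_eqI[OF tm[OF tangent_space_tadd[OF A \<xi> \<eta>]]
          tangent_space_tadd[OF B tm[OF \<xi>] tm[OF \<eta>]] d])
qed

lemma tmap_tzero:
  assumes A: "smooth_atlas A" and B: "smooth_atlas B" and f: "smooth_near A B f p"
  shows "tmap A B f (tzero p) = tzero (f p)"
proof -
  note p = smooth_near_carrier[OF f]
  obtain c where c: "c \<in> A" "p \<in> fst c" using p(1) by (rule carrierE)
  obtain d where d: "d \<in> B" "f p \<in> fst d" using p(2) by (rule carrierE)
  have "snd (tmap A B f (tzero p)) d = snd (tzero (f p)) d"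
    using tmap_component[OF A B f tangent_space_tzero[OF A p(1)] c d]
      linear_0[OF chart_derivative_linear[OF A B f c d]] by (simp add: tzero_def)
  then show ?thesis
    by (rule tangent_space_eqI[OF tmap_in_tangent_space[OF A B f tangent_space_tzero[OF A p(1)]]
          tangent_space_tzero[OF B p(2)] d])
qed

text \<open>The inverse of reading off a component in the chart \<open>c\<close>; it supplies
  existence wherever a tangent vector with a given component is wanted.\<close>

definition tangent_of :: "('a, 'e::real_normed_vector) atlas \<Rightarrow> ('a, 'e) chart \<Rightarrow> 'a \<Rightarrow> 'e \<Rightarrow> ('a, 'e) tvec" where
  "tangent_of A c p v = (p, \<lambda>d. if d \<in> A \<and> p \<in> fst d
     then frechet_derivative (snd d \<circ> chart_inv c) (at (snd c p)) v else 0)"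

lemma tangent_of:
  assumes A: "smooth_atlas A" and c: "c \<in> A" "p \<in> fst c"
  shows "tangent_of A c p v \<in> tangent_space A p" "snd (tangent_of A c p v) c = v"
proof -
  show "tangent_of A c p v \<in> tangent_space A p"
  proof (rule tangent_spaceI)
    fix d d' assume d: "d \<in> A" "p \<in> fst d" and d': "d' \<in> A" "p \<in> fst d'"
    then show "snd (tangent_of A c p v) d' =
        frechet_derivative (snd d' \<circ> chart_inv d) (at (snd d p)) (snd (tangent_of A c p v) d)"
      using derivative_transition_chain[OF A A smooth_near_id[OF A carrierI[OF c]] c d d', of v]
      by (simp add: tangent_of_def o_def)
  qed (use carrierI[OF c] in \<open>auto simp: tangent_of_def\<close>)
  show "snd (tangent_of A c p v) c = v"
    using c chart_derivative_same[OF A c] by (simp add: tangent_of_def)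
qed

lemma projection_derivatives:
  assumes A: "smooth_atlas A" and B: "smooth_atlas B" and c: "c \<in> A" "p \<in> fst c" and d: "d \<in> B" "q \<in> fst d"
    and e: "e = (fst c \<times> fst d, map_prod (snd c) (snd d))"
  shows "frechet_derivative (snd c \<circ> fst \<circ> chart_inv e) (at (snd e (p, q))) v = fst v"
    and "frechet_derivative (snd d \<circ> snd \<circ> chart_inv e) (at (snd e (p, q))) v = snd v"
proof -
  note AB = smooth_atlas_prod[OF A B]
  have eAB: "e \<in> prod_atlas A B" unfolding e by (rule prod_atlasI[OF c(1) d(1)])
  note inv = chart_inv_chart[OF AB eAB] and o = smooth_atlasD(3)[OF AB eAB]
  have pq: "snd e (p, q) \<in> snd e ` fst e" using c d by (auto simp: e)
  have "fst x = (snd c \<circ> fst \<circ> chart_inv e) x \<and> snd x = (snd d \<circ> snd \<circ> chart_inv e) x"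
    if "x \<in> snd e ` fst e" for x
    using that inv by (auto simp: e)
  then have *: "\<And>x. x \<in> snd e ` fst e \<Longrightarrow> fst x = (snd c \<circ> fst \<circ> chart_inv e) x"
    and **: "\<And>x. x \<in> snd e ` fst e \<Longrightarrow> snd x = (snd d \<circ> snd \<circ> chart_inv e) x" by blast+
  show "frechet_derivative (snd c \<circ> fst \<circ> chart_inv e) (at (snd e (p, q))) v = fst v"
    using frechet_derivative_at[OF has_derivative_transform_within_open[OF
        bounded_linear_imp_has_derivative[OF bounded_linear_fst] o pq *]] by metis
  show "frechet_derivative (snd d \<circ> snd \<circ> chart_inv e) (at (snd e (p, q))) v = snd v"
    using frechet_derivative_at[OF has_derivative_transform_within_open[OF
        bounded_linear_imp_has_derivative[OF bounded_linear_snd] o pq **]] by metis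
qed

text \<open>\<open>tpair\<close> is a definite description, so existence and uniqueness have to come
  first. In a product chart the differentials of the projections are the two halves of the
  component, so these halves can be prescribed and determine the vector.\<close>

lemma tpair_in_tangent_space:
  assumes A: "smooth_atlas A" and B: "smooth_atlas B"
    and \<xi>: "\<xi> \<in> tangent_space A p" and \<eta>: "\<eta> \<in> tangent_space B q"
  shows "tpair A B \<xi> \<eta> \<in> tangent_space (prod_atlas A B) (p, q)"
proof -
  let ?P = "prod_atlas A B"
  note AB = smooth_atlas_prod[OF A B]
  obtain c where c: "c \<in> A" "p \<in> fst c" using tangent_spaceD(2)[OF \<xi>] by (rule carrierE)
  obtain d where d: "d \<in> B" "q \<in> fst d" using tangent_spaceD(2)[OF \<eta>] by (rule carrierE)
  define e where "e = (fst c \<times> fst d, map_prod (snd c) (snd d))"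
  have e: "e \<in> ?P" "(p, q) \<in> fst e" using c d prod_atlasI[OF c(1) d(1)] by (auto simp: e_def)
  note pr = smooth_near_projections[OF A B carrierI[OF e]]
  have fst_iff: "tmap ?P A fst \<zeta> = \<xi> \<longleftrightarrow> fst (snd \<zeta> e) = snd \<xi> c" if \<zeta>: "\<zeta> \<in> tangent_space ?P (p, q)" for \<zeta>
    using tangent_space_eqI[OF tmap_in_tangent_space[OF AB A pr(1) \<zeta>], of \<xi> c] \<xi> c
      tmap_component[OF AB A pr(1) \<zeta> e, of c] projection_derivatives(1)[OF A B c d e_def] by auto
  have snd_iff: "tmap ?P B snd \<zeta> = \<eta> \<longleftrightarrow> snd (snd \<zeta> e) = snd \<eta> d" if \<zeta>: "\<zeta> \<in> tangent_space ?P (p, q)" for \<zeta>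
    using tangent_space_eqI[OF tmap_in_tangent_space[OF AB B pr(2) \<zeta>], of \<eta> d] \<eta> d
      tmap_component[OF AB B pr(2) \<zeta> e, of d] projection_derivatives(2)[OF A B c d e_def] by auto
  define \<zeta>0 where "\<zeta>0 = tangent_of ?P e (p, q) (snd \<xi> c, snd \<eta> d)"
  note \<zeta>0 = tangent_of[OF AB e, of "(snd \<xi> c, snd \<eta> d)", folded \<zeta>0_def]
  have "tpair A B \<xi> \<eta> = \<zeta>0"
    unfolding tpair_def
  proof (rule the_equality)
    show "\<zeta>0 \<in> tangent_bundle ?P \<and> tmap ?P A fst \<zeta>0 = \<xi> \<and> tmap ?P B snd \<zeta>0 = \<eta>"
      using fst_iff[OF \<zeta>0(1)] snd_iff[OF \<zeta>0(1)] \<zeta>0(2) tangent_spaceD(3)[OF \<zeta>0(1)] by simp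
    fix \<zeta> assume \<zeta>: "\<zeta> \<in> tangent_bundle ?P \<and> tmap ?P A fst \<zeta> = \<xi> \<and> tmap ?P B snd \<zeta> = \<eta>"
    \<comment> \<open>The description only places \<open>\<zeta>\<close> in the tangent bundle; its
      base point is recovered from the base points of its two images.\<close>
    then have "fst (fst \<zeta>) = p" "snd (fst \<zeta>) = q"
      using fst_tmap[of ?P A fst \<zeta>] fst_tmap[of ?P B snd \<zeta>] tangent_spaceD(1)[OF \<xi>] tangent_spaceD(1)[OF \<eta>]
      by simp_all
    then have "fst \<zeta> = (p, q)" by (simp add: prod_eq_iff)
    then have \<zeta>': "\<zeta> \<in> tangent_space ?P (p, q)" using \<zeta> tangent_bundleD by metis
    show "\<zeta> = \<zeta>0"
      using \<zeta> fst_iff[OF \<zeta>'] snd_iff[OF \<zeta>'] \<zeta>0(2)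
      by (intro tangent_space_eqI[OF \<zeta>' \<zeta>0(1) e]) (simp add: prod_eq_iff)
  qed
  then show ?thesis using \<zeta>0(1) by simp
qed

section \<open>The tangent bundle as a manifold\<close>

abbreviation tangent_chart :: "('a, 'e::real_normed_vector) atlas \<Rightarrow> ('a, 'e) chart \<Rightarrow> (('a, 'e) tvec, 'e \<times> 'e) chart" where
  "tangent_chart A c \<equiv> ({\<xi> \<in> tangent_bundle A. fst \<xi> \<in> fst c}, \<lambda>\<xi>. (snd c (fst \<xi>), snd \<xi> c))"

lemma tangent_chart_inj:
  assumes A: "smooth_atlas A" and c: "c \<in> A"
  shows "inj_on (snd (tangent_chart A c)) (fst (tangent_chart A c))"
proof (rule inj_onI)
  fix \<xi> \<eta> assume \<xi>: "\<xi> \<in> fst (tangent_chart A c)" and \<eta>: "\<eta> \<in> fst (tangent_chart A c)"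
    and eq: "snd (tangent_chart A c) \<xi> = snd (tangent_chart A c) \<eta>"
  then have "fst \<xi> = fst \<eta>" using inj_onD[OF smooth_atlasD(2)[OF A c], of "fst \<xi>" "fst \<eta>"] by auto
  then show "\<xi> = \<eta>"
    using \<xi> \<eta> eq by (intro tangent_space_eqI[OF _ _ c, of _ "fst \<xi>"]) (auto simp: tangent_space_def)
qed

text \<open>The full second factor comes from \<open>tangent_of\<close>, which realises every vector
  of the model space as a component.\<close>

lemma tangent_chart_image:
  assumes A: "smooth_atlas A" and c: "c \<in> A" and U: "U \<subseteq> fst c"
  shows "snd (tangent_chart A c) ` {\<xi> \<in> tangent_bundle A. fst \<xi> \<in> U} = snd c ` U \<times> UNIV"
proof
  show "snd c ` U \<times> UNIV \<subseteq> snd (tangent_chart A c) ` {\<xi> \<in> tangent_bundle A. fst \<xi> \<in> U}"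
  proof
    fix z assume "z \<in> snd c ` U \<times> (UNIV :: 'b set)"
    then obtain p v where p: "p \<in> U" and z: "z = (snd c p, v)" by auto
    have pc: "p \<in> fst c" using p U by blast
    note t = tangent_of[OF A c pc, of v]
    have "z = snd (tangent_chart A c) (tangent_of A c p v)"
      using t(2) tangent_spaceD(1)[OF t(1)] by (simp add: z)
    moreover have "tangent_of A c p v \<in> {\<xi> \<in> tangent_bundle A. fst \<xi> \<in> U}"
      using tangent_spaceD(1,3)[OF t(1)] p by simp
    ultimately show "z \<in> snd (tangent_chart A c) ` {\<xi> \<in> tangent_bundle A. fst \<xi> \<in> U}"
      by (rule image_eqI)
  qed
qed auto

lemma tangent_atlasE:
  assumes "e \<in> tangent_atlas A"
  obtains c where "c \<in> A" "e = tangent_chart A c"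
  using assms by (auto simp: tangent_atlas_def)

lemma tangent_atlasI: "c \<in> A \<Longrightarrow> tangent_chart A c \<in> tangent_atlas A"
  by (auto simp: tangent_atlas_def)

lemma carrier_tangent_atlas: "carrier (tangent_atlas A) = tangent_bundle A"
proof -
  have "carrier (tangent_atlas A) = {\<xi> \<in> tangent_bundle A. fst \<xi> \<in> carrier A}"
    unfolding carrier_def tangent_atlas_def by auto
  then show ?thesis using tangent_spaceD(2)[OF tangent_bundleD] by blast
qed

text \<open>If t is a transition map of the base, the one between tangent charts is (x, v) to (t x,
  Dt(x) v). Its second half is smooth by \<open>smooth_on_derivative\<close>.\<close>

lemma smooth_atlas_tangent:
  fixes A :: "('a, 'e::real_normed_vector) atlas"
  assumes A: "smooth_atlas A"
  shows "smooth_atlas (tangent_atlas A)"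
  unfolding smooth_atlas_def
proof (intro conjI ballI)
  show "finite_dimensional TYPE('e \<times> 'e)"
    by (rule finite_dimensional_prod[OF smooth_atlasD(1)[OF A] smooth_atlasD(1)[OF A]])
  fix e assume "e \<in> tangent_atlas A"
  then obtain c where c: "c \<in> A" and e: "e = tangent_chart A c" by (rule tangent_atlasE)
  show inj: "inj_on (snd e) (fst e)" unfolding e by (rule tangent_chart_inj[OF A c])
  have "snd e ` fst e = snd c ` fst c \<times> UNIV" using tangent_chart_image[OF A c order_refl] by (simp add: e)
  then show "open (snd e ` fst e)" using smooth_atlasD(3)[OF A c] by (simp add: open_Times)
  fix e' assume "e' \<in> tangent_atlas A"
  then obtain c' where c': "c' \<in> A" and e': "e' = tangent_chart A c'" by (rule tangent_atlasE)
  have "fst e \<inter> fst e' = {\<xi> \<in> tangent_bundle A. fst \<xi> \<in> fst c \<inter> fst c'}" by (auto simp: e e')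
  then have im: "snd e ` (fst e \<inter> fst e') = snd c ` (fst c \<inter> fst c') \<times> UNIV"
    using tangent_chart_image[OF A c, of "fst c \<inter> fst c'"] by (simp add: e)
  show o: "open (snd e ` (fst e \<inter> fst e'))"
    unfolding im by (intro open_Times smooth_atlasD(4)[OF A] c c' open_UNIV)
  let ?S = "snd c ` (fst c \<inter> fst c')" and ?t = "snd c' \<circ> chart_inv c"
  note oS = smooth_atlasD(4)[OF A c c'] and t = smooth_atlasD(5)[OF A c c']
  have o': "open (?S \<times> (UNIV :: 'e set))" using oS by (simp add: open_Times)
  have "smooth_on (?S \<times> (UNIV :: 'e set)) (\<lambda>z. ?t (fst z))"
    by (rule smooth_on_compose[OF smooth_atlasD(1)[OF A] o' _ smooth_on_linear[OF o' bounded_linear_fst] t]) auto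
  from smooth_on_Pair[OF o' this smooth_on_derivative[OF smooth_atlasD(1)[OF A] oS t]]
  show "smooth_on (snd e ` (fst e \<inter> fst e')) (snd e' \<circ> chart_inv e)"
    unfolding im
  proof (rule smooth_on_cong[OF o', rotated])
    fix z assume "z \<in> ?S \<times> (UNIV :: 'e set)"
    then obtain \<xi> where \<xi>: "\<xi> \<in> fst e" "\<xi> \<in> fst e'" "z = snd e \<xi>" unfolding im[symmetric] by blast
    then have "\<xi> \<in> tangent_space A (fst \<xi>)" and p: "fst \<xi> \<in> fst c" "fst \<xi> \<in> fst c'"
      by (auto simp: e e' tangent_space_def)
    from tangent_spaceD(5)[OF this(1) c p(1) c' p(2)]
    have *: "snd \<xi> c' = frechet_derivative ?t (at (snd c (fst \<xi>))) (snd \<xi> c)" .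
    have "chart_inv e z = \<xi>" unfolding chart_inv_def \<xi>(3) using inj \<xi>(1) by (rule inv_into_f_f)
    then show "(?t (fst z), frechet_derivative ?t (at (fst z)) (snd z)) = (snd e' \<circ> chart_inv e) z"
      using chart_inv_chart[OF A c p(1)] * unfolding \<xi>(3) by (simp add: e e')
  qed
qed

lemma smooth_near_base_point:
  assumes A: "smooth_atlas A" and \<xi>: "\<xi> \<in> tangent_bundle A"
  shows "smooth_near (tangent_atlas A) A fst \<xi>"
proof -
  obtain c where c: "c \<in> A" "fst \<xi> \<in> fst c" using tangent_spaceD(2)[OF tangent_bundleD[OF \<xi>]] by (rule carrierE)
  define e where "e = tangent_chart A c"
  have e: "e \<in> tangent_atlas A" unfolding e_def by (rule tangent_atlasI[OF c(1)])
  note TA = smooth_atlas_tangent[OF A]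
  note o = smooth_atlasD(3)[OF TA e]
  have "smooth_on (snd e ` fst e) (snd c \<circ> fst \<circ> chart_inv e)"
  proof (rule smooth_on_cong[OF o _ smooth_on_linear[OF o bounded_linear_fst]])
    fix x assume "x \<in> snd e ` fst e"
    then obtain \<eta> where \<eta>: "\<eta> \<in> fst e" "x = snd e \<eta>" by blast
    then show "fst x = (snd c \<circ> fst \<circ> chart_inv e) x"
      using chart_inv_chart[OF TA e \<eta>(1)] by (simp add: e_def)
  qed
  then show ?thesis
    by (rule smooth_nearI[OF e c(1) mfd_open_chart[OF TA e], rotated -1]) (use \<xi> c in \<open>auto simp: e_def\<close>)
qed

lemma smooth_near_tzero:
  assumes A: "smooth_atlas A" and p: "p \<in> carrier A"
  shows "smooth_near A (tangent_atlas A) tzero p"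
proof -
  obtain c where c: "c \<in> A" "p \<in> fst c" using p by (rule carrierE)
  note o = smooth_atlasD(3)[OF A c(1)]
  have "smooth_on (snd c ` fst c) (snd (tangent_chart A c) \<circ> tzero \<circ> chart_inv c)"
    by (rule smooth_on_cong[OF o _ smooth_on_Pair[OF o smooth_on_id[OF o] smooth_on_const[OF o]]])
      (use chart_inv_chart[OF A c(1)] in \<open>auto simp: tzero_def\<close>)
  moreover have "tzero ` fst c \<subseteq> fst (tangent_chart A c)"
    using tangent_spaceD(3)[OF tangent_space_tzero[OF A carrierI[OF c(1)]]] by (auto simp: tzero_def)
  ultimately show ?thesis
    using smooth_nearI[OF c(1) tangent_atlasI[OF c(1)] mfd_open_chart[OF A c(1)] c(2)] by blast
qed

lemma smooth_near_const:
  assumes A: "smooth_atlas A" and B: "smooth_atlas B" and p: "p \<in> carrier A" and q: "q \<in> carrier B"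
  shows "smooth_near A B (\<lambda>_. q) p"
proof -
  obtain c where c: "c \<in> A" "p \<in> fst c" using p by (rule carrierE)
  obtain d where d: "d \<in> B" "q \<in> fst d" using q by (rule carrierE)
  show ?thesis
    by (rule smooth_nearI[OF c(1) d(1) mfd_open_chart[OF A c(1)] c(2)])
      (use d(2) smooth_on_const[OF smooth_atlasD(3)[OF A c(1)], of "snd d q"] in \<open>auto simp: o_def\<close>)
qed

section \<open>Maps on submanifolds and their differentials\<close>

lemma smooth_map_on_extension:
  assumes "smooth_map_on A B S f" "p \<in> S"
  obtains F where "smooth_near A B F p" "F p = f p" "extends_near A B S f p F"
proof -
  obtain F where F: "extends_near A B S f p F" using assms by (auto simp: smooth_map_on_def)
  then have "F p = f p" using assms(2) by (auto simp: extends_near_def)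
  then show thesis using that F by (auto simp: extends_near_def)
qed

text \<open>When the submanifold is the whole carrier, a local extension coincides with
  \<open>f\<close> near the point, so \<open>f\<close> itself inherits smoothness.\<close>

lemma smooth_map_smooth_near:
  assumes A: "smooth_atlas A" and f: "smooth_map A B f" and p: "p \<in> carrier A"
  shows "smooth_near A B f p"
proof -
  obtain F W where F: "smooth_near A B F p" and W: "mfd_open A W" "p \<in> W" "\<And>q. q \<in> W \<inter> carrier A \<Longrightarrow> F q = f q"
    using f p by (auto simp: smooth_map_on_def extends_near_def)
  show ?thesis
    using W(1) by (intro smooth_near_cong[OF A F W(1,2)] W(3)) (auto simp: mfd_open_def)
qed

text \<open>This isolates what is known about the extension behind \<open>tmap_on\<close>: it is
  smooth near the point and, the point lying in \<open>S\<close>, has the right value there. The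
  next two lemmas are derived from exactly this.\<close>

lemma tmap_on_choice:
  assumes F: "extends_near A B S f p F" and p: "p \<in> S" and \<xi>: "\<xi> \<in> tangent_space A p"
  obtains F' where "smooth_near A B F' p" "F' p = f p" "tmap_on A B S f \<xi> = tmap A B F' \<xi>"
proof -
  define F' where "F' = (SOME F. extends_near A B S f p F)"
  have "extends_near A B S f p F'" unfolding F'_def using F by (rule someI[where P = "extends_near A B S f p"])
  then have "smooth_near A B F' p" "F' p = f p" using p by (auto simp: extends_near_def)
  then show thesis using that[of F'] tangent_spaceD(1)[OF \<xi>] by (simp add: tmap_on_def F'_def)
qed

lemma tmap_on_in_tangent_space:
  assumes A: "smooth_atlas A" and B: "smooth_atlas B" and F: "extends_near A B S f p F"
    and p: "p \<in> S" and \<xi>: "\<xi> \<in> tangent_space A p"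
  shows "tmap_on A B S f \<xi> \<in> tangent_space B (f p)"
proof -
  obtain F' where F': "smooth_near A B F' p" "F' p = f p" "tmap_on A B S f \<xi> = tmap A B F' \<xi>"
    using tmap_on_choice[OF F p \<xi>] by blast
  show ?thesis using tmap_in_tangent_space[OF A B F'(1) \<xi>] by (simp add: F')
qed

lemma tmap_on_tzero:
  assumes A: "smooth_atlas A" and B: "smooth_atlas B" and F: "extends_near A B S f p F" and p: "p \<in> S"
  shows "tmap_on A B S f (tzero p) = tzero (f p)"
proof -
  have "p \<in> carrier A" using F smooth_near_carrier(1) by (auto simp: extends_near_def)
  then obtain F' where F': "smooth_near A B F' p" "F' p = f p"
    "tmap_on A B S f (tzero p) = tmap A B F' (tzero p)"
    using tmap_on_choice[OF F p tangent_space_tzero[OF A]] by blast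
  show ?thesis using tmap_tzero[OF A B F'(1)] by (simp add: F')
qed

section \<open>Transports and quasi-connections\<close>

locale bundle_with_connection =
  fixes G :: "('g, 'f::real_normed_vector, 'x, 'e::real_normed_vector) lie_groupoid"
    and P :: "('p, 'k::real_normed_vector, 'm, 'l::real_normed_vector, 'x, 'g) pbundle"
    and H :: "('g, 'f) tvec set"
  assumes groupoid: "is_lie_groupoid G"
    and principal: "principal_bundle G P"
    and connection: "ehresmann_connection G H"
begin

abbreviation "At \<equiv> At_groupoid G P H"
abbreviation "Ad \<equiv> Ad_groupoid G P H"

lemma atlases [simp, intro]:
  "smooth_atlas (arrs G)" "smooth_atlas (objs G)" "smooth_atlas (tot P)"
  using groupoid principal by (auto simp: is_lie_groupoid_def principal_bundle_def intro: manifold_imp_smooth_atlas)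

lemma structure_smooth_near:
  shows "g \<in> X1 G \<Longrightarrow> smooth_near (arrs G) (objs G) (src G) g"
    and "g \<in> X1 G \<Longrightarrow> smooth_near (arrs G) (objs G) (tgt G) g"
    and "g \<in> X1 G \<Longrightarrow> smooth_near (arrs G) (arrs G) (ivs G) g"
    and "p \<in> carrier (tot P) \<Longrightarrow> smooth_near (tot P) (objs G) (anc P) p"
  using groupoid principal
  by (auto simp: is_lie_groupoid_def principal_bundle_def right_action_def submersion_def
      intro: smooth_map_smooth_near)

lemma act_smooth:
  "smooth_map_on (prod_atlas (tot P) (arrs G)) (tot P) (actable G P) (\<lambda>(p, g). act P p g)"
  using principal by (simp add: principal_bundle_def right_action_def)

lemma unit:
  assumes "x \<in> X0 G"
  shows "unt G x \<in> X1 G" "src G (unt G x) = x" "tgt G (unt G x) = x"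
  using groupoid assms by (auto simp: is_lie_groupoid_def)

lemma inverse:
  assumes "g \<in> X1 G"
  shows "ivs G g \<in> X1 G" "src G (ivs G g) = tgt G g" "tgt G (ivs G g) = src G g"
    "mul G g (ivs G g) = unt G (tgt G g)" "mul G (ivs G g) g = unt G (src G g)"
  using groupoid assms by (auto simp: is_lie_groupoid_def)

lemma mul_unit:
  assumes "g \<in> X1 G"
  shows "mul G (unt G (tgt G g)) g = g" "mul G g (unt G (src G g)) = g"
  using groupoid assms by (auto simp: is_lie_groupoid_def)

lemma mul_assoc:
  assumes "g \<in> X1 G" "h \<in> X1 G" "k \<in> X1 G" "src G g = tgt G h" "src G h = tgt G k"
  shows "mul G (mul G g h) k = mul G g (mul G h k)"
  using groupoid assms by (auto simp: is_lie_groupoid_def composable_def)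

lemma mul_closed:
  assumes "g \<in> X1 G" "h \<in> X1 G" "src G g = tgt G h"
  shows "mul G g h \<in> X1 G" "tgt G (mul G g h) = tgt G g"
  using groupoid assms by (auto simp: is_lie_groupoid_def composable_def)

lemma anchor: "p \<in> carrier (tot P) \<Longrightarrow> anc P p \<in> X0 G"
  by (rule smooth_near_carrier(2)[OF structure_smooth_near(4)])

text \<open>Needed because \<open>transport\<close> lifts at \<open>ivs G g\<close> and then applies
  the differential of inversion, so the resulting vector sits over the double inverse of
  \<open>g\<close>.\<close>

lemma inverse_inverse:
  assumes g: "g \<in> X1 G"
  shows "ivs G (ivs G g) = g"
proof -
  note k = inverse[OF g] and l = inverse[OF inverse(1)[OF g]]
  have "g = mul G g (mul G (ivs G g) (ivs G (ivs G g)))"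
    using l(4) k(3) mul_unit(2)[OF g] by simp
  also have "\<dots> = mul G (mul G g (ivs G g)) (ivs G (ivs G g))"
    using mul_assoc[OF g k(1) l(1)] k(3) l(3) by simp
  also have "\<dots> = ivs G (ivs G g)" using k l mul_unit(1)[OF l(1)] by simp
  finally show ?thesis by simp
qed

lemma inverse_unit:
  assumes x: "x \<in> X0 G"
  shows "ivs G (unt G x) = unt G x"
  using mul_unit(1)[OF inverse(1)[OF unit(1)[OF x]]] inverse[OF unit(1)[OF x]] unit[OF x] by simp

lemma actableD:
  assumes "(p, g) \<in> actable G P"
  shows "p \<in> carrier (tot P)" "g \<in> X1 G" "tgt G g = anc P p"
    "act P p g \<in> carrier (tot P)" "anc P (act P p g) = src G g" "proj P (act P p g) = proj P p"
  using assms principal unfolding principal_bundle_def right_action_def actable_def by auto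

lemma actableI: "p \<in> carrier (tot P) \<Longrightarrow> g \<in> X1 G \<Longrightarrow> tgt G g = anc P p \<Longrightarrow> (p, g) \<in> actable G P"
  by (simp add: actable_def)

lemma act_unit: "p \<in> carrier (tot P) \<Longrightarrow> act P p (unt G (anc P p)) = p"
  using principal by (simp add: principal_bundle_def right_action_def)

lemma act_free:
  assumes "(p, g) \<in> actable G P" "(p, h) \<in> actable G P" "act P p g = act P p h"
  shows "g = h"
proof -
  have "inj_on (\<lambda>(p, g). (p, act P p g)) (actable G P)"
    using principal by (simp add: principal_bundle_def diffeo_on_def bij_betw_def)
  from inj_onD[OF this _ assms(1,2)] assms(3) show ?thesis by simp
qed

text \<open>\<open>hlift\<close> is an \<open>inv_into\<close>, so its value is controlled only if
  the given vector is hit by the horizontal space. The submersion property gives some preimage;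
  removing its vertical part leaves a horizontal one with the same image.\<close>

lemma hlift_tangent:
  assumes g: "g \<in> X1 G" and v: "v \<in> tangent_space (objs G) (src G g)"
  shows "hlift G H g v \<in> tangent_space (arrs G) g"
proof -
  note s = structure_smooth_near(1)[OF g]
  have HT: "fibre_of H g \<subseteq> tangent_space (arrs G) g"
    using connection by (auto simp: ehresmann_connection_def smooth_subbundle_def fibre_of_def tangent_space_def)
  have "d_src G ` tangent_space (arrs G) g = tangent_space (objs G) (src G g)"
    using groupoid g by (simp add: is_lie_groupoid_def submersion_def d_src_def)
  then obtain \<xi> where \<xi>: "\<xi> \<in> tangent_space (arrs G) g" "d_src G \<xi> = v" using v by (metis imageE)
  have "\<exists>\<eta>\<kappa>. fst \<eta>\<kappa> \<in> fibre_of H g \<and> snd \<eta>\<kappa> \<in> ker_dsrc G g \<and> \<xi> = tadd (fst \<eta>\<kappa>) (snd \<eta>\<kappa>)"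
    using connection g \<xi>(1) unfolding ehresmann_connection_def by blast
  then obtain \<eta> \<kappa> where \<eta>: "\<eta> \<in> fibre_of H g" and \<kappa>: "\<kappa> \<in> ker_dsrc G g" and eq: "\<xi> = tadd \<eta> \<kappa>"
    by blast
  have \<kappa>': "\<kappa> \<in> tangent_space (arrs G) g" "d_src G \<kappa> = tzero (src G g)"
    using \<kappa> by (auto simp: ker_dsrc_def)
  have "v = tadd (d_src G \<eta>) (d_src G \<kappa>)"
    using tmap_tadd[OF _ _ s _ \<kappa>'(1), of \<eta>] \<eta> HT \<xi>(2) by (auto simp: d_src_def eq)
  then have "v = d_src G \<eta>" unfolding \<kappa>'(2) by (simp add: tadd_def tzero_def)
  then have "inv_into (fibre_of H g) (d_src G) v \<in> fibre_of H g" using \<eta> by (intro inv_into_into) blast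
  then show ?thesis using HT by (auto simp: hlift_def)
qed

lemma lam1_tangent:
  assumes pg: "(p, g) \<in> actable G P" and v: "v \<in> tangent_space (objs G) (anc P p)"
  shows "lam1 G H (ivs G g) v \<in> tangent_space (objs G) (anc P (act P p g))"
proof -
  note a = actableD[OF pg] and i = inverse[OF actableD(2)[OF pg]]
  have "hlift G H (ivs G g) v \<in> tangent_space (arrs G) (ivs G g)"
    using v a i by (intro hlift_tangent) auto
  from tmap_in_tangent_space[OF _ _ structure_smooth_near(2)[OF i(1)] this]
  show ?thesis using a i by (simp add: lam1_def d_tgt_def)
qed

text \<open>The argument follows base points: the lift lies over \<open>ivs G g\<close>, inversion
  moves it to \<open>g\<close>, the pair lies over (p, g), and the action takes that point to
  \<open>act P p g\<close>.\<close>

lemma transport_tangent: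
  assumes pg: "(p, g) \<in> actable G P" and u: "u \<in> tangent_space (tot P) p"
  shows "transport G P H g u \<in> tangent_space (tot P) (act P p g)"
proof -
  note a = actableD[OF pg] and i = inverse[OF actableD(2)[OF pg]]
  have "tmap (tot P) (objs G) (anc P) u \<in> tangent_space (objs G) (anc P p)"
    by (intro tmap_in_tangent_space[OF _ _ structure_smooth_near(4) u] a atlases)
  then have "hlift G H (ivs G g) (tmap (tot P) (objs G) (anc P) u) \<in> tangent_space (arrs G) (ivs G g)"
    using a i by (intro hlift_tangent) auto
  from tmap_in_tangent_space[OF _ _ structure_smooth_near(3)[OF i(1)] this]
  have "d_ivs G (hlift G H (ivs G g) (tmap (tot P) (objs G) (anc P) u)) \<in> tangent_space (arrs G) g"
    by (simp add: d_ivs_def inverse_inverse a)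
  from tpair_in_tangent_space[OF _ _ u this]
  have z: "tpair (tot P) (arrs G) u (d_ivs G (hlift G H (ivs G g) (tmap (tot P) (objs G) (anc P) u)))
      \<in> tangent_space (prod_atlas (tot P) (arrs G)) (p, g)" by simp
  obtain F where F: "extends_near (prod_atlas (tot P) (arrs G)) (tot P) (actable G P) (\<lambda>(p, g). act P p g) (p, g) F"
    using smooth_map_on_extension[OF act_smooth pg] by blast
  show ?thesis
    using tmap_on_in_tangent_space[OF smooth_atlas_prod _ F pg z] by (simp add: transport_def d_act_def)
qed

text \<open>An extension of the action near (p, unit) is pulled back along h to (p, ivs h), which is
  smooth on all arrows. It agrees with the orbit map on the source fibre of \<open>anc P p\<close>,
  since there the inverse of h has target \<open>anc P p\<close> and may act on p.\<close>

lemma orbit_extension: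
  assumes p: "p \<in> carrier (tot P)"
  obtains F where
    "extends_near (arrs G) (tot P) {h \<in> X1 G. src G h = anc P p} (\<lambda>h. act P p (ivs G h)) (unt G (anc P p)) F"
proof -
  let ?e = "unt G (anc P p)" and ?A = "prod_atlas (tot P) (arrs G)"
  note e = unit[OF anchor[OF p]]
  have AP: "smooth_atlas ?A" by (simp add: smooth_atlas_prod)
  have pe: "(p, ivs G ?e) \<in> actable G P" using p e inverse[OF e(1)] by (intro actableI) auto
  obtain F where F: "smooth_near ?A (tot P) F (p, ivs G ?e)"
    and eF: "extends_near ?A (tot P) (actable G P) (\<lambda>(p, g). act P p g) (p, ivs G ?e) F"
    using smooth_map_on_extension[OF act_smooth pe] by blast
  obtain V where V: "mfd_open ?A V" "(p, ivs G ?e) \<in> V" "\<And>z. z \<in> V \<inter> actable G P \<Longrightarrow> F z = (\<lambda>(p, g). act P p g) z"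
    using eF by (auto simp: extends_near_def)
  have j: "smooth_near (arrs G) ?A (\<lambda>h. (p, ivs G h)) ?e"
    by (intro smooth_near_Pair smooth_near_const structure_smooth_near atlases e p)
  obtain W where W: "mfd_open (arrs G) W" "?e \<in> W" "(\<lambda>h. (p, ivs G h)) ` W \<subseteq> V"
    using smooth_near_preimage[OF atlases(1) AP j V(1,2)] by blast
  have "F (p, ivs G h) = act P p (ivs G h)" if "h \<in> W" "h \<in> X1 G" "src G h = anc P p" for h
    using V(3)[of "(p, ivs G h)"] that W(3) p inverse[of h] by (auto intro: actableI)
  moreover have "smooth_near (arrs G) (tot P) (\<lambda>h. F (p, ivs G h)) ?e"
    by (rule smooth_near_compose[OF atlases(1) AP j F])
  ultimately show thesis using W(1,2) by (intro that[of "\<lambda>h. F (p, ivs G h)"]) (auto simp: extends_near_def)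
qed

text \<open>Inversion fixes a unit and units act trivially, so the orbit map sends the unit to p,
  and the differential takes values over p.\<close>

lemma d_orbit_tangent:
  assumes p: "p \<in> carrier (tot P)"
  shows "\<alpha> \<in> algebroid G (anc P p) \<Longrightarrow> d_orbit G P p \<alpha> \<in> tangent_space (tot P) p"
    and "d_orbit G P p (tzero (unt G (anc P p))) = tzero p"
proof -
  note e = unit[OF anchor[OF p]]
  obtain F where F: "extends_near (arrs G) (tot P) {h \<in> X1 G. src G h = anc P p} (\<lambda>h. act P p (ivs G h))
      (unt G (anc P p)) F"
    using orbit_extension[OF p] by blast
  have e': "unt G (anc P p) \<in> {h \<in> X1 G. src G h = anc P p}" using e by simp
  have pe: "act P p (ivs G (unt G (anc P p))) = p" using act_unit[OF p] inverse_unit[OF anchor[OF p]] by simp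
  show "d_orbit G P p \<alpha> \<in> tangent_space (tot P) p" if "\<alpha> \<in> algebroid G (anc P p)"
    using tmap_on_in_tangent_space[OF _ _ F e', of \<alpha>] that pe by (simp add: d_orbit_def algebroid_def ker_dsrc_def)
  show "d_orbit G P p (tzero (unt G (anc P p))) = tzero p"
    using tmap_on_tzero[OF _ _ F e'] pe by (simp add: d_orbit_def)
qed

lemma tzero_algebroid:
  assumes x: "x \<in> X0 G"
  shows "tzero (unt G x) \<in> algebroid G x"
  using tangent_space_tzero[OF atlases(1) unit(1)[OF x]] unit[OF x]
    tmap_tzero[OF _ _ structure_smooth_near(1)[OF unit(1)[OF x]]]
  by (simp add: algebroid_def ker_dsrc_def d_src_def)

lemma At_simps:
  "(p, u, v) \<in> Obj At \<longleftrightarrow>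
     p \<in> carrier (tot P) \<and> u \<in> tangent_space (tot P) p \<and> v \<in> tangent_space (objs G) (anc P p)"
  "(x, g) \<in> Arr At \<longleftrightarrow> x \<in> Obj At \<and> (fst x, g) \<in> actable G P"
  "Dom At = fst" "Cod At ((p, u, v), g) = (act P p g, transport G P H g u, lam1 G H (ivs G g) v)"
  "Idt At x = (x, unt G (anc P (fst x)))" "Cmp At (y, h) (x, g) = (x, mul G g h)"
  by (auto simp: At_groupoid_def transport_groupoid_def Let_def)

lemma Ad_simps:
  "(p, \<alpha>, v) \<in> Obj Ad \<longleftrightarrow>
     p \<in> carrier (tot P) \<and> \<alpha> \<in> algebroid G (anc P p) \<and> v \<in> tangent_space (objs G) (anc P p)"
  "(x', g) \<in> Arr Ad \<longleftrightarrow> x' \<in> Obj Ad \<and> (fst x', g) \<in> actable G P"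
  "Dom Ad = fst" "Cod Ad ((p, \<alpha>, v), g) = (act P p g, lam0 G H (ivs G g) \<alpha>, lam1 G H (ivs G g) v)"
  "Idt Ad x' = (x', unt G (anc P (fst x')))" "Cmp Ad (y', h) (x', g) = (x', mul G g h)"
  by (auto simp: Ad_groupoid_def transport_groupoid_def Let_def)

lemma At_Cod: "f \<in> Arr At \<Longrightarrow> Cod At f \<in> Obj At"
proof -
  assume f: "f \<in> Arr At"
  obtain p u v g where "f = ((p, u, v), g)" by (metis prod_cases3 surj_pair)
  then show ?thesis using f lam1_tangent transport_tangent actableD(4) by (auto simp: At_simps)
qed

lemma At_Obj_oadd:
  assumes "x \<in> Obj At" "y \<in> Obj At" "fst x = fst y"
  shows "oadd x y \<in> Obj At"
proof (cases x, cases y)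
  fix p u v q u' v' assume "x = (p, u, v)" "y = (q, u', v')"
  then show ?thesis using assms by (auto simp: At_simps oadd_def intro: tangent_space_tadd)
qed

lemma At_Obj_oscale:
  assumes "x \<in> Obj At"
  shows "oscale r x \<in> Obj At"
  using assms by (cases x) (auto simp: At_simps oscale_def intro: tangent_space_tscale)

lemma At_zero:
  assumes u: "u \<in> tangent_space (tot P) p"
  shows "(p, u, tzero (anc P p)) \<in> Obj At"
  using u tangent_spaceD(2)[OF u] anchor by (auto simp: At_simps intro: tangent_space_tzero)

lemma d_orbit0_At:
  assumes "x \<in> Obj Ad"
  shows "d_orbit0 G P x \<in> Obj At" "fst (d_orbit0 G P x) = fst x"
  using assms d_orbit_tangent(1) by (cases x; auto simp: At_simps Ad_simps d_orbit0_def)+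

end

text \<open>A functor that lifts arrows maps the orbit of an object onto the orbit of its image, so taking
  images induces the map on isomorphism classes; no composition of arrows is involved.\<close>

lemma induces_linear_mapI:
  assumes obj: "\<And>x. x \<in> Obj C \<Longrightarrow> F0 x \<in> Obj D \<and> fst (F0 x) = fst x"
    and arr: "\<And>f. f \<in> Arr C \<Longrightarrow> Dom C f \<in> Obj C \<and> Cod C f \<in> Obj C \<and>
      F1 f \<in> Arr D \<and> Dom D (F1 f) = F0 (Dom C f) \<and> Cod D (F1 f) = F0 (Cod C f)"
    and lift: "\<And>x h. x \<in> Obj C \<Longrightarrow> h \<in> Arr D \<Longrightarrow> Dom D h = F0 x \<Longrightarrow> \<exists>f\<in>Arr C. Dom C f = x \<and> F1 f = h"
    and add: "\<And>x y. x \<in> Obj C \<Longrightarrow> y \<in> Obj C \<Longrightarrow> fst x = fst y \<Longrightarrow>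
      oadd x y \<in> Obj C \<and> F0 (oadd x y) = oadd (F0 x) (F0 y)"
    and scale: "\<And>r x. x \<in> Obj C \<Longrightarrow> oscale r x \<in> Obj C \<and> F0 (oscale r x) = oscale r (F0 x)"
  shows "induces_linear_map C D F0"
proof -
  have iso: "F0 ` iso_class C x = iso_class D (F0 x)" if x: "x \<in> Obj C" for x
  proof
    show "F0 ` iso_class C x \<subseteq> iso_class D (F0 x)"
      using obj arr by (fastforce simp: iso_class_def)
    show "iso_class D (F0 x) \<subseteq> F0 ` iso_class C x"
    proof
      fix y assume "y \<in> iso_class D (F0 x)"
      then obtain h where "h \<in> Arr D" "Dom D h = F0 x" "Cod D h = y" by (auto simp: iso_class_def)
      then obtain f where f: "f \<in> Arr C" "Dom C f = x" "y = F0 (Cod C f)" using lift[OF x] arr by metis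
      then have "Cod C f \<in> iso_class C x" using arr by (auto simp: iso_class_def)
      then show "y \<in> F0 ` iso_class C x" using f(3) by blast
    qed
  qed
  show ?thesis
    unfolding induces_linear_map_def
  proof (intro bexI[of _ "image F0"] conjI ballI allI impI)
    show "image F0 \<in> conn C \<rightarrow> conn D" using iso obj by (auto simp: conn_def)
    show "F0 ` iso_class C x = iso_class D (F0 x)" if "x \<in> Obj C" for x using iso[OF that] .
    show "conn_sum D (F0 ` K) (F0 ` L) (F0 ` N)" if KLN: "conn_sum C K L N" for K L N
    proof -
      obtain f y where f: "f \<in> Arr C" and y: "y \<in> Obj C" "fst y = fst (Cod C f)"
        and K: "K = iso_class C (Dom C f)" and L: "L = iso_class C y"
        and N: "N = iso_class C (oadd (Cod C f) y)"
        using KLN unfolding conn_sum_def by blast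
      note a = arr[OF f] and o = add[OF conjunct1[OF conjunct2[OF arr[OF f]]] y(1) y(2)[symmetric]]
      have "fst (F0 y) = fst (Cod D (F1 f))" using a obj y by metis
      moreover have "F0 ` K = iso_class D (Dom D (F1 f))" using a iso K by metis
      moreover have "F0 ` L = iso_class D (F0 y)" using iso y L by metis
      moreover have "F0 ` N = iso_class D (oadd (Cod D (F1 f)) (F0 y))" using a o iso N by metis
      ultimately show ?thesis unfolding conn_sum_def using a obj[OF y(1)] by blast
    qed
    show "conn_scale D r (F0 ` K) (F0 ` N)" if KN: "conn_scale C r K N" for r K N
    proof -
      obtain x where x: "x \<in> Obj C" "K = iso_class C x" "N = iso_class C (oscale r x)"
        using KN unfolding conn_scale_def by blast
      then have "F0 ` K = iso_class D (F0 x)" "F0 ` N = iso_class D (oscale r (F0 x))"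
        using iso scale[OF x(1), of r] by metis+
      then show ?thesis unfolding conn_scale_def using obj[OF x(1)] by blast
    qed
  qed
qed

section \<open>From connection forms to quasi-connections\<close>

context bundle_with_connection
begin

context
  fixes \<omega>
  assumes \<omega>: "connection_form G P H \<omega>"
begin

abbreviation "Form0 \<equiv> form_functor0 G P H \<omega>"
abbreviation "Form1 \<equiv> form_functor1 G P H \<omega>"

lemma connection_formD:
  assumes u: "u \<in> tangent_space (tot P) p"
  shows "fst (\<omega> u) = p" "snd (\<omega> u) \<in> algebroid G (anc P p)"
    "u' \<in> tangent_space (tot P) p \<Longrightarrow> snd (\<omega> (tadd u u')) = tadd (snd (\<omega> u)) (snd (\<omega> u'))"
    "snd (\<omega> (tscale r u)) = tscale r (snd (\<omega> u))"
    "(p, g) \<in> actable G P \<Longrightarrow> snd (\<omega> (transport G P H g u)) = lam0 G H (ivs G g) (snd (\<omega> u))"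
  using \<omega> u tangent_spaceD(2,3)[OF u] unfolding connection_form_def by blast+

lemma connection_form_d_orbit:
  "p \<in> carrier (tot P) \<Longrightarrow> \<alpha> \<in> algebroid G (anc P p) \<Longrightarrow> snd (\<omega> (d_orbit G P p \<alpha>)) = \<alpha>"
  using \<omega> unfolding connection_form_def by blast

lemma form_functor0_apply: "(p, u, v) \<in> Obj At \<Longrightarrow> Form0 (p, u, v) = (p, snd (\<omega> u), v)"
  by (simp add: form_functor0_def)

lemma form_functor1_apply: "(x, g) \<in> Arr At \<Longrightarrow> Form1 (x, g) = (Form0 x, g)"
  by (cases x) (simp add: form_functor1_def At_simps(2) form_functor0_apply)

lemma form_functor0_Obj: "x \<in> Obj At \<Longrightarrow> Form0 x \<in> Obj Ad \<and> fst (Form0 x) = fst x"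
  by (cases x) (auto simp: form_functor0_apply At_simps Ad_simps connection_formD(2))

lemma form_functor1_Arr:
  assumes "f \<in> Arr At"
  shows "Form1 f \<in> Arr Ad \<and> Dom Ad (Form1 f) = Form0 (Dom At f) \<and> Cod Ad (Form1 f) = Form0 (Cod At f)"
proof -
  obtain p u v g where f: "f = ((p, u, v), g)" by (metis prod_cases3 surj_pair)
  with assms have x: "(p, u, v) \<in> Obj At" and pg: "(p, g) \<in> actable G P" and u: "u \<in> tangent_space (tot P) p"
    by (auto simp: At_simps)
  have "Form1 f = ((p, snd (\<omega> u), v), g)"
    using form_functor1_apply assms form_functor0_apply[OF x] by (simp add: f)
  moreover have "Form0 (Cod At f) = (act P p g, lam0 G H (ivs G g) (snd (\<omega> u)), lam1 G H (ivs G g) v)"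
    using At_Cod[OF assms] connection_formD(5)[OF u pg] by (simp add: f At_simps(4) form_functor0_apply)
  ultimately show ?thesis
    using form_functor0_Obj[OF x] form_functor0_apply[OF x] pg by (simp add: f At_simps(3) Ad_simps(2-4))
qed

lemma form_functor0_linear:
  "x \<in> Obj At \<Longrightarrow> y \<in> Obj At \<Longrightarrow> fst x = fst y \<Longrightarrow> Form0 (oadd x y) = oadd (Form0 x) (Form0 y)"
  "x \<in> Obj At \<Longrightarrow> Form0 (oscale r x) = oscale r (Form0 x)"
proof -
  show "Form0 (oadd x y) = oadd (Form0 x) (Form0 y)" if xy: "x \<in> Obj At" "y \<in> Obj At" "fst x = fst y"
  proof (cases x, cases y)
    fix p u v q u' v' assume eq: "x = (p, u, v)" "y = (q, u', v')"
    with xy have "u \<in> tangent_space (tot P) p" "u' \<in> tangent_space (tot P) p" by (auto simp: At_simps)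
    from connection_formD(3)[OF this] show ?thesis
      using form_functor0_apply xy At_Obj_oadd[OF xy] by (simp add: eq oadd_def)
  qed
  show "Form0 (oscale r x) = oscale r (Form0 x)" if x: "x \<in> Obj At"
  proof (cases x)
    fix p u v assume eq: "x = (p, u, v)"
    with x have "u \<in> tangent_space (tot P) p" by (auto simp: At_simps)
    from connection_formD(4)[OF this] show ?thesis
      using form_functor0_apply x At_Obj_oscale[OF x] by (simp add: eq oscale_def)
  qed
qed

text \<open>A local extension of \<open>\<omega>\<close> around the middle component, together with
  the outer components, is the required extension of the functor on the ambient product.\<close>

lemma form_functor0_smooth:
  "smooth_map_on (prod_atlas (tot P) (prod_atlas (tangent_atlas (tot P)) (tangent_atlas (objs G))))
     (prod_atlas (tot P) (prod_atlas (tangent_atlas (arrs G)) (tangent_atlas (objs G)))) (Obj At) Form0"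
  (is "smooth_map_on ?A ?B _ _")
proof -
  let ?TP = "tangent_atlas (tot P)" and ?TX = "tangent_atlas (objs G)" and ?TG = "tangent_atlas (arrs G)"
  have T: "smooth_atlas ?TP" "smooth_atlas ?TX" "smooth_atlas ?TG" by (simp_all add: smooth_atlas_tangent)
  note TT = smooth_atlas_prod[OF T(1,2)]
  note AA = smooth_atlas_prod[OF atlases(3) TT]
  have sub: "Obj At \<subseteq> carrier ?A"
  proof
    fix x assume "x \<in> Obj At"
    then show "x \<in> carrier ?A"
      by (cases x) (auto simp: At_simps carrier_prod_atlas carrier_tangent_atlas tangent_space_def)
  qed
  have "\<exists>F. extends_near ?A ?B (Obj At) Form0 z F" if z: "z \<in> Obj At" for z
  proof -
    have zA: "z \<in> carrier ?A" using z sub by blast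
    have u: "fst (snd z) \<in> tangent_bundle (tot P)"
      using zA by (auto simp: carrier_prod_atlas carrier_tangent_atlas)
    note pr = smooth_near_projections[OF atlases(3) TT zA]
    have zT: "snd z \<in> carrier (prod_atlas ?TP ?TX)" using zA by (auto simp: carrier_prod_atlas)
    note pr' = smooth_near_projections[OF T(1,2) zT]
    have p1: "smooth_near ?A ?TP (\<lambda>z. fst (snd z)) z" by (rule smooth_near_compose[OF AA TT pr(2) pr'(1)])
    have p2: "smooth_near ?A ?TX (\<lambda>z. snd (snd z)) z" by (rule smooth_near_compose[OF AA TT pr(2) pr'(2)])
    have \<omega>_smooth: "smooth_map_on ?TP (prod_atlas (tot P) ?TG) (tangent_bundle (tot P)) \<omega>"
      using \<omega> by (simp add: connection_form_def)
    obtain \<Omega> where \<Omega>: "smooth_near ?TP (prod_atlas (tot P) ?TG) \<Omega> (fst (snd z))"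
      and e\<Omega>: "extends_near ?TP (prod_atlas (tot P) ?TG) (tangent_bundle (tot P)) \<omega> (fst (snd z)) \<Omega>"
      using smooth_map_on_extension[OF \<omega>_smooth u] by blast
    obtain V where V: "mfd_open ?TP V" "fst (snd z) \<in> V" "\<And>w. w \<in> V \<inter> tangent_bundle (tot P) \<Longrightarrow> \<Omega> w = \<omega> w"
      using e\<Omega> by (auto simp: extends_near_def)
    \<comment> \<open>Near \<open>z\<close> the middle component stays where the extension agrees
      with \<open>\<omega>\<close> on tangent vectors.\<close>
    obtain W where W: "mfd_open ?A W" "z \<in> W" "(\<lambda>z. fst (snd z)) ` W \<subseteq> V"
      using smooth_near_preimage[OF AA T(1) p1 V(1,2)] by blast
    note PG = smooth_atlas_prod[OF atlases(3) T(3)]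
    have \<Omega>1: "smooth_near ?A (prod_atlas (tot P) ?TG) (\<lambda>z. \<Omega> (fst (snd z))) z"
      by (rule smooth_near_compose[OF AA T(1) p1 \<Omega>])
    have \<Omega>2: "smooth_near ?A ?TG (\<lambda>z. snd (\<Omega> (fst (snd z)))) z"
      by (rule smooth_near_compose[OF AA PG \<Omega>1
            smooth_near_projections(2)[OF atlases(3) T(3) smooth_near_carrier(2)[OF \<Omega>]]])
    have "smooth_near ?A ?B (\<lambda>z. (fst z, snd (\<Omega> (fst (snd z))), snd (snd z))) z"
      by (intro smooth_near_Pair[OF AA atlases(3) smooth_atlas_prod[OF T(3,2)] pr(1)]
          smooth_near_Pair[OF AA T(3,2) \<Omega>2 p2])
    moreover have "(fst y, snd (\<Omega> (fst (snd y))), snd (snd y)) = Form0 y" if y: "y \<in> W \<inter> Obj At" for y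
    proof (cases y)
      fix p u v assume eq: "y = (p, u, v)"
      have "u \<in> V \<inter> tangent_bundle (tot P)" using y W(3) by (auto simp: eq At_simps tangent_space_def)
      then show ?thesis using V(3) y form_functor0_apply by (simp add: eq)
    qed
    ultimately show ?thesis using W(1,2)
      by (intro exI[of _ "\<lambda>z. (fst z, snd (\<Omega> (fst (snd z))), snd (snd z))"]) (auto simp: extends_near_def)
  qed
  then show ?thesis using sub by (auto simp: smooth_map_on_def)
qed

lemma form_functor0_graded:
  assumes "x \<in> Obj At"
  shows "is_tzero (snd (snd x)) \<Longrightarrow> is_tzero (snd (snd (Form0 x)))"
    and "is_tzero (fst (snd x)) \<Longrightarrow> is_tzero (fst (snd (Form0 x)))"
proof -
  obtain p u v where x: "x = (p, u, v)" by (rule prod_cases3)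
  then have u: "u \<in> tangent_space (tot P) p" using assms by (simp add: At_simps)
  note F = form_functor0_apply[OF assms[unfolded x]]
  show "is_tzero (snd (snd (Form0 x)))" if "is_tzero (snd (snd x))" using that F by (simp add: x)
  assume "is_tzero (fst (snd x))"
  \<comment> \<open>Writing the zero vector as 0 times itself turns preservation of zero into
    homogeneity of \<open>\<omega>\<close>, with the base points taken care of.\<close>
  then have "u = tscale 0 u" by (simp add: x is_tzero_def tzero_def tscale_def)
  then have "snd (\<omega> u) = tscale 0 (snd (\<omega> u))" using connection_formD(4)[OF u, of 0] by simp
  then show "is_tzero (fst (snd (Form0 x)))"
    using F by (simp add: x is_tzero_def tzero_def tscale_def)
qed

text \<open>Arrows lift because whether \<open>g\<close> may act depends on p alone, and
  \<open>Form0\<close> keeps p: an arrow by \<open>g\<close> out of \<open>Form0 x\<close> comes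
  from the arrow by \<open>g\<close> out of x. Invariance of \<open>proj\<close> under the action
  keeps codomains in the fibre over \<open>m\<close>.\<close>

lemma form_functor_induces_linear_map:
  "induces_linear_map (fibre_cat P At m) (fibre_cat P Ad m) Form0"
proof (rule induces_linear_mapI[where ?F1.0 = Form1])
  fix x assume "x \<in> Obj (fibre_cat P At m)"
  then have x: "x \<in> Obj At" "proj P (fst x) = m" by (auto simp: fibre_cat_def)
  show "Form0 x \<in> Obj (fibre_cat P Ad m) \<and> fst (Form0 x) = fst x"
    using form_functor0_Obj[OF x(1)] x(2) by (simp add: fibre_cat_def)
  show "oscale r x \<in> Obj (fibre_cat P At m) \<and> Form0 (oscale r x) = oscale r (Form0 x)" for r
    using At_Obj_oscale[OF x(1)] form_functor0_linear(2)[OF x(1)] x(2)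
    by (simp add: fibre_cat_def oscale_def split_beta)
  show "oadd x y \<in> Obj (fibre_cat P At m) \<and> Form0 (oadd x y) = oadd (Form0 x) (Form0 y)"
    if "y \<in> Obj (fibre_cat P At m)" "fst x = fst y" for y
    using that At_Obj_oadd[OF x(1)] form_functor0_linear(1)[OF x(1)] x(2)
    by (simp add: fibre_cat_def oadd_def split_beta)
  show "\<exists>f\<in>Arr (fibre_cat P At m). Dom (fibre_cat P At m) f = x \<and> Form1 f = h"
    if h: "h \<in> Arr (fibre_cat P Ad m)" "Dom (fibre_cat P Ad m) h = Form0 x" for h
  proof -
    obtain g where g: "h = (Form0 x, g)" using h(2) by (cases h) (simp add: fibre_cat_def Ad_simps)
    have "(x, g) \<in> Arr At"
      using h(1) form_functor0_Obj[OF x(1)] x(1) by (simp add: g fibre_cat_def At_simps(2) Ad_simps(2))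
    then show ?thesis
      using form_functor1_apply x(2) by (intro bexI[of _ "(x, g)"]) (auto simp: g fibre_cat_def At_simps(3))
  qed
next
  fix f assume "f \<in> Arr (fibre_cat P At m)"
  then have f: "f \<in> Arr At" "proj P (fst (fst f)) = m" by (auto simp: fibre_cat_def)
  obtain p u v g where eq: "f = ((p, u, v), g)" by (metis prod_cases3 surj_pair)
  have "(p, u, v) \<in> Obj At" "(p, g) \<in> actable G P" using f(1) by (simp_all add: eq At_simps(2))
  then show "Dom (fibre_cat P At m) f \<in> Obj (fibre_cat P At m) \<and> Cod (fibre_cat P At m) f \<in> Obj (fibre_cat P At m) \<and>
      Form1 f \<in> Arr (fibre_cat P Ad m) \<and> Dom (fibre_cat P Ad m) (Form1 f) = Form0 (Dom (fibre_cat P At m) f) \<and>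
      Cod (fibre_cat P Ad m) (Form1 f) = Form0 (Cod (fibre_cat P At m) f)"
    using At_Cod[OF f(1)] form_functor1_Arr[OF f(1)] f form_functor1_apply form_functor0_Obj actableD(6)
    by (simp add: fibre_cat_def eq At_simps(3,4))
qed

lemma form_functor_quasi_connection: "quasi_connection G P H Form0 Form1"
  unfolding quasi_connection_def
proof (intro conjI ballI)
  show "Form0 \<in> extensional (Obj At)" "Form1 \<in> extensional (Arr At)"
    by (simp_all add: form_functor0_def form_functor1_def)
  show "is_functor At Ad Form0 Form1"
    unfolding is_functor_def
  proof (intro conjI ballI impI)
    fix x assume x: "x \<in> Obj At"
    show "Form0 x \<in> Obj Ad" using form_functor0_Obj[OF x] by blast
    have "fst x \<in> carrier (tot P)" using x by (cases x) (simp add: At_simps)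
    then have "(x, unt G (anc P (fst x))) \<in> Arr At"
      using x unit[OF anchor] by (auto simp: At_simps(2) intro: actableI)
    then show "Form1 (Idt At x) = Idt Ad (Form0 x)"
      using form_functor0_Obj[OF x] form_functor1_apply by (simp add: At_simps(5) Ad_simps(5))
  next
    fix f assume f: "f \<in> Arr At"
    show "Form1 f \<in> Arr Ad" "Dom Ad (Form1 f) = Form0 (Dom At f)" "Cod Ad (Form1 f) = Form0 (Cod At f)"
      using form_functor1_Arr[OF f] by blast+
    fix h assume h: "h \<in> Arr At" and fh: "Cod At f = Dom At h"
    obtain p u v g where feq: "f = ((p, u, v), g)" by (metis prod_cases3 surj_pair)
    obtain y k where heq: "h = (y, k)" by (cases h)
    have y: "y = (act P p g, transport G P H g u, lam1 G H (ivs G g) v)"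
      using fh by (simp add: feq heq At_simps(3,4))
    have pg: "(p, g) \<in> actable G P" and qk: "(act P p g, k) \<in> actable G P"
      using f h by (simp_all add: feq heq y At_simps(2))
    \<comment> \<open>\<open>Form1\<close> is given by its formula on arrows only, so the composite
      must first be recognised as an arrow.\<close>
    have "(p, mul G g k) \<in> actable G P"
      using actableD[OF pg] actableD[OF qk] mul_closed[of g k] by (intro actableI) simp_all
    then have "((p, u, v), mul G g k) \<in> Arr At" using f by (simp add: feq At_simps(2))
    then show "Form1 (Cmp At h f) = Cmp Ad (Form1 h) (Form1 f)"
      using form_functor1_apply f h by (simp add: feq heq At_simps(6) Ad_simps(6))
  qed
  show "proj P (fst (Form0 x)) = proj P (fst x)" if "x \<in> Obj At" for x using form_functor0_Obj[OF that] by simp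
  show "proj P (fst (fst (Form1 f))) = proj P (fst (fst f))" if "f \<in> Arr At" for f
    using that form_functor1_apply form_functor0_Obj by (cases f) (simp add: At_simps(2))
  show F0_orbit: "Form0 (d_orbit0 G P x) = x" if x: "x \<in> Obj Ad" for x
    using d_orbit0_At(1)[OF x] x connection_form_d_orbit
    by (cases x) (simp add: d_orbit0_def form_functor0_apply Ad_simps)
  show "Form1 (d_orbit1 G P f) = f" if f: "f \<in> Arr Ad" for f
  proof (cases f)
    case (Pair x g)
    then have x: "x \<in> Obj Ad" "(fst x, g) \<in> actable G P" using f by (simp_all add: Ad_simps(2))
    then have "(d_orbit0 G P x, g) \<in> Arr At" using d_orbit0_At[OF x(1)] by (simp add: At_simps(2))
    then show ?thesis using form_functor1_apply F0_orbit[OF x(1)] by (simp add: Pair d_orbit1_def)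
  qed
  show "graded_bundle_map G P H Form0"
    unfolding graded_bundle_map_def
    using form_functor0_smooth form_functor0_Obj form_functor0_linear form_functor0_graded by blast
  show "induces_linear_map (fibre_cat P At m) (fibre_cat P Ad m) Form0" for m
    by (rule form_functor_induces_linear_map)
qed

end

section \<open>Recovering the connection form from a quasi-connection\<close>

lemma form_functor0_inj:
  assumes \<omega>: "connection_form G P H \<omega>" and \<omega>': "connection_form G P H \<omega>'"
    and eq: "form_functor0 G P H \<omega> = form_functor0 G P H \<omega>'"
  shows "\<omega> = \<omega>'"
proof (rule extensionalityI)
  show "\<omega> \<in> extensional (tangent_bundle (tot P))" "\<omega>' \<in> extensional (tangent_bundle (tot P))"
    using \<omega> \<omega>' by (simp_all add: connection_form_def)
  fix u assume "u \<in> tangent_bundle (tot P)"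
  then have u: "u \<in> tangent_space (tot P) (fst u)" by (rule tangent_bundleD)
  \<comment> \<open>Every tangent vector occurs in an object with zero last component, so the
    functor on objects sees all values of the form.\<close>
  have "snd (\<omega> u) = snd (\<omega>' u)"
    using form_functor0_apply[OF \<omega> At_zero[OF u]] form_functor0_apply[OF \<omega>' At_zero[OF u]] eq by simp
  then show "\<omega> u = \<omega>' u"
    using connection_formD(1)[OF \<omega> u] connection_formD(1)[OF \<omega>' u] by (simp add: prod_eq_iff)
qed

text \<open>Inserting the zero vector as last component selects objects of pure degree, so that
  \<open>F0\<close> restricts to a linear map from tangent vectors to the algebroid.\<close>

definition form_of where
  "form_of F0 = (\<lambda>u\<in>tangent_bundle (tot P). (fst u, fst (snd (F0 (fst u, u, tzero (anc P (fst u)))))))"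

context
  fixes F0 F1
  assumes quasi: "quasi_connection G P H F0 F1"
begin

lemma quasi_connectionD:
  shows "x \<in> Obj At \<Longrightarrow> F0 x \<in> Obj Ad" "x \<in> Obj At \<Longrightarrow> fst (F0 x) = fst x"
    "x \<in> Obj At \<Longrightarrow> y \<in> Obj At \<Longrightarrow> fst x = fst y \<Longrightarrow> F0 (oadd x y) = oadd (F0 x) (F0 y)"
    "x \<in> Obj At \<Longrightarrow> F0 (oscale r x) = oscale r (F0 x)"
    "x \<in> Obj At \<Longrightarrow> is_tzero (snd (snd x)) \<Longrightarrow> is_tzero (snd (snd (F0 x)))"
    "x' \<in> Obj Ad \<Longrightarrow> F0 (d_orbit0 G P x') = x'"
    "f \<in> Arr At \<Longrightarrow> F1 f \<in> Arr Ad" "f \<in> Arr At \<Longrightarrow> Dom Ad (F1 f) = F0 (Dom At f)"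
    "f \<in> Arr At \<Longrightarrow> Cod Ad (F1 f) = F0 (Cod At f)"
  using quasi unfolding quasi_connection_def graded_bundle_map_def is_functor_def by blast+

lemma quasi_connection_zero:
  assumes u: "u \<in> tangent_space (tot P) p"
  shows "F0 (p, u, tzero (anc P p)) = (p, snd (form_of F0 u), tzero (anc P p))"
    and "snd (form_of F0 u) \<in> algebroid G (anc P p)"
proof -
  let ?x = "(p, u, tzero (anc P p))"
  note x = At_zero[OF u]
  obtain q \<alpha> w where F: "F0 ?x = (q, \<alpha>, w)" by (rule prod_cases3)
  have q: "q = p" and w: "w \<in> tangent_space (objs G) (anc P p)" and \<alpha>: "\<alpha> \<in> algebroid G (anc P p)"
    using quasi_connectionD(1,2)[OF x] F by (auto simp: Ad_simps)
  have "is_tzero w" using quasi_connectionD(5)[OF x] F by (simp add: is_tzero_def tzero_def)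
  \<comment> \<open>Degree preservation says that \<open>w\<close> is some zero vector; its
    membership in the tangent space at \<open>anc P p\<close> says which one.\<close>
  then have "w = tzero (anc P p)" using tangent_spaceD(1)[OF w] by (simp add: is_tzero_def)
  moreover have "snd (form_of F0 u) = \<alpha>" using tangent_spaceD(1,3)[OF u] F by (simp add: form_of_def)
  ultimately show "F0 ?x = (p, snd (form_of F0 u), tzero (anc P p))" "snd (form_of F0 u) \<in> algebroid G (anc P p)"
    using F q \<alpha> by simp_all
qed

lemma quasi_connection_apply:
  assumes x: "(p, u, v) \<in> Obj At"
  shows "F0 (p, u, v) = (p, snd (form_of F0 u), v)"
proof -
  let ?a = "anc P p"
  have p: "p \<in> carrier (tot P)" and u: "u \<in> tangent_space (tot P) p" and v: "v \<in> tangent_space (objs G) ?a"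
    using x by (auto simp: At_simps)
  have y: "(p, tzero (unt G ?a), v) \<in> Obj Ad" using p v tzero_algebroid[OF anchor[OF p]] by (simp add: Ad_simps)
  have y': "(p, tzero p, v) \<in> Obj At" using d_orbit0_At(1)[OF y] d_orbit_tangent(2)[OF p] by (simp add: d_orbit0_def)
  have Fy: "F0 (p, tzero p, v) = (p, tzero (unt G ?a), v)"
    using quasi_connectionD(6)[OF y] d_orbit_tangent(2)[OF p] by (simp add: d_orbit0_def)
  have "tadd u (tzero p) = u" "tadd (tzero ?a) v = v" "tadd (snd (form_of F0 u)) (tzero (unt G ?a)) = snd (form_of F0 u)"
    using tangent_spaceD(1)[OF v] by (simp_all add: tadd_def tzero_def prod_eq_iff)
  then show ?thesis
    using quasi_connectionD(3)[OF At_zero[OF u] y'] quasi_connection_zero(1)[OF u] Fy by (simp add: oadd_def)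
qed

lemma form_functor0_form_of: "form_functor0 G P H (form_of F0) = F0"
proof (rule extensionalityI)
  show "F0 \<in> extensional (Obj At)" using quasi by (simp add: quasi_connection_def)
  show "form_functor0 G P H (form_of F0) \<in> extensional (Obj At)" by (simp add: form_functor0_def)
  fix x assume "x \<in> Obj At"
  then show "form_functor0 G P H (form_of F0) x = F0 x"
    using quasi_connection_apply by (cases x) (simp add: form_functor0_def)
qed

lemma quasi_connection_arrow:
  assumes f: "(x, g) \<in> Arr At"
  shows "F1 (x, g) = (F0 x, g)"
proof -
  obtain p u v where x: "x = (p, u, v)" by (rule prod_cases3)
  have xA: "(p, u, v) \<in> Obj At" and pg: "(p, g) \<in> actable G P" using f by (simp_all add: x At_simps(2))
  note Fx = quasi_connection_apply[OF xA]
  obtain g' where F1: "F1 (x, g) = (F0 x, g')"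
    using quasi_connectionD(8)[OF f] by (cases "F1 (x, g)") (simp add: At_simps(3) Ad_simps(3))
  have "(p, g') \<in> actable G P" using quasi_connectionD(7)[OF f, unfolded F1] by (simp add: Ad_simps(2) x Fx)
  \<comment> \<open>Comparing the P-components of the two codomains suffices, because
    \<open>F0\<close> covers the identity of P.\<close>
  moreover have "act P p g' = act P p g"
  proof -
    have "act P p g' = fst (Cod Ad (F0 x, g'))" by (simp add: x Fx Ad_simps(4))
    also have "\<dots> = fst (F0 (Cod At (x, g)))" using quasi_connectionD(9)[OF f] by (simp add: F1)
    also have "\<dots> = fst (Cod At (x, g))" by (rule quasi_connectionD(2)[OF At_Cod[OF f]])
    finally show ?thesis by (simp add: x At_simps(4))
  qed
  ultimately have "g' = g" using act_free pg by blast
  then show ?thesis using F1 by simp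
qed

lemma form_functor1_form_of: "form_functor1 G P H (form_of F0) = F1"
proof (rule extensionalityI)
  show "F1 \<in> extensional (Arr At)" using quasi by (simp add: quasi_connection_def)
  show "form_functor1 G P H (form_of F0) \<in> extensional (Arr At)" by (simp add: form_functor1_def)
  fix f assume f: "f \<in> Arr At"
  obtain p u v g where eq: "f = ((p, u, v), g)" by (metis prod_cases3 surj_pair)
  then have "(p, u, v) \<in> Obj At" using f by (simp add: At_simps(2))
  then show "form_functor1 G P H (form_of F0) f = F1 f"
    using quasi_connection_apply quasi_connection_arrow f by (simp add: eq form_functor1_def)
qed

text \<open>The form is \<open>F0\<close> restricted along the smooth section u to (p, u, 0) and
  then projected. Composing an extension of \<open>F0\<close> with this section and with the
  projections gives an extension of the form, valid where the section stays in the region of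
  agreement.\<close>

lemma form_of_smooth:
  "smooth_map_on (tangent_atlas (tot P)) (prod_atlas (tot P) (tangent_atlas (arrs G))) (tangent_bundle (tot P)) (form_of F0)"
proof -
  let ?TP = "tangent_atlas (tot P)" and ?TX = "tangent_atlas (objs G)" and ?TG = "tangent_atlas (arrs G)"
  let ?A = "prod_atlas (tot P) (prod_atlas ?TP ?TX)" and ?B = "prod_atlas (tot P) (prod_atlas ?TG ?TX)"
  let ?\<iota> = "\<lambda>u. (fst u, u, tzero (anc P (fst u)))"
  have T: "smooth_atlas ?TP" "smooth_atlas ?TX" "smooth_atlas ?TG" by (simp_all add: smooth_atlas_tangent)
  note TT = smooth_atlas_prod[OF T(1,2)] and GT = smooth_atlas_prod[OF T(3,2)]
  note AA = smooth_atlas_prod[OF atlases(3) TT] and BB = smooth_atlas_prod[OF atlases(3) GT]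
  have \<iota>_At: "?\<iota> u \<in> Obj At" if "u \<in> tangent_bundle (tot P)" for u by (rule At_zero[OF tangent_bundleD[OF that]])
  have "\<exists>F. extends_near ?TP (prod_atlas (tot P) ?TG) (tangent_bundle (tot P)) (form_of F0) u F"
    if u: "u \<in> tangent_bundle (tot P)" for u
  proof -
    have up: "fst u \<in> carrier (tot P)" using tangent_spaceD(2)[OF tangent_bundleD[OF u]] .
    note b = smooth_near_base_point[OF atlases(3) u]
    have a: "smooth_near ?TP (objs G) (\<lambda>u. anc P (fst u)) u"
      by (rule smooth_near_compose[OF T(1) atlases(3) b structure_smooth_near(4)[OF up]])
    have z: "smooth_near ?TP ?TX (\<lambda>u. tzero (anc P (fst u))) u"
      by (rule smooth_near_compose[OF T(1) atlases(2) a smooth_near_tzero[OF atlases(2) anchor[OF up]]])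
    have i: "smooth_near ?TP ?TP (\<lambda>u. u) u" using u by (intro smooth_near_id[OF T(1)]) (simp add: carrier_tangent_atlas)
    have \<iota>: "smooth_near ?TP ?A ?\<iota> u"
      by (intro smooth_near_Pair[OF T(1) atlases(3) TT b] smooth_near_Pair[OF T(1) T(1,2) i z])
    have "smooth_map_on ?A ?B (Obj At) F0"
      using quasi by (simp add: quasi_connection_def graded_bundle_map_def)
    then obtain F where F: "smooth_near ?A ?B F (?\<iota> u)" and eF: "extends_near ?A ?B (Obj At) F0 (?\<iota> u) F"
      using smooth_map_on_extension[OF _ \<iota>_At[OF u]] by blast
    obtain V where V: "mfd_open ?A V" "?\<iota> u \<in> V" "\<And>x. x \<in> V \<inter> Obj At \<Longrightarrow> F x = F0 x"
      using eF by (auto simp: extends_near_def)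
    obtain W where W: "mfd_open ?TP W" "u \<in> W" "?\<iota> ` W \<subseteq> V"
      using smooth_near_preimage[OF T(1) AA \<iota> V(1,2)] by blast
    let ?\<Omega> = "\<lambda>u. (fst (F (?\<iota> u)), fst (snd (F (?\<iota> u))))"
    note c = smooth_near_carrier(2)[OF F]
    have c': "snd (F (?\<iota> u)) \<in> carrier (prod_atlas ?TG ?TX)" using c by (auto simp: carrier_prod_atlas)
    have F\<iota>: "smooth_near ?TP ?B (\<lambda>u. F (?\<iota> u)) u" by (rule smooth_near_compose[OF T(1) AA \<iota> F])
    note pr = smooth_near_projections[OF atlases(3) GT c]
    have s1: "smooth_near ?TP (tot P) (\<lambda>u. fst (F (?\<iota> u))) u" by (rule smooth_near_compose[OF T(1) BB F\<iota> pr(1)])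
    have s2: "smooth_near ?TP (prod_atlas ?TG ?TX) (\<lambda>u. snd (F (?\<iota> u))) u"
      by (rule smooth_near_compose[OF T(1) BB F\<iota> pr(2)])
    have s3: "smooth_near ?TP ?TG (\<lambda>u. fst (snd (F (?\<iota> u)))) u"
      by (rule smooth_near_compose[OF T(1) GT s2 smooth_near_projections(1)[OF T(3,2) c']])
    have "smooth_near ?TP (prod_atlas (tot P) ?TG) ?\<Omega> u"
      by (rule smooth_near_Pair[OF T(1) atlases(3) T(3) s1 s3])
    moreover have "?\<Omega> w = form_of F0 w" if w: "w \<in> W \<inter> tangent_bundle (tot P)" for w
    proof -
      have "?\<iota> w \<in> V \<inter> Obj At" using w W(3) \<iota>_At by blast
      then have "F (?\<iota> w) = F0 (?\<iota> w)" by (rule V(3))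
      then show ?thesis using w quasi_connectionD(2)[OF \<iota>_At, of w] by (simp add: form_of_def)
    qed
    ultimately show ?thesis using W(1,2) by (intro exI[of _ ?\<Omega>]) (auto simp: extends_near_def)
  qed
  then show ?thesis by (simp add: smooth_map_on_def carrier_tangent_atlas)
qed

lemma form_of_connection_form: "connection_form G P H (form_of F0)"
proof -
  have fst_\<omega>: "fst (form_of F0 u) = p" if "u \<in> tangent_space (tot P) p" for u p
    using tangent_spaceD(1,3)[OF that] by (simp add: form_of_def)
  have add: "snd (form_of F0 (tadd u u')) = tadd (snd (form_of F0 u)) (snd (form_of F0 u'))"
    if u: "u \<in> tangent_space (tot P) p" and u': "u' \<in> tangent_space (tot P) p" for p u u'
    using quasi_connectionD(3)[OF At_zero[OF u] At_zero[OF u']] quasi_connection_zero(1)[OF u]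
      quasi_connection_zero(1)[OF u'] At_Obj_oadd[OF At_zero[OF u] At_zero[OF u']]
    by (simp add: oadd_def quasi_connection_apply)
  have scale: "snd (form_of F0 (tscale r u)) = tscale r (snd (form_of F0 u))" if "u \<in> tangent_bundle (tot P)" for r u
    using quasi_connectionD(4)[OF At_zero[OF tangent_bundleD[OF that]], of r]
      quasi_connection_zero(1)[OF tangent_bundleD[OF that]] At_Obj_oscale[OF At_zero[OF tangent_bundleD[OF that]], of r]
    by (simp add: oscale_def quasi_connection_apply)
  have equivariant: "snd (form_of F0 (transport G P H g u)) = lam0 G H (ivs G g) (snd (form_of F0 u))"
    if pg: "(p, g) \<in> actable G P" and u: "u \<in> tangent_space (tot P) p" for p g u
  proof -
    \<comment> \<open>The codomain of this arrow carries \<open>lam1\<close> of a zero vector as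
      last component. Since \<open>quasi_connection_apply\<close> holds for any last component, the
      value of \<open>F0\<close> there is read off directly and compared in the middle
      component.\<close>
    have f: "((p, u, tzero (anc P p)), g) \<in> Arr At" using At_zero[OF u] pg by (simp add: At_simps(2))
    show ?thesis
      using quasi_connectionD(9)[OF f] At_Cod[OF f] quasi_connection_zero(1)[OF u]
      by (simp add: quasi_connection_arrow[OF f] quasi_connection_apply At_simps(4) Ad_simps(4))
  qed
  have orbit: "snd (form_of F0 (d_orbit G P p \<alpha>)) = \<alpha>"
    if p: "p \<in> carrier (tot P)" and \<alpha>: "\<alpha> \<in> algebroid G (anc P p)" for p \<alpha>
  proof -
    have x: "(p, \<alpha>, tzero (anc P p)) \<in> Obj Ad"
      using p \<alpha> tangent_space_tzero[OF atlases(2) anchor[OF p]] by (simp add: Ad_simps)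
    show ?thesis
      using quasi_connectionD(6)[OF x] d_orbit0_At(1)[OF x] by (simp add: d_orbit0_def quasi_connection_apply)
  qed
  have "form_of F0 \<in> extensional (tangent_bundle (tot P))" by (simp add: form_of_def)
  then show ?thesis
    unfolding connection_form_def
    using fst_\<omega> add scale equivariant orbit form_of_smooth quasi_connection_zero(2) by blast
qed

end

end

theorem proposition21:
  fixes G :: "('g, 'f::real_normed_vector, 'x, 'e::real_normed_vector) lie_groupoid"
    and P :: "('p, 'k::real_normed_vector, 'm, 'l::real_normed_vector, 'x, 'g) pbundle"
    and H :: "('g, 'f) tvec set"
  assumes "is_lie_groupoid G"
    and "principal_bundle G P"
    and "cartan_connection G H"
  shows "bij_betw (\<lambda>\<omega>. (form_functor0 G P H \<omega>, form_functor1 G P H \<omega>))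
           {\<omega>. connection_form G P H \<omega>}
           {(F0, F1). quasi_connection G P H F0 F1}"
proof -
  interpret bundle_with_connection G P H
    using assms by unfold_locales (auto simp: cartan_connection_def)
  show ?thesis
    unfolding bij_betw_def
  proof
    \<comment> \<open>The functor on objects alone already determines the form.\<close>
    show "inj_on (\<lambda>\<omega>. (form_functor0 G P H \<omega>, form_functor1 G P H \<omega>)) {\<omega>. connection_form G P H \<omega>}"
      using form_functor0_inj by (auto intro: inj_onI)
    show "(\<lambda>\<omega>. (form_functor0 G P H \<omega>, form_functor1 G P H \<omega>)) ` {\<omega>. connection_form G P H \<omega>} =
        {(F0, F1). quasi_connection G P H F0 F1}"
    proof (intro equalityI subsetI)
      fix F assume "F \<in> {(F0, F1). quasi_connection G P H F0 F1}"
      then obtain F0 F1 where F: "F = (F0, F1)" "quasi_connection G P H F0 F1" by blast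
      show "F \<in> (\<lambda>\<omega>. (form_functor0 G P H \<omega>, form_functor1 G P H \<omega>)) ` {\<omega>. connection_form G P H \<omega>}"
        using form_functor0_form_of[OF F(2)] form_functor1_form_of[OF F(2)] form_of_connection_form[OF F(2)] F(1)
        by (intro image_eqI[of _ _ "form_of F0"]) simp_all
    qed (use form_functor_quasi_connection in auto)
  qed
qed

end
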